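(* Fix $m=1$. For each $\hat E<0$, there exists a time-reversible periodic regularized simultaneous binary collision (SBC) orbit \[ \gamma(s) =(u_1(s),u_2(s),u_3(s),u_4(s),v_1(s),v_2(s),v_3(s),v_4(s))\] with period $T>0$, angular momentum $A=0$, and a symmetry group isomorphic to $D_4$, for the Hamiltonian system of equations with Hamiltonian $\hat\Gamma$ (with $m=1$ and the given value of $\hat E$) on the level set $\hat\Gamma=0$, such that distinct regularized SBCs occur at $s=T/8,\,3T/8,\,5T/8,\,7T/8$. This periodic orbit corresponds to a symmetric periodic singular orbit \[ (x_1(t),\ x_2(t),\ x_3(t),\ x_4(t),\ \omega_1(t),\ \omega_2(t),\ \omega_3(t),\ \omega_4(t))\] with energy $\hat E$ for the planar pairwise symmetric four-body problem (PPS4BP) with equal masses $m=1$, where for all $t$, \[ x_4(t) = x_1(t),\quad x_3(t) = x_2(t),\quad \vert x_2(t)\vert\leq x_1(t),\quad \omega_4(t)=\omega_1(t),\quad \omega_3(t)=\omega_2(t),\] with initial conditions \[x_1(0)>0,\quad x_2(0)=0,\quad \omega_1(0)=0,\quad \omega_2(0)>0,\] and period \[ R=\int_0^{T/2} \big(u_1^2(s)+u_2^2(s)\big)\big(u_3^2(s)+u_4^2(s)\big)\ ds,\] where for $t\in[0,R]$, the only singularities are two distinct SBCs occurring at $t=R/4$ and $t=3R/4$.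
   Context: **The PPS4BP.** Four bodies in the plane with masses $1,m,1,m$ ($0<m\le 1$) have positions $(x_1,x_2)$, $(x_3,x_4)$, $(-x_1,-x_2)$, $(-x_3,-x_4)$. The momenta are $(\omega_1,\omega_2)=2(\dot x_1,\dot x_2)$, $(\omega_3,\omega_4)=2m(\dot x_3,\dot x_4)$ (and their negatives for the other two bodies), where $\dot{}=d/dt$. The Hamiltonian is $H=K-U$ with \[ K=\tfrac14(\omega_1^2+\omega_2^2)+\tfrac1{4m}(\omega_3^2+\omega_4^2),\] \[ U=\frac{1}{2\sqrt{x_1^2+x_2^2}}+\frac{2m}{\sqrt{(x_3-x_1)^2+(x_4-x_2)^2}}+\frac{2m}{\sqrt{(x_1+x_3)^2+(x_2+x_4)^2}}+\frac{m^2}{2\sqrt{x_3^2+x_4^2}},\] and the equations are $\dot x_i=\partial H/\partial\omega_i$, $\dot\omega_i=-\partial H/\partial x_i$. The energy is the value of $H$. The angular momentum is $A=x_1\omega_2-x_2\omega_1+x_3\omega_4-x_4\omega_3$. The simultaneous binary collisions (SBCs) considered are: $x_3-x_1=0=x_4-x_2$ with $x_1^2+x_2^2\neq0$; and $x_1+x_3=0=x_2+x_4$ with $x_1^2+x_2^2\ne 0$. Other singularities are the binary collisions $x_1=x_2=0$ with $x_3^2+x_4^2\neq 0$, or $x_3=x_4=0$ with $x_1^2+x_2^2\neq 0$, and total collapse $x_1=x_2=x_3=x_4=0$. A singular orbit is one having collisions, continued through its SBCs by means of the regularization below; relations involving the $\omega_i$ are understood at times other than collision times. **Regularized coordinates.**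 The coordinates $(u,v)=(u_1,\dots,u_4,v_1,\dots,v_4)$ are related to $(x,\omega)$ through intermediate $(g,h)$ by \[ g_1=x_1-x_3,\ g_2=x_2-x_4,\ g_3=x_1+x_3,\ g_4=x_2+x_4,\] \[ \omega_1=h_1+h_3,\ \omega_2=h_2+h_4,\ \omega_3=h_3-h_1,\ \omega_4=h_4-h_2,\] \[ g_1=u_1^2-u_2^2,\ g_2=2u_1u_2,\ g_3=u_3^2-u_4^2,\ g_4=2u_3u_4,\] \[ v_1=2h_1u_1+2h_2u_2,\ v_2=-2h_1u_2+2h_2u_1,\ v_3=2h_3u_3+2h_4u_4,\ v_4=-2h_3u_4+2h_4u_3.\] Time $t$ and regularized time $s$ are related by $dt/ds=(u_1^2+u_2^2)(u_3^2+u_4^2)$, with $t=0$ at $s=0$. "Corresponds" means via these coordinate and time changes. In these coordinates $A=\frac12[-v_1u_2+v_2u_1-v_3u_4+v_4u_3]$. **The Hamiltonian $\hat\Gamma$.** Put $M_1=v_1u_1-v_2u_2$, $M_2=v_1u_2+v_2u_1$, $M_3=v_3u_3-v_4u_4$, $M_4=v_3u_4+v_4u_3$, $M_5=u_1^2-u_2^2+u_3^2-u_4^2$, $M_6=2u_1u_2+2u_3u_4$, $M_7=u_1^2-u_2^2-u_3^2+u_4^2$, $M_8=2u_1u_2-2u_3u_4$. For a constant $\hat E$, \begin{align*}\hat\Gamma=&\tfrac1{16}\big(1+\tfrac1m\big)\big((v_1^2+v_2^2)(u_3^2+u_4^2)+(v_3^2+v_4^2)(u_1^2+u_2^2)\big)+\tfrac18\big(1-\tfrac1m\big)(M_3M_1+M_4M_2)\\&-\frac{(u_1^2+u_2^2)(u_3^2+u_4^2)}{\sqrt{M_5^2+M_6^2}}-2m(u_1^2+u_2^2+u_3^2+u_4^2)-\frac{m^2(u_1^2+u_2^2)(u_3^2+u_4^2)}{\sqrt{M_7^2+M_8^2}}-\hat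 E(u_1^2+u_2^2)(u_3^2+u_4^2).\end{align*} The Hamiltonian system with Hamiltonian $\hat\Gamma$ is $u_i'=\partial\hat\Gamma/\partial v_i$, $v_i'=-\partial\hat\Gamma/\partial u_i$, $i=1,2,3,4$, with ${}'=d/ds$, on the set where $M_5^2+M_6^2\ne0$ and $M_7^2+M_8^2\neq0$. A regularized SBC is a point of an orbit at which $u_1^2+u_2^2=0$ and $u_3^2+u_4^2\neq0$, or $u_3^2+u_4^2=0$ and $u_1^2+u_2^2\ne0$. **Symmetries.** Let $D_4=\langle a,b:a^2=b^4=(ab)^2=e\rangle$. The linear maps \[ S_F(u,v)=(-u_3,u_4,u_1,-u_2,-v_3,v_4,v_1,-v_2),\quad S_G(u,v)=(-u_1,-u_2,u_3,u_4,v_1,v_2,-v_3,-v_4)\] leave $\hat\Gamma$ invariant and generate a group isomorphic to $D_4$. If $\gamma(s)$ is a solution, so are $S_F\gamma(s)$ (time-preserving symmetry) and $S_G\gamma(-s)$ (time-reversing symmetry). The symmetry group of a periodic solution $\gamma$ is the group of those $S$ in the group generated by $S_F,S_G$ for which there is a constant $c$ with $S\gamma(s)=\gamma(s+c)$ for all $s$ (time-preserving) or $S\gamma(s)=\gamma(c-s)$ for all $s$ (time-reversing). The orbit is time-reversible if it has a time-reversing symmetry. *)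

theory Defs
  imports "HOL-Analysis.Analysis" "HOL-Algebra.Bij" "HOL-Algebra.Generated_Groups"
begin

section \<open>Hamiltonian systems\<close>

text \<open>A phase point is a pair \<open>(q, p)\<close> of positions and momenta. It is \<open>(x, \<omega>)\<close> in the
  original coordinates and \<open>(u, v)\<close> in the regularized ones.\<close>

type_synonym phase = "(real^4) \<times> (real^4)"

lemma vector_4 [simp]:
  "(vector [w,x,y,z] :: 'a::zero^4) $ 1 = w"
  "(vector [w,x,y,z] :: 'a::zero^4) $ 2 = x"
  "(vector [w,x,y,z] :: 'a::zero^4) $ 3 = y"
  "(vector [w,x,y,z] :: 'a::zero^4) $ 4 = z"
  unfolding vector_def by simp_all

text \<open>\<open>c\<close> satisfies \<open>q\<^sub>i' = \<partial>H/\<partial>p\<^sub>i\<close>, \<open>p\<^sub>i' = - \<partial>H/\<partial>q\<^sub>i\<close> at every time in \<open>I\<close>. The pair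
  \<open>(Hq, Hp)\<close> is the gradient of \<open>H\<close>; it is part of the condition that \<open>H\<close> is differentiable
  at the points concerned.\<close>

definition solves_hamiltonian :: "(phase \<Rightarrow> real) \<Rightarrow> (real \<Rightarrow> phase) \<Rightarrow> real set \<Rightarrow> bool" where
  "solves_hamiltonian H c I \<longleftrightarrow>
     (\<forall>s\<in>I. \<exists>Hq Hp. GDERIV H (c s) :> (Hq, Hp) \<and> (c has_vector_derivative (Hp, - Hq)) (at s))"


section \<open>The planar pairwise symmetric four-body problem\<close>

definition kinetic :: "real \<Rightarrow> real^4 \<Rightarrow> real" where
  "kinetic m \<omega> = 1/4 * ((\<omega>$1)\<^sup>2 + (\<omega>$2)\<^sup>2) + 1/(4*m) * ((\<omega>$3)\<^sup>2 + (\<omega>$4)\<^sup>2)"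

definition potential :: "real \<Rightarrow> real^4 \<Rightarrow> real" where
  "potential m x =
     1 / (2 * sqrt ((x$1)\<^sup>2 + (x$2)\<^sup>2))
     + 2*m / sqrt ((x$3 - x$1)\<^sup>2 + (x$4 - x$2)\<^sup>2)
     + 2*m / sqrt ((x$1 + x$3)\<^sup>2 + (x$2 + x$4)\<^sup>2)
     + m\<^sup>2 / (2 * sqrt ((x$3)\<^sup>2 + (x$4)\<^sup>2))"

definition pps4bp_H :: "real \<Rightarrow> phase \<Rightarrow> real" where
  "pps4bp_H m = (\<lambda>(x, \<omega>). kinetic m \<omega> - potential m x)"

definition sbc_minus :: "real^4 \<Rightarrow> bool" where
  "sbc_minus x \<longleftrightarrow> x$3 - x$1 = 0 \<and> x$4 - x$2 = 0 \<and> (x$1)\<^sup>2 + (x$2)\<^sup>2 \<noteq> 0"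

definition sbc_plus :: "real^4 \<Rightarrow> bool" where
  "sbc_plus x \<longleftrightarrow> x$1 + x$3 = 0 \<and> x$2 + x$4 = 0 \<and> (x$1)\<^sup>2 + (x$2)\<^sup>2 \<noteq> 0"

definition binary_collision :: "real^4 \<Rightarrow> bool" where
  "binary_collision x \<longleftrightarrow>
     (x$1 = 0 \<and> x$2 = 0 \<and> (x$3)\<^sup>2 + (x$4)\<^sup>2 \<noteq> 0) \<or>
     (x$3 = 0 \<and> x$4 = 0 \<and> (x$1)\<^sup>2 + (x$2)\<^sup>2 \<noteq> 0)"

definition total_collapse :: "real^4 \<Rightarrow> bool" where
  "total_collapse x \<longleftrightarrow> x$1 = 0 \<and> x$2 = 0 \<and> x$3 = 0 \<and> x$4 = 0"

definition singular :: "real^4 \<Rightarrow> bool" where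
  "singular x \<longleftrightarrow> sbc_minus x \<or> sbc_plus x \<or> binary_collision x \<or> total_collapse x"


section \<open>The regularized system\<close>

definition Gamma_hat :: "real \<Rightarrow> real \<Rightarrow> phase \<Rightarrow> real" where
  "Gamma_hat m E = (\<lambda>(u, v).
     let M1 = v$1 * u$1 - v$2 * u$2;
         M2 = v$1 * u$2 + v$2 * u$1;
         M3 = v$3 * u$3 - v$4 * u$4;
         M4 = v$3 * u$4 + v$4 * u$3;
         M5 = (u$1)\<^sup>2 - (u$2)\<^sup>2 + (u$3)\<^sup>2 - (u$4)\<^sup>2;
         M6 = 2 * u$1 * u$2 + 2 * u$3 * u$4;
         M7 = (u$1)\<^sup>2 - (u$2)\<^sup>2 - (u$3)\<^sup>2 + (u$4)\<^sup>2;
         M8 = 2 * u$1 * u$2 - 2 * u$3 * u$4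
     in 1/16 * (1 + 1/m) *
          (((v$1)\<^sup>2 + (v$2)\<^sup>2) * ((u$3)\<^sup>2 + (u$4)\<^sup>2) + ((v$3)\<^sup>2 + (v$4)\<^sup>2) * ((u$1)\<^sup>2 + (u$2)\<^sup>2))
        + 1/8 * (1 - 1/m) * (M3 * M1 + M4 * M2)
        - ((u$1)\<^sup>2 + (u$2)\<^sup>2) * ((u$3)\<^sup>2 + (u$4)\<^sup>2) / sqrt (M5\<^sup>2 + M6\<^sup>2)
        - 2 * m * ((u$1)\<^sup>2 + (u$2)\<^sup>2 + (u$3)\<^sup>2 + (u$4)\<^sup>2)
        - m\<^sup>2 * ((u$1)\<^sup>2 + (u$2)\<^sup>2) * ((u$3)\<^sup>2 + (u$4)\<^sup>2) / sqrt (M7\<^sup>2 + M8\<^sup>2)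
        - E * ((u$1)\<^sup>2 + (u$2)\<^sup>2) * ((u$3)\<^sup>2 + (u$4)\<^sup>2))"

definition Gamma_domain :: "phase set" where
  "Gamma_domain = {(u, v).
     let M5 = (u$1)\<^sup>2 - (u$2)\<^sup>2 + (u$3)\<^sup>2 - (u$4)\<^sup>2;
         M6 = 2 * u$1 * u$2 + 2 * u$3 * u$4;
         M7 = (u$1)\<^sup>2 - (u$2)\<^sup>2 - (u$3)\<^sup>2 + (u$4)\<^sup>2;
         M8 = 2 * u$1 * u$2 - 2 * u$3 * u$4
     in M5\<^sup>2 + M6\<^sup>2 \<noteq> 0 \<and> M7\<^sup>2 + M8\<^sup>2 \<noteq> 0}"

text \<open>The angular momentum \<open>x\<^sub>1\<omega>\<^sub>2 - x\<^sub>2\<omega>\<^sub>1 + x\<^sub>3\<omega>\<^sub>4 - x\<^sub>4\<omega>\<^sub>3\<close> in regularized coordinates.\<close>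

definition angular_momentum :: "phase \<Rightarrow> real" where
  "angular_momentum = (\<lambda>(u, v). 1/2 * (- v$1 * u$2 + v$2 * u$1 - v$3 * u$4 + v$4 * u$3))"

definition regularized_sbc :: "phase \<Rightarrow> bool" where
  "regularized_sbc = (\<lambda>(u, v).
     ((u$1)\<^sup>2 + (u$2)\<^sup>2 = 0 \<and> (u$3)\<^sup>2 + (u$4)\<^sup>2 \<noteq> 0) \<or>
     ((u$3)\<^sup>2 + (u$4)\<^sup>2 = 0 \<and> (u$1)\<^sup>2 + (u$2)\<^sup>2 \<noteq> 0))"

definition time_rate :: "phase \<Rightarrow> real" where
  "time_rate = (\<lambda>(u, v). ((u$1)\<^sup>2 + (u$2)\<^sup>2) * ((u$3)\<^sup>2 + (u$4)\<^sup>2))"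

definition position_change :: "real^4 \<Rightarrow> real^4 \<Rightarrow> bool" where
  "position_change u x \<longleftrightarrow> (\<exists>g :: real^4.
     g$1 = x$1 - x$3 \<and> g$2 = x$2 - x$4 \<and> g$3 = x$1 + x$3 \<and> g$4 = x$2 + x$4 \<and>
     g$1 = (u$1)\<^sup>2 - (u$2)\<^sup>2 \<and> g$2 = 2 * u$1 * u$2 \<and>
     g$3 = (u$3)\<^sup>2 - (u$4)\<^sup>2 \<and> g$4 = 2 * u$3 * u$4)"

definition momentum_change :: "phase \<Rightarrow> real^4 \<Rightarrow> bool" where
  "momentum_change = (\<lambda>(u, v) \<omega>. \<exists>h :: real^4.
     \<omega>$1 = h$1 + h$3 \<and> \<omega>$2 = h$2 + h$4 \<and> \<omega>$3 = h$3 - h$1 \<and> \<omega>$4 = h$4 - h$2 \<and>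
     v$1 = 2 * h$1 * u$1 + 2 * h$2 * u$2 \<and> v$2 = - 2 * h$1 * u$2 + 2 * h$2 * u$1 \<and>
     v$3 = 2 * h$3 * u$3 + 2 * h$4 * u$4 \<and> v$4 = - 2 * h$3 * u$4 + 2 * h$4 * u$3)"

text \<open>Here \<open>\<tau>\<close> is the change of time \<open>t = \<tau> s\<close>. The momenta \<open>\<omega>\<close> are infinite at collisions, so
  they are related to \<open>\<gamma>\<close> only away from collision times, and the value of \<open>\<omega>\<close> at a collision
  time carries no meaning.\<close>

definition corresponds :: "(real \<Rightarrow> phase) \<Rightarrow> (real \<Rightarrow> real^4) \<Rightarrow> (real \<Rightarrow> real^4) \<Rightarrow> bool" where
  "corresponds \<gamma> x \<omega> \<longleftrightarrow> (\<exists>\<tau> :: real \<Rightarrow> real.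
     \<tau> 0 = 0 \<and> bij \<tau> \<and>
     (\<forall>s. (\<tau> has_real_derivative time_rate (\<gamma> s)) (at s)) \<and>
     (\<forall>s. position_change (fst (\<gamma> s)) (x (\<tau> s))) \<and>
     (\<forall>s. \<not> singular (x (\<tau> s)) \<longrightarrow> momentum_change (\<gamma> s) (\<omega> (\<tau> s))))"


section \<open>Symmetries\<close>

text \<open>The pair \<open>(i, j)\<close> stands for \<open>a\<^sup>i b\<^sup>j\<close>, and the multiplication encodes \<open>b a = a b\<^sup>-\<^sup>1\<close>.
  The lemmas below show that this is the group presented by \<open>a\<^sup>2 = b\<^sup>4 = (ab)\<^sup>2 = e\<close>.\<close>

definition D4 :: "(nat \<times> nat) monoid" where
  "D4 = \<lparr>carrier = {..<2} \<times> {..<4},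
         mult = (\<lambda>(i, j) (k, l). ((i + k) mod 2, ((if k = 0 then j else 4 - j) + l) mod 4)),
         one = (0, 0)\<rparr>"

definition S_F :: "phase \<Rightarrow> phase" where
  "S_F = (\<lambda>(u, v). (vector [- u$3, u$4, u$1, - u$2], vector [- v$3, v$4, v$1, - v$2]))"

definition S_G :: "phase \<Rightarrow> phase" where
  "S_G = (\<lambda>(u, v). (vector [- u$1, - u$2, u$3, u$4], vector [v$1, v$2, - v$3, - v$4]))"

text \<open>The group generated by \<open>S_F\<close> and \<open>S_G\<close> inside the group of all bijections of phase space.\<close>

definition FG_set :: "(phase \<Rightarrow> phase) set" where
  "FG_set = generate (BijGroup UNIV) {S_F, S_G}"

definition time_preserving :: "(real \<Rightarrow> phase) \<Rightarrow> (phase \<Rightarrow> phase) \<Rightarrow> bool" where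
  "time_preserving \<gamma> S \<longleftrightarrow> (\<exists>c. \<forall>s. S (\<gamma> s) = \<gamma> (s + c))"

definition time_reversing :: "(real \<Rightarrow> phase) \<Rightarrow> (phase \<Rightarrow> phase) \<Rightarrow> bool" where
  "time_reversing \<gamma> S \<longleftrightarrow> (\<exists>c. \<forall>s. S (\<gamma> s) = \<gamma> (c - s))"

definition symmetry_group :: "(real \<Rightarrow> phase) \<Rightarrow> (phase \<Rightarrow> phase) monoid" where
  "symmetry_group \<gamma> = (BijGroup UNIV)
     \<lparr>carrier := {S \<in> FG_set. time_preserving \<gamma> S \<or> time_reversing \<gamma> S}\<rparr>"

definition time_reversible :: "(real \<Rightarrow> phase) \<Rightarrow> bool" where
  "time_reversible \<gamma> \<longleftrightarrow> (\<exists>S \<in> FG_set. time_reversing \<gamma> S)"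

lemma below_2: "{..<2::nat} = {0, 1}"
  by auto

lemma below_4: "{..<4::nat} = {0, 1, 2, 3}"
  by auto

lemma D4_mult: "(i, j) \<otimes>\<^bsub>D4\<^esub> (k, l) = ((i + k) mod 2, ((if k = 0 then j else 4 - j) + l) mod 4)"
  by (simp add: D4_def)

lemma D4_assoc:
  "\<forall>j\<in>{0,1,2,3}. \<forall>k\<in>{0,1}. \<forall>l\<in>{0,1,2,3}. \<forall>m\<in>{0,1}. \<forall>n\<in>{0,1,2,3}.
     ((i, j) \<otimes>\<^bsub>D4\<^esub> (k, l)) \<otimes>\<^bsub>D4\<^esub> (m, n) = (i, j) \<otimes>\<^bsub>D4\<^esub> ((k, l) \<otimes>\<^bsub>D4\<^esub> (m, n))"
  by (simp add: D4_mult mod_simps)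

lemma D4_group: "group D4"
proof (rule groupI)
  fix x y z assume *: "x \<in> carrier D4" "y \<in> carrier D4" "z \<in> carrier D4"
  have D: "i \<in> {0,1}" "j \<in> {0,1,2,3}" if "(i, j) \<in> carrier D4" for i j
    using that by (auto simp: D4_def)
  obtain i j k l m n where [simp]: "x = (i, j)" "y = (k, l)" "z = (m, n)"
    by (cases x; cases y; cases z)
  show "(x \<otimes>\<^bsub>D4\<^esub> y) \<otimes>\<^bsub>D4\<^esub> z = x \<otimes>\<^bsub>D4\<^esub> (y \<otimes>\<^bsub>D4\<^esub> z)"
    unfolding \<open>x = (i, j)\<close> \<open>y = (k, l)\<close> \<open>z = (m, n)\<close>
    by (rule D4_assoc[rule_format]) (use * in \<open>auto dest: D\<close>)
next
  fix x assume "x \<in> carrier D4"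
  then obtain i j where [simp]: "x = (i, j)" and ij: "i < 2" "j < 4"
    by (auto simp: D4_def)
  show "\<exists>y\<in>carrier D4. y \<otimes>\<^bsub>D4\<^esub> x = \<one>\<^bsub>D4\<^esub>"
  proof (cases "i = 0")
    case True
    then show ?thesis
      using ij by (intro bexI[of _ "(0, (4 - j) mod 4)"]) (simp_all add: D4_def mod_add_left_eq)
  next
    case False
    then have "i = 1" using ij by simp
    then show ?thesis
      using ij by (intro bexI[of _ "(1, j)"]) (simp_all add: D4_def)
  qed
next
  show "\<one>\<^bsub>D4\<^esub> \<in> carrier D4" by (simp add: D4_def)
next
  fix x y assume "x \<in> carrier D4" "y \<in> carrier D4"
  then show "x \<otimes>\<^bsub>D4\<^esub> y \<in> carrier D4" by (cases x; cases y) (simp add: D4_def)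
next
  fix x assume "x \<in> carrier D4"
  then show "\<one>\<^bsub>D4\<^esub> \<otimes>\<^bsub>D4\<^esub> x = x" by (cases x) (auto simp: D4_def)
qed

lemma D4_order: "order D4 = 8"
  by (simp add: order_def D4_def)

lemma D4_relations:
  fixes a b :: "nat \<times> nat"
  defines "a \<equiv> (1, 0)" and "b \<equiv> (0, 1)"
  shows "a [^]\<^bsub>D4\<^esub> (2::nat) = \<one>\<^bsub>D4\<^esub>" "b [^]\<^bsub>D4\<^esub> (4::nat) = \<one>\<^bsub>D4\<^esub>"
    "(a \<otimes>\<^bsub>D4\<^esub> b) [^]\<^bsub>D4\<^esub> (2::nat) = \<one>\<^bsub>D4\<^esub>"
proof -
  interpret group D4 by (rule D4_group)
  have ab: "a \<in> carrier D4" "b \<in> carrier D4" by (simp_all add: a_def b_def D4_def)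
  have pow: "x [^]\<^bsub>D4\<^esub> (2::nat) = x \<otimes>\<^bsub>D4\<^esub> x" if "x \<in> carrier D4" for x
    using that by (simp add: numeral_2_eq_2)
  have "b [^]\<^bsub>D4\<^esub> (4::nat) = b [^]\<^bsub>D4\<^esub> (2::nat) \<otimes>\<^bsub>D4\<^esub> b [^]\<^bsub>D4\<^esub> (2::nat)"
    using ab by (simp add: nat_pow_mult)
  also have "\<dots> = \<one>\<^bsub>D4\<^esub>" unfolding pow[OF ab(2)] by (simp add: b_def D4_def)
  finally show "b [^]\<^bsub>D4\<^esub> (4::nat) = \<one>\<^bsub>D4\<^esub>" .
  show "a [^]\<^bsub>D4\<^esub> (2::nat) = \<one>\<^bsub>D4\<^esub>" unfolding pow[OF ab(1)] by (simp add: a_def D4_def)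
  show "(a \<otimes>\<^bsub>D4\<^esub> b) [^]\<^bsub>D4\<^esub> (2::nat) = \<one>\<^bsub>D4\<^esub>"
    unfolding pow[OF m_closed[OF ab]] by (simp add: a_def b_def D4_def)
qed

lemma D4_generated: "carrier D4 = generate D4 {(1, 0), (0, 1)}"
proof
  interpret group D4 by (rule D4_group)
  show "generate D4 {(1, 0), (0, 1)} \<subseteq> carrier D4"
    by (rule generate_incl) (simp add: D4_def)
  let ?g = "generate D4 {(1, 0), (0, 1)}"
  have b1: "(0, 1) \<in> ?g" and a: "(1, 0) \<in> ?g" by (auto intro: generate.incl)
  have e: "(0, 0) \<in> ?g" using generate.one[of D4] by (simp add: D4_def)
  have b2: "(0, 2) \<in> ?g" using generate.eng[OF b1 b1] by (simp add: D4_mult numeral_2_eq_2)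
  have b3: "(0, 3) \<in> ?g" using generate.eng[OF b1 b2] by (simp add: D4_mult)
  have c1: "(1, 1) \<in> ?g" using generate.eng[OF a b1] by (simp add: D4_mult)
  have c2: "(1, 2) \<in> ?g" using generate.eng[OF a b2] by (simp add: D4_mult numeral_2_eq_2)
  have c3: "(1, 3) \<in> ?g" using generate.eng[OF a b3] by (simp add: D4_mult)
  from e a b1 b2 b3 c1 c2 c3 show "carrier D4 \<subseteq> ?g"
    by (auto simp: D4_def below_2 below_4)
qed

lemma D4_universal:
  fixes G (structure)
  assumes "group G" and a: "a \<in> carrier G" and b: "b \<in> carrier G"
    and a2: "a [^] (2::nat) = \<one>" and b4: "b [^] (4::nat) = \<one>"
    and ab: "(a \<otimes> b) [^] (2::nat) = \<one>"
  shows "\<exists>h \<in> hom D4 G. h (1, 0) = a \<and> h (0, 1) = b"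
proof -
  interpret group G by fact
  have aa: "a \<otimes> a = \<one>" using a2 a by (simp add: numeral_2_eq_2)
  have a_mod: "a [^] (n mod 2) = a [^] n" for n :: nat
  proof -
    have "a [^] n = a [^] (2 * (n div 2)) \<otimes> a [^] (n mod 2)"
      using a by (simp add: nat_pow_mult)
    also have "a [^] (2 * (n div 2)) = \<one>"
      using a by (simp add: a2 flip: nat_pow_pow)
    finally show ?thesis using a by simp
  qed
  have b_mod: "b [^] (n mod 4) = b [^] n" for n :: nat
  proof -
    have "b [^] n = b [^] (4 * (n div 4)) \<otimes> b [^] (n mod 4)"
      using b by (simp add: nat_pow_mult)
    also have "b [^] (4 * (n div 4)) = \<one>"
      using b by (simp add: b4 flip: nat_pow_pow)
    finally show ?thesis using b by simp
  qed
  have ba: "b \<otimes> a = a \<otimes> b [^] (3::nat)"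
  proof -
    have abab: "a \<otimes> (b \<otimes> (a \<otimes> b)) = \<one>" using ab a b by (simp add: numeral_2_eq_2 m_assoc)
    have "b \<otimes> (a \<otimes> b) = (a \<otimes> a) \<otimes> (b \<otimes> (a \<otimes> b))" using aa a b by simp
    also have "\<dots> = a" using abab a b by (simp add: m_assoc)
    finally have bab: "b \<otimes> (a \<otimes> b) = a" .
    have b13: "b \<otimes> b [^] (3::nat) = \<one>"
      using b4 b nat_pow_mult[OF b, of 1 3] by simp
    have "a \<otimes> b [^] (3::nat) = (b \<otimes> (a \<otimes> b)) \<otimes> b [^] (3::nat)" by (simp add: bab)
    also have "\<dots> = b \<otimes> a" using a b b13 by (simp add: m_assoc)
    finally show ?thesis by simp
  qed
  have bja: "b [^] j \<otimes> a = a \<otimes> b [^] (3 * j)" for j :: nat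
  proof (induction j)
    case 0
    then show ?case using a by simp
  next
    case (Suc j)
    have "b [^] Suc j \<otimes> a = b [^] j \<otimes> (b \<otimes> a)" using a b by (simp add: m_assoc)
    also have "\<dots> = (b [^] j \<otimes> a) \<otimes> b [^] (3::nat)" using a b by (simp add: ba m_assoc)
    also have "\<dots> = a \<otimes> b [^] (3 * Suc j)"
      using a b Suc by (simp add: m_assoc nat_pow_mult add.commute)
    finally show ?case .
  qed
  have bja': "b [^] j \<otimes> (a \<otimes> x) = a \<otimes> (b [^] (3 * j) \<otimes> x)" if "x \<in> carrier G" for j :: nat and x
    using bja[of j] a b that by (metis m_assoc nat_pow_closed)
  let ?h = "\<lambda>(i::nat, j::nat). a [^] i \<otimes> b [^] j"
  have h_mult: "?h ((i, j) \<otimes>\<^bsub>D4\<^esub> (k, l)) = ?h (i, j) \<otimes> ?h (k, l)"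
    if "j < 4" "k < 2" for i j k l
  proof (cases "k = 0")
    case True
    have "?h ((i, j) \<otimes>\<^bsub>D4\<^esub> (k, l)) = a [^] (i mod 2) \<otimes> b [^] ((j + l) mod 4)"
      using True by (simp add: D4_mult)
    also have "\<dots> = ?h (i, j) \<otimes> ?h (k, l)"
      unfolding a_mod b_mod using a b True by (simp add: m_assoc flip: nat_pow_mult)
    finally show ?thesis .
  next
    case False
    then have k: "k = 1" using that by simp
    have "j = 0 \<or> j = 1 \<or> j = 2 \<or> j = 3" using that by linarith
    then have "(4 - j) mod 4 = (3 * j) mod 4" by auto
    then have j: "b [^] (4 - j) = b [^] (3 * j)" by (metis b_mod)
    have "?h ((i, j) \<otimes>\<^bsub>D4\<^esub> (k, l)) = a [^] ((i + 1) mod 2) \<otimes> b [^] ((4 - j + l) mod 4)"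
      using k by (simp add: D4_mult)
    also have "\<dots> = (a [^] i \<otimes> a) \<otimes> (b [^] (3 * j) \<otimes> b [^] l)"
      unfolding a_mod b_mod using a b by (simp flip: nat_pow_mult j)
    also have "\<dots> = ?h (i, j) \<otimes> ?h (k, l)"
      using a b k by (simp add: m_assoc bja')
    finally show ?thesis .
  qed
  have "?h \<in> hom D4 G"
  proof (rule homI)
    fix x y assume "x \<in> carrier D4" "y \<in> carrier D4"
    then have "snd x < 4" "fst y < 2" by (auto simp: D4_def)
    then show "?h (x \<otimes>\<^bsub>D4\<^esub> y) = ?h x \<otimes> ?h y"
      using h_mult[of "snd x" "fst y" "fst x" "snd y"] by simp
  qed (use a b in auto)
  moreover have "?h (1, 0) = a" "?h (0, 1) = b" using a b by simp_all
  ultimately show ?thesis by blast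
qed

end

theory Submission
  imports Defs
begin

text \<open>Configurations in which the four bodies form a rectangle are invariant, and on them the
  regularized system reduces to two degrees of freedom \<open>(x, y)\<close>, whose squares are the side
  lengths up to a factor. Start at a collision, \<open>x = 0\<close>, \<open>y = 1\<close>, with \<open>y\<close> at rest. If the solution
  reaches the diagonal \<open>x = y\<close> orthogonally, that is with \<open>p + q = 0\<close>, then reflecting this arc in
  the collision and in the diagonal produces the periodic orbit. At energy \<open>0\<close> the diagonal is
  reached while \<open>p + q > 0\<close>, by convexity of the moment of inertia; at energy \<open>-12\<close> conservation
  of energy keeps the solution away from the diagonal until \<open>p + q\<close> has changed sign. By
  continuity an energy in between gives an orthogonal arrival, and scaling turns it into any
  negative energy.\<close>

section \<open>Global Lipschitz differential equations\<close>

text \<open>The reduced equations are singular at the origin and their solutions are not known in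
  advance to exist for all time, whereas the shooting compares solutions of a whole interval of
  energies. The field is therefore cut off to a globally Lipschitz one. The cut-offs are compatible
  with both reflections, so uniqueness for the truncated field turns these into identities along the
  solution. A priori bounds show that the cut-offs are inactive up to the diagonal; the reflections
  then carry this to all times.

  The forces on \<open>p\<close> and \<open>q\<close> have no definite sign. What drives the
  estimates is the quotient \<open>q / y\<close>, essentially a momentum of the original problem:
  once the energy constant has been eliminated by means of the zero level, its derivative is an
  attractive force times the rate of time, and so it is never positive. All further signs and bounds
  descend from this one.\<close>

lemma norm_integral_exp_bound:
  fixes f :: "real \<Rightarrow> 'a::euclidean_space"
  assumes "continuous_on {0..t} f" "0 \<le> t" "K > 0"
    and bound: "\<And>s. s \<in> {0..t} \<Longrightarrow> norm (f s) \<le> C * exp (K * s)"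
  shows "norm (integral {0..t} f) \<le> C / K * exp (K * t)"
proof -
  have C: "C \<ge> 0" using bound[of 0] assms(2) norm_ge_zero[of "f 0"] by (simp del: norm_ge_zero)
  have I: "((\<lambda>s. C * exp (K * s)) has_integral (C / K * exp (K * t) - C / K * exp (K * 0))) {0..t}"
    by (rule fundamental_theorem_of_calculus[OF assms(2)])
      (use assms(3) in \<open>auto intro!: derivative_eq_intros simp flip: has_real_derivative_iff_has_vector_derivative\<close>)
  have "norm (integral {0..t} f) \<le> integral {0..t} (\<lambda>s. C * exp (K * s))"
    by (rule integral_norm_bound_integral)
      (use assms I in \<open>auto intro: integrable_continuous_interval\<close>)
  also have "\<dots> = C / K * exp (K * t) - C / K" using integral_unique[OF I] by simp
  also have "\<dots> \<le> C / K * exp (K * t)" using C assms(3) by simp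
  finally show ?thesis .
qed

text \<open>The Picard map is a contraction of the bounded continuous functions after the substitution
  \<open>x t = exp (2 * L * t) * g t\<close>, so that no continuation argument is needed.\<close>

lemma lipschitz_ode_forward:
  fixes F :: "'a::euclidean_space \<Rightarrow> 'a"
  assumes lip: "L-lipschitz_on UNIV F"
  obtains x where "x 0 = x0"
    and "\<And>t. t \<ge> 0 \<Longrightarrow> (x has_vector_derivative F (x t)) (at t within {0..})"
proof -
  \<comment> \<open>Against the weight \<open>exp (K * t)\<close> an integration gains a factor
    \<open>1 / K\<close>, so the contraction constant is \<open>L / K\<close>, at most 1/2. The
    summand 1 keeps \<open>K\<close> positive when \<open>L = 0\<close>.\<close>
  define K where "K = 2 * (L + 1)"
  have L0: "L \<ge> 0" using lip by (rule lipschitz_on_nonneg)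
  then have K: "K > 0" by (simp add: K_def)
  have lipF: "norm (F a - F b) \<le> L * norm (a - b)" for a b
    using lipschitz_on_normD[OF lip] by simp
  have contF: "continuous_on S F" for S
    by (rule continuous_on_subset[OF lipschitz_on_continuous_on[OF lip]]) simp
  define f where "f g s = F (exp (K * s) *\<^sub>R apply_bcontfun g s)" for g :: "real \<Rightarrow>\<^sub>C 'a" and s
  have contf: "continuous_on S (f g)" for S g
    unfolding f_def
    by (rule continuous_on_compose2[OF contF[of UNIV]]) (auto intro!: continuous_intros)
  define P where "P g t = x0 + integral {0..t} (f g)" for g t
  \<comment> \<open>The fixed point is sought among functions on the whole line;
    \<open>max 0 t\<close> extends the iterate by a constant to negative times.\<close>
  define T where "T g t = exp (- K * max 0 t) *\<^sub>R P g (max 0 t)" for g t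
  have contP: "continuous_on {0..} (P g)" for g
    unfolding continuous_on_eq_continuous_within
  proof
    fix t :: real assume t: "t \<in> {0..}"
    have "continuous_on {0..t+1} (P g)"
      unfolding P_def
      by (intro continuous_intros indefinite_integral_continuous_1 integrable_continuous_interval contf)
    then have "continuous (at t within {0..t+1}) (P g)"
      using t by (simp add: continuous_on_eq_continuous_within)
    moreover have "at t within {0..t+1} = at t within {0..}"
      by (rule at_within_nhd[of _ "{..<t+1}"]) auto
    ultimately show "continuous (at t within {0..}) (P g)" by simp
  qed
  have contT: "continuous_on UNIV (T g)" for g
    unfolding T_def
    by (intro continuous_intros continuous_on_compose2[OF contP]) auto
  have fbound: "norm (f g s) \<le> (norm (F 0) + L * norm g) * exp (K * s)" if "s \<ge> 0" for g s
  proof -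
    have "norm (f g s) \<le> norm (F 0) + L * norm (exp (K * s) *\<^sub>R apply_bcontfun g s)"
      unfolding f_def using lipF[of "exp (K * s) *\<^sub>R apply_bcontfun g s" 0]
        norm_triangle_sub[of "F (exp (K * s) *\<^sub>R apply_bcontfun g s)" "F 0"] by simp
    also have "\<dots> \<le> norm (F 0) * exp (K * s) + L * (exp (K * s) * norm g)"
    proof (intro add_mono)
      have "1 \<le> exp (K * s)" using K that by simp
      then show "norm (F 0) \<le> norm (F 0) * exp (K * s)"
        by (simp add: mult_le_cancel_left1)
      show "L * norm (exp (K * s) *\<^sub>R apply_bcontfun g s) \<le> L * (exp (K * s) * norm g)"
        using L0 by (simp add: mult_left_mono norm_bounded)
    qed
    finally show ?thesis by (simp add: algebra_simps)
  qed
  have Tbound: "norm (T g t) \<le> norm x0 + (norm (F 0) + L * norm g) / K" for g t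
  proof -
    let ?t = "max 0 t"
    have "norm (P g ?t) \<le> norm x0 + (norm (F 0) + L * norm g) / K * exp (K * ?t)"
      unfolding P_def
      by (rule norm_triangle_le, rule add_left_mono, rule norm_integral_exp_bound)
        (use contf K fbound in auto)
    also have "\<dots> \<le> norm x0 * exp (K * ?t) + (norm (F 0) + L * norm g) / K * exp (K * ?t)"
    proof -
      have "1 \<le> exp (K * ?t)" using K by simp
      then show ?thesis by (simp add: mult_le_cancel_left1)
    qed
    finally have "norm (P g ?t) \<le> (norm x0 + (norm (F 0) + L * norm g) / K) * exp (K * ?t)"
      by (simp add: algebra_simps)
    then have "exp (- K * ?t) * norm (P g ?t)
        \<le> exp (- K * ?t) * ((norm x0 + (norm (F 0) + L * norm g) / K) * exp (K * ?t))"
      by (rule mult_left_mono) simp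
    then show ?thesis by (simp add: T_def exp_minus field_simps)
  qed
  have Tb: "T g \<in> bcontfun" for g
    unfolding bcontfun_def using contT Tbound by (auto simp: bounded_iff)
  define TT where "TT g = Bcontfun (T g)" for g
  have TT: "apply_bcontfun (TT g) = T g" for g
    using Tb by (simp add: TT_def Bcontfun_inverse)
  have "dist (TT g) (TT h) \<le> 1/2 * dist g h" for g h
  proof (rule dist_bound)
    fix t :: real
    let ?t = "max 0 t"
    have "norm (f g s - f h s) \<le> (L * dist g h) * exp (K * s)" for s
    proof -
      have "norm (f g s - f h s) \<le> L * norm (exp (K * s) *\<^sub>R (apply_bcontfun g s - apply_bcontfun h s))"
        unfolding f_def using lipF by (simp add: scaleR_diff_right)
      also have "\<dots> \<le> L * (exp (K * s) * dist g h)"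
        using L0 dist_bounded[of g s h] by (simp add: mult_left_mono dist_norm)
      finally show ?thesis by (simp add: algebra_simps)
    qed
    then have "norm (integral {0..?t} (\<lambda>s. f g s - f h s)) \<le> L * dist g h / K * exp (K * ?t)"
      by (intro norm_integral_exp_bound continuous_intros contf K) auto
    then have "norm (P g ?t - P h ?t) \<le> L * dist g h / K * exp (K * ?t)"
      unfolding P_def
      by (subst (asm) integral_diff) (auto intro: integrable_continuous_interval contf)
    then have "exp (- K * ?t) * norm (P g ?t - P h ?t) \<le> exp (- K * ?t) * (L * dist g h / K * exp (K * ?t))"
      by (rule mult_left_mono) simp
    also have "\<dots> = L / K * dist g h" by (simp add: exp_minus field_simps)
    also have "\<dots> \<le> 1/2 * dist g h"
      using L0 by (intro mult_right_mono) (auto simp: K_def field_simps)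
    finally show "dist (apply_bcontfun (TT g) t) (apply_bcontfun (TT h) t) \<le> 1/2 * dist g h"
      by (simp add: TT T_def dist_norm flip: scaleR_diff_right)
  qed
  then have "\<exists>!g. TT g = g" by (intro banach_fix_type[where c = "1/2"]) auto
  then obtain g where g: "TT g = g" by blast
  define x where "x t = exp (K * t) *\<^sub>R apply_bcontfun g t" for t
  have xP: "x t = P g t" if "t \<ge> 0" for t
  proof -
    have "apply_bcontfun g t = T g t" using g TT by metis
    then show ?thesis using that by (simp add: x_def T_def exp_minus)
  qed
  show ?thesis
  proof
    show "x 0 = x0" using xP[of 0] by (simp add: P_def)
    fix t :: real assume t: "t \<ge> 0"
    have "(P g has_vector_derivative f g t) (at t within {0..t+1})"
      unfolding P_def
      using integral_has_vector_derivative[OF contf, of t 0 "t+1" g] t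
      by (auto intro!: derivative_eq_intros)
    moreover have "at t within {0..t+1} = at t within {0..}"
      by (rule at_within_nhd[of _ "{..<t+1}"]) auto
    ultimately have "(P g has_vector_derivative f g t) (at t within {0..})" by simp
    then have "(x has_vector_derivative f g t) (at t within {0..})"
      by (rule has_vector_derivative_transform[rotated 2]) (use t xP in auto)
    then show "(x has_vector_derivative F (x t)) (at t within {0..})"
      by (simp add: f_def x_def)
  qed
qed

text \<open>Negative times are supplied by a forward solution of the reversed field. The two halves
  fit together at 0 because their one-sided derivatives agree there.\<close>

lemma lipschitz_ode:
  fixes F :: "'a::euclidean_space \<Rightarrow> 'a"
  assumes lip: "L-lipschitz_on UNIV F"
  obtains x where "x 0 = x0" and "\<And>t. (x has_vector_derivative F (x t)) (at t)"
proof -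
  obtain y where y: "y 0 = x0" "\<And>t. t \<ge> 0 \<Longrightarrow> (y has_vector_derivative F (y t)) (at t within {0..})"
    using lipschitz_ode_forward[OF lip, of x0] by blast
  have "L-lipschitz_on UNIV (\<lambda>a. - F a)" using lip by simp
  then obtain z where z: "z 0 = x0"
      "\<And>t. t \<ge> 0 \<Longrightarrow> (z has_vector_derivative - F (z t)) (at t within {0..})"
    using lipschitz_ode_forward[of L "\<lambda>a. - F a" x0] by blast
  define x where "x t = (if t \<ge> 0 then y t else z (- t))" for t
  have right: "(x has_vector_derivative F (x t)) (at t within {0..})" if "t \<ge> 0" for t
    by (rule has_vector_derivative_transform[of _ _ x y]) (use that y in \<open>auto simp: x_def\<close>)
  have left: "(x has_vector_derivative F (x t)) (at t within {..0})" if "t \<le> 0" for t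
  proof -
    have "((\<lambda>t. z (- t)) has_vector_derivative F (z (- t))) (at t within {..0})"
    proof -
      have "(uminus has_vector_derivative -1) (at t within {..0})"
        by (auto intro!: derivative_eq_intros simp flip: has_real_derivative_iff_has_vector_derivative)
      moreover have "(z has_vector_derivative - F (z (- t))) (at (- t) within (uminus ` {..0}))"
        using z(2)[of "- t"] that by (simp add: image_uminus_atMost)
      ultimately have "((z \<circ> uminus) has_vector_derivative (-1) *\<^sub>R (- F (z (- t)))) (at t within {..0})"
        by (rule vector_diff_chain_within)
      then show ?thesis by (simp add: o_def)
    qed
    then have "((\<lambda>t. z (- t)) has_vector_derivative F (x t)) (at t within {..0})"
      using that y z by (auto simp: x_def)
    then show ?thesis
      by (rule has_vector_derivative_transform[rotated 2]) (use that y z in \<open>auto simp: x_def\<close>)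
  qed
  have "(x has_vector_derivative F (x t)) (at t)" for t
  proof -
    consider "t > 0" | "t < 0" | "t = 0" by linarith
    then show ?thesis
    proof cases
      case 1
      then have "at t within {0..} = at t" by (intro at_within_interior) (simp add: interior_Ici[of "-1"])
      then show ?thesis using right[of t] 1 by simp
    next
      case 2
      then have "at t within {..0} = at t" by (intro at_within_interior) simp
      then show ?thesis using left[of t] 2 by simp
    next
      case 3
      have "(x has_vector_derivative F (x 0)) (at 0 within {0..} \<union> {..0})"
        using right[of 0] left[of 0] unfolding has_vector_derivative_def has_derivative_within
        by (auto intro: Lim_Un)
      moreover have "{0..} \<union> {..0} = (UNIV :: real set)" by auto
      ultimately show ?thesis using 3 by simp
    qed
  qed
  moreover have "x 0 = x0" using y by (simp add: x_def)
  ultimately show ?thesis using that by blast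
qed

text \<open>Gronwall's estimate: the field expands the squared distance at a rate of at most
  \<open>2 * L\<close>, so the weighted squared distance \<open>\<phi>\<close> cannot increase.
  Uniqueness and the continuous dependence on the energy both rest on it.\<close>

lemma lipschitz_ode_dependence_forward:
  fixes F :: "'a::euclidean_space \<Rightarrow> 'a"
  assumes lip: "L-lipschitz_on UNIV F"
    and x: "\<And>t. (x has_vector_derivative F (x t)) (at t)"
    and y: "\<And>t. (y has_vector_derivative F (y t)) (at t)"
    and "t \<ge> 0"
  shows "norm (x t - y t) \<le> exp (L * t) * norm (x 0 - y 0)"
proof -
  define \<phi> where "\<phi> s = exp (- (2 * L) * s) * ((x s - y s) \<bullet> (x s - y s))" for s
  have "\<phi> t \<le> \<phi> 0"
  proof (rule DERIV_nonpos_imp_nonincreasing[OF assms(4)])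
    fix s
    have xd: "(x has_derivative (\<lambda>h. h *\<^sub>R F (x s))) (at s)"
      and yd: "(y has_derivative (\<lambda>h. h *\<^sub>R F (y s))) (at s)"
      using x y by (simp_all add: has_vector_derivative_def)
    have "((\<lambda>s. (x s - y s) \<bullet> (x s - y s)) has_real_derivative 2 * ((x s - y s) \<bullet> (F (x s) - F (y s)))) (at s)"
      unfolding has_field_derivative_def
      by (rule derivative_eq_intros xd yd refl)+
        (auto simp: fun_eq_iff inner_commute algebra_simps)
    note d = this
    have e: "((\<lambda>s. exp (- (2 * L) * s)) has_real_derivative - (2 * L) * exp (- (2 * L) * s)) (at s)"
      by (auto intro!: derivative_eq_intros)
    have "(\<phi> has_real_derivative exp (- (2 * L) * s) *
        (2 * ((x s - y s) \<bullet> (F (x s) - F (y s))) - 2 * L * ((x s - y s) \<bullet> (x s - y s)))) (at s)"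
      unfolding \<phi>_def
      by (rule DERIV_cong[OF DERIV_mult[OF e d]]) (simp add: algebra_simps)
    moreover have "(x s - y s) \<bullet> (F (x s) - F (y s)) \<le> L * ((x s - y s) \<bullet> (x s - y s))"
    proof -
      have "(x s - y s) \<bullet> (F (x s) - F (y s)) \<le> norm (x s - y s) * norm (F (x s) - F (y s))"
        by (rule norm_cauchy_schwarz)
      also have "\<dots> \<le> norm (x s - y s) * (L * norm (x s - y s))"
        using lipschitz_on_normD[OF lip] by (intro mult_left_mono) auto
      finally show ?thesis by (simp add: power2_norm_eq_inner[symmetric] power2_eq_square algebra_simps)
    qed
    ultimately show "\<exists>d. (\<phi> has_real_derivative d) (at s) \<and> d \<le> 0"
      by (intro exI conjI) (auto simp: mult_le_0_iff)
  qed
  then have "exp (- (2 * L) * t) * (norm (x t - y t))\<^sup>2 \<le> (norm (x 0 - y 0))\<^sup>2"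
    by (simp add: \<phi>_def power2_norm_eq_inner)
  then have "(norm (x t - y t))\<^sup>2 \<le> exp (2 * L * t) * (norm (x 0 - y 0))\<^sup>2"
    by (simp add: exp_minus field_simps)
  also have "\<dots> = (exp (L * t) * norm (x 0 - y 0))\<^sup>2"
    by (simp add: power_mult_distrib algebra_simps flip: exp_of_nat_mult exp_double)
  finally show ?thesis by (rule power2_le_imp_le) simp
qed

text \<open>The affine substitution moves \<open>a\<close> to time 0. With \<open>c = -1\<close> it
  also reverses time and replaces \<open>F\<close> by its negative, which has the same Lipschitz
  constant, so the forward estimate suffices on both sides.\<close>

lemma lipschitz_ode_unique:
  fixes F :: "'a::euclidean_space \<Rightarrow> 'a"
  assumes lip: "L-lipschitz_on UNIV F"
    and x: "\<And>t. (x has_vector_derivative F (x t)) (at t)"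
    and y: "\<And>t. (y has_vector_derivative F (y t)) (at t)"
    and "x a = y a"
  shows "x t = y t"
proof -
  have fw: "x t = y t" if "L-lipschitz_on UNIV F"
      "\<And>t. (x has_vector_derivative F (x t)) (at t)"
      "\<And>t. (y has_vector_derivative F (y t)) (at t)" "x 0 = y 0" "t \<ge> 0" for F x and y :: "real \<Rightarrow> 'a" and t
    using lipschitz_ode_dependence_forward[OF that(1-3,5)] that(4) by simp
  have shift: "((\<lambda>t. w (c * t + a)) has_vector_derivative c *\<^sub>R F (w (c * t + a))) (at t)"
    if "\<And>t. (w has_vector_derivative F (w t)) (at t)" for w :: "real \<Rightarrow> 'a" and c t
  proof -
    have "((\<lambda>t. c * t + a) has_vector_derivative c) (at t)"
      by (auto intro!: derivative_eq_intros simp flip: has_real_derivative_iff_has_vector_derivative)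
    from vector_diff_chain_at[OF this that] show ?thesis by (simp add: o_def)
  qed
  show ?thesis
  proof (cases "t \<ge> a")
    case True
    have "x (1 * (t - a) + a) = y (1 * (t - a) + a)"
      by (rule fw[of F "\<lambda>t. x (1 * t + a)" "\<lambda>t. y (1 * t + a)" "t - a"])
        (use shift[OF x, of 1] shift[OF y, of 1] lip True assms(4) in auto)
    then show ?thesis by simp
  next
    case False
    have "x ((-1) * (a - t) + a) = y ((-1) * (a - t) + a)"
      by (rule fw[of "\<lambda>a. - F a" "\<lambda>t. x ((-1) * t + a)" "\<lambda>t. y ((-1) * t + a)" "a - t"])
        (use shift[OF x, of "-1"] shift[OF y, of "-1"] lip False assms(4) in auto)
    then show ?thesis by simp
  qed
qed

section \<open>The truncated reduced field\<close>

text \<open>Boundedness is part of the notion because it makes the class closed under products,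
  which Lipschitz continuity alone is not.\<close>

definition bounded_lipschitz :: "('a::metric_space \<Rightarrow> 'b::real_normed_vector) \<Rightarrow> bool" where
  "bounded_lipschitz f \<longleftrightarrow> bounded (range f) \<and> (\<exists>L. L-lipschitz_on UNIV f)"

lemma bounded_lipschitzE:
  assumes "bounded_lipschitz f"
  obtains B L where "B \<ge> 0" "L \<ge> 0" "\<And>a. norm (f a) \<le> B" "\<And>a b. norm (f a - f b) \<le> L * dist a b"
proof -
  from assms obtain L where L: "L-lipschitz_on UNIV f" and "bounded (range f)"
    by (auto simp: bounded_lipschitz_def)
  then obtain B where B: "\<And>a. norm (f a) \<le> B" by (auto simp: bounded_iff)
  show ?thesis
  proof
    show "B \<ge> 0" using B norm_ge_zero order_trans by blast
    show "L \<ge> 0" using L by (rule lipschitz_on_nonneg)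
    show "norm (f a - f b) \<le> L * dist a b" for a b
      using lipschitz_onD[OF L, of a b] by (simp add: dist_norm)
  qed (rule B)
qed

lemma bounded_lipschitzI:
  assumes "\<And>a. norm (f a) \<le> B" "\<And>a b. norm (f a - f b) \<le> L * dist a b"
  shows "bounded_lipschitz f"
proof -
  have "\<bar>L\<bar>-lipschitz_on UNIV f"
  proof (rule lipschitz_onI)
    fix a b
    have "norm (f a - f b) \<le> \<bar>L\<bar> * dist a b"
      using order_trans[OF assms(2) mult_right_mono[OF abs_ge_self zero_le_dist]] .
    then show "dist (f a) (f b) \<le> \<bar>L\<bar> * dist a b" by (simp add: dist_norm)
  qed simp
  then show ?thesis using assms(1) by (auto simp: bounded_lipschitz_def bounded_iff)
qed

lemma bounded_lipschitz_const: "bounded_lipschitz (\<lambda>_. c)"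
  by (rule bounded_lipschitzI[of _ "norm c" 0]) auto

lemma bounded_lipschitz_add:
  assumes "bounded_lipschitz f" "bounded_lipschitz g"
  shows "bounded_lipschitz (\<lambda>a. f a + g a)"
proof -
  obtain B L where f: "\<And>a. norm (f a) \<le> B" "\<And>a b. norm (f a - f b) \<le> L * dist a b"
    using bounded_lipschitzE[OF assms(1)] by metis
  obtain C M where g: "\<And>a. norm (g a) \<le> C" "\<And>a b. norm (g a - g b) \<le> M * dist a b"
    using bounded_lipschitzE[OF assms(2)] by metis
  show ?thesis
  proof (rule bounded_lipschitzI)
    show "norm (f a + g a) \<le> B + C" for a by (intro norm_triangle_mono f g)
    show "norm ((f a + g a) - (f b + g b)) \<le> (L + M) * dist a b" for a b
      using norm_triangle_mono[OF f(2) g(2), of a b a b] by (simp add: algebra_simps)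
  qed
qed

lemma bounded_lipschitz_mult:
  fixes f g :: "'a::metric_space \<Rightarrow> real"
  assumes "bounded_lipschitz f" "bounded_lipschitz g"
  shows "bounded_lipschitz (\<lambda>a. f a * g a)"
proof -
  obtain B L where f: "B \<ge> 0" "\<And>a. norm (f a) \<le> B" "\<And>a b. norm (f a - f b) \<le> L * dist a b"
    using bounded_lipschitzE[OF assms(1)] by metis
  obtain C M where g: "C \<ge> 0" "M \<ge> 0" "\<And>a. norm (g a) \<le> C" "\<And>a b. norm (g a - g b) \<le> M * dist a b"
    using bounded_lipschitzE[OF assms(2)] by metis
  show ?thesis
  proof (rule bounded_lipschitzI)
    show "norm (f a * g a) \<le> B * C" for a
      using mult_mono[OF f(2) g(3) f(1) norm_ge_zero] by (simp add: abs_mult)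
    show "norm (f a * g a - f b * g b) \<le> (B * M + L * C) * dist a b" for a b
    proof -
      have "f a * g a - f b * g b = f a * (g a - g b) + (f a - f b) * g b" by algebra
      also have "norm \<dots> \<le> B * (M * dist a b) + (L * dist a b) * C"
      proof (rule norm_triangle_mono)
        show "norm (f a * (g a - g b)) \<le> B * (M * dist a b)"
          unfolding norm_mult by (intro mult_mono f g norm_ge_zero)
        show "norm ((f a - f b) * g b) \<le> (L * dist a b) * C"
          unfolding norm_mult
          by (intro mult_mono f g norm_ge_zero) (use f(3)[of a b] norm_ge_zero order_trans in blast)
      qed
      finally show ?thesis by (simp add: algebra_simps)
    qed
  qed
qed

lemma bounded_lipschitz_diff:
  fixes f g :: "'a::metric_space \<Rightarrow> real"
  assumes "bounded_lipschitz f" "bounded_lipschitz g"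
  shows "bounded_lipschitz (\<lambda>a. f a - g a)"
  using bounded_lipschitz_add[OF assms(1) bounded_lipschitz_mult[OF bounded_lipschitz_const[of "-1"] assms(2)]]
  by simp

lemma bounded_lipschitz_power:
  fixes f :: "'a::metric_space \<Rightarrow> real"
  assumes "bounded_lipschitz f"
  shows "bounded_lipschitz (\<lambda>a. f a ^ n)"
  by (induction n) (simp_all add: bounded_lipschitz_const bounded_lipschitz_mult assms)

text \<open>Clamping to a symmetric interval is an odd function, so changes of sign of the
  coordinates pass through the truncation. A cut-off without this property would destroy the
  reflections that reverse the flow.\<close>

definition trunc :: "real \<Rightarrow> real \<Rightarrow> real" where
  "trunc c a = max (- c) (min c a)"

lemma trunc_minus [simp]: "c \<ge> 0 \<Longrightarrow> trunc c (- a) = - trunc c a"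
  by (auto simp: trunc_def max_def min_def)

lemma trunc_id: "\<bar>a\<bar> \<le> c \<Longrightarrow> trunc c a = a"
  by (auto simp: trunc_def)

lemma bounded_lipschitz_trunc:
  fixes f :: "'a::metric_space \<Rightarrow> real"
  assumes "\<And>a b. \<bar>f a - f b\<bar> \<le> dist a b" "c \<ge> 0"
  shows "bounded_lipschitz (\<lambda>a. trunc c (f a))"
proof (rule bounded_lipschitzI)
  show "norm (trunc c (f a)) \<le> c" for a using assms(2) by (auto simp: trunc_def)
  show "norm (trunc c (f a) - trunc c (f b)) \<le> 1 * dist a b" for a b
    using assms(1)[of a b] by (auto simp: trunc_def max_def min_def abs_if split: if_splits)
qed

lemma bounded_lipschitz_max:
  fixes f :: "'a::metric_space \<Rightarrow> real"
  assumes "bounded_lipschitz f"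
  shows "bounded_lipschitz (\<lambda>a. max c (f a))"
proof -
  obtain B L where f: "\<And>a. norm (f a) \<le> B" "\<And>a b. norm (f a - f b) \<le> L * dist a b"
    using bounded_lipschitzE[OF assms(1)] by metis
  show ?thesis
  proof (rule bounded_lipschitzI)
    show "norm (max c (f a)) \<le> \<bar>c\<bar> + B" for a using f(1)[of a] by (auto simp: max_def)
    show "norm (max c (f a) - max c (f b)) \<le> L * dist a b" for a b
    proof -
      have "norm (max c (f a) - max c (f b)) \<le> norm (f a - f b)" by (auto simp: max_def)
      then show ?thesis using f(2)[of a b] by simp
    qed
  qed
qed

text \<open>A difference of reciprocal roots is \<open>(f b - f a) / (?a * ?b * (?a + ?b))\<close>.
  Roots of at least 1/4 make the denominator at least 1/32, whence the factor 32.\<close>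

lemma bounded_lipschitz_inverse_sqrt:
  fixes f :: "'a::metric_space \<Rightarrow> real"
  assumes "bounded_lipschitz f" and low: "\<And>a. f a \<ge> 1/16"
  shows "bounded_lipschitz (\<lambda>a. 1 / sqrt (f a))"
proof -
  obtain B L where f: "\<And>a. norm (f a) \<le> B" "\<And>a b. norm (f a - f b) \<le> L * dist a b"
    using bounded_lipschitzE[OF assms(1)] by metis
  have low': "sqrt (f a) \<ge> 1/4" for a by (rule real_le_rsqrt) (use low in \<open>simp add: power2_eq_square\<close>)
  show ?thesis
  proof (rule bounded_lipschitzI)
    show "norm (1 / sqrt (f a)) \<le> 4" for a
    proof -
      have "\<bar>sqrt (f a)\<bar> = sqrt (f a)" using low'[of a] by linarith
      then show ?thesis using low'[of a] low[of a] by (simp add: divide_le_eq)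
    qed
    show "norm (1 / sqrt (f a) - 1 / sqrt (f b)) \<le> (32 * L) * dist a b" for a b
    proof -
      let ?a = "sqrt (f a)" and ?b = "sqrt (f b)"
      have ab: "?a \<ge> 1/4" "?b \<ge> 1/4" using low' by auto
      have pos: "?a * ?b * (?a + ?b) > 0" using ab by (intro mult_pos_pos add_pos_pos) linarith+
      have "1 / A - 1 / B = (B\<^sup>2 - A\<^sup>2) / (A * B * (A + B))" if "A > 0" "B > 0" for A B :: real
      proof -
        have "B\<^sup>2 - A\<^sup>2 = (B - A) * (A + B)" by algebra
        moreover have "1 / A - 1 / B = (B - A) / (A * B)" using that by (simp add: field_simps)
        ultimately show ?thesis using that by simp
      qed
      from this[of ?a ?b] have "1 / ?a - 1 / ?b = (f b - f a) / (?a * ?b * (?a + ?b))"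
        using low[of a] low[of b] ab by simp
      also have "\<bar>\<dots>\<bar> = \<bar>f a - f b\<bar> / (?a * ?b * (?a + ?b))"
        using pos by (simp only: abs_divide abs_of_pos abs_minus_commute)
      also have "\<dots> \<le> \<bar>f a - f b\<bar> / (1/32)"
      proof (rule divide_left_mono)
        have "1/4 * (1/4) * (1/4 + 1/4) \<le> ?a * ?b * (?a + ?b)"
          using ab by (intro mult_mono add_mono mult_nonneg_nonneg) linarith+
        then show "1/32 \<le> ?a * ?b * (?a + ?b)" by simp
      qed (use pos in auto)
      finally show ?thesis using f(2)[of a b] by simp
    qed
  qed
qed

lemmas bounded_lipschitz_intros =
  bounded_lipschitz_const bounded_lipschitz_add bounded_lipschitz_mult bounded_lipschitz_diff
  bounded_lipschitz_power

lemma lipschitz_Pair_bounded: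
  assumes "bounded_lipschitz f" "\<exists>L. L-lipschitz_on UNIV g"
  shows "\<exists>L. L-lipschitz_on UNIV (\<lambda>a. (f a, g a))"
  using assms lipschitz_on_Pair unfolding bounded_lipschitz_def by blast

type_synonym state = "real \<times> real \<times> real \<times> real \<times> real"

text \<open>On the invariant plane \<open>u\<^sub>1 + iu\<^sub>2 = x exp (-i\<pi>/8)\<close>, \<open>u\<^sub>3 + iu\<^sub>4 = y exp (i\<pi>/8)\<close>,
  \<open>v\<^sub>1 + iv\<^sub>2 = p exp (-i\<pi>/8)\<close>, \<open>v\<^sub>3 + iv\<^sub>4 = q exp (i\<pi>/8)\<close> the four bodies form a rectangle and
  the Hamiltonian becomes \<open>rect_energy\<close>, with \<open>p' = rect_force E x y q\<close> and
  \<open>q' = rect_force E y x p\<close>.\<close>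

definition rect_energy :: "real \<Rightarrow> real \<Rightarrow> real \<Rightarrow> real \<Rightarrow> real \<Rightarrow> real" where
  "rect_energy E x y p q =
     (p\<^sup>2 * y\<^sup>2 + q\<^sup>2 * x\<^sup>2) / 8 - 2 * (x\<^sup>2 * y\<^sup>2 / sqrt (x ^ 4 + y ^ 4)) - 2 * (x\<^sup>2 + y\<^sup>2) - E * x\<^sup>2 * y\<^sup>2"

definition rect_force :: "real \<Rightarrow> real \<Rightarrow> real \<Rightarrow> real \<Rightarrow> real" where
  "rect_force E x y q = x * (4 - q\<^sup>2 / 4 + 4 * (y ^ 6 / sqrt (x ^ 4 + y ^ 4) ^ 3) + 2 * E * y\<^sup>2)"

text \<open>The floor 1/16 is \<open>(1/2) ^ 4\<close>: it removes the singularity at the origin and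
  is inactive as long as \<open>y\<close> is at least 1/2.\<close>

definition truncated_force :: "real \<Rightarrow> real \<Rightarrow> real \<Rightarrow> real \<Rightarrow> real" where
  "truncated_force E x y q =
     x * (4 - q\<^sup>2 / 4 + 4 * (y ^ 6 / sqrt (max (1/16) (x ^ 4 + y ^ 4)) ^ 3) + 2 * E * y\<^sup>2)"

text \<open>The energy is carried along as a fifth, constant coordinate, which makes the dependence on
  the energy a case of the dependence on the initial value.\<close>

definition truncated_field :: "state \<Rightarrow> state" where
  "truncated_field = (\<lambda>(x, y, p, q, E).
     let x = trunc 2 x; y = trunc 2 y; p = trunc 10 p; q = trunc 10 q; E = trunc 12 E
     in (p * y\<^sup>2 / 4, q * x\<^sup>2 / 4, truncated_force E x y q, truncated_force E y x p, 0))"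

lemma truncated_field_lipschitz: "\<exists>L. L-lipschitz_on UNIV truncated_field"
proof -
  have d: "\<bar>fst w - fst w'\<bar> \<le> dist w w'" "dist (snd w) (snd w') \<le> dist w w'"
    for w w' :: "real \<times> 'a::metric_space"
    using dist_fst_le[of w w'] dist_snd_le[of w w'] by (simp_all add: dist_real_def)
  let ?x = "\<lambda>w::state. trunc 2 (fst w)" and ?y = "\<lambda>w::state. trunc 2 (fst (snd w))"
    and ?p = "\<lambda>w::state. trunc 10 (fst (snd (snd w)))" and ?q = "\<lambda>w::state. trunc 10 (fst (snd (snd (snd w))))"
    and ?E = "\<lambda>w::state. trunc 12 (snd (snd (snd (snd w))))"
  note d1 = d(1) and d2 = order_trans[OF d(1) d(2)]
  note d3 = order_trans[OF d(1) order_trans[OF d(2) d(2)]]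
  note d4 = order_trans[OF d(1) order_trans[OF d(2) order_trans[OF d(2) d(2)]]]
  have d5: "\<bar>snd (snd (snd (snd w))) - snd (snd (snd (snd w')))\<bar> \<le> dist w w'" for w w' :: state
    using order_trans[OF d(2) order_trans[OF d(2) order_trans[OF d(2) d(2)]], of w w']
    by (simp add: dist_real_def)
  have c: "bounded_lipschitz ?x" "bounded_lipschitz ?y" "bounded_lipschitz ?p" "bounded_lipschitz ?q"
    "bounded_lipschitz ?E"
    by (rule bounded_lipschitz_trunc, rule d1 d2 d3 d4 d5, simp)+
  have force: "bounded_lipschitz (\<lambda>w. truncated_force (e w) (a w) (b w) (r w))"
    if "bounded_lipschitz e" "bounded_lipschitz a" "bounded_lipschitz b" "bounded_lipschitz r"
    for e a b r :: "state \<Rightarrow> real"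
  proof -
    have "bounded_lipschitz (\<lambda>w. 1 / sqrt (max (1/16) (a w ^ 4 + b w ^ 4)))"
      by (intro bounded_lipschitz_inverse_sqrt bounded_lipschitz_max bounded_lipschitz_intros that) auto
    then have "bounded_lipschitz (\<lambda>w. a w * (4 - 1/4 * (r w)\<^sup>2
        + 4 * (b w ^ 6 * (1 / sqrt (max (1/16) (a w ^ 4 + b w ^ 4))) ^ 3) + 2 * e w * (b w)\<^sup>2))"
      by (intro bounded_lipschitz_intros that)
    then show ?thesis by (simp add: truncated_force_def power_one_over)
  qed
  have eq: "truncated_field = (\<lambda>w. (1/4 * ?p w * (?y w)\<^sup>2, 1/4 * ?q w * (?x w)\<^sup>2,
      truncated_force (?E w) (?x w) (?y w) (?q w), truncated_force (?E w) (?y w) (?x w) (?p w), 0))"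
    by (auto simp: truncated_field_def fun_eq_iff Let_def)
  have "\<exists>L. L-lipschitz_on UNIV (\<lambda>_::state. 0::real)"
    using lipschitz_on_constant by blast
  then show ?thesis
    unfolding eq by (intro lipschitz_Pair_bounded bounded_lipschitz_intros force c)
qed

text \<open>With \<open>x = 0\<close> and \<open>q = 0\<close> the energy is
  \<open>p\<^sup>2 * y\<^sup>2 / 8 - 2 * y\<^sup>2\<close>, whatever \<open>E\<close> is. The values
  \<open>y = 1\<close>, \<open>p = 4\<close> thus lie on the zero level for all \<open>E\<close>
  simultaneously, and \<open>E\<close> alone serves as the shooting parameter.\<close>

locale truncated_solution =
  fixes E :: real and x y p q :: "real \<Rightarrow> real"
  assumes E: "-12 \<le> E" "E \<le> 0"
    and init: "x 0 = 0" "y 0 = 1" "p 0 = 4" "q 0 = 0"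
    and dx: "\<And>s. (x has_real_derivative trunc 10 (p s) * (trunc 2 (y s))\<^sup>2 / 4) (at s)"
    and dy: "\<And>s. (y has_real_derivative trunc 10 (q s) * (trunc 2 (x s))\<^sup>2 / 4) (at s)"
    and dp: "\<And>s. (p has_real_derivative
        truncated_force E (trunc 2 (x s)) (trunc 2 (y s)) (trunc 10 (q s))) (at s)"
    and dq: "\<And>s. (q has_real_derivative
        truncated_force E (trunc 2 (y s)) (trunc 2 (x s)) (trunc 10 (p s))) (at s)"

lemma truncated_solution_components:
  fixes z :: "real \<Rightarrow> state"
  assumes z: "\<And>s. (z has_vector_derivative truncated_field (z s)) (at s)"
    and z0: "z 0 = (0, 1, 4, 0, E)" and E: "-12 \<le> E" "E \<le> 0"
  shows "truncated_solution E (\<lambda>s. fst (z s)) (\<lambda>s. fst (snd (z s)))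
           (\<lambda>s. fst (snd (snd (z s)))) (\<lambda>s. fst (snd (snd (snd (z s)))))"
    and "snd (snd (snd (snd (z s)))) = E"
proof -
  have f: "((\<lambda>s. fst (w s)) has_vector_derivative fst w') (at s)"
    and s: "((\<lambda>s. snd (w s)) has_vector_derivative snd w') (at s)"
    if "(w has_vector_derivative w') (at s)" for w :: "real \<Rightarrow> 'a::real_normed_vector \<times> 'b::real_normed_vector" and w' s
    by (rule bounded_linear.has_vector_derivative[OF bounded_linear_fst that]
          bounded_linear.has_vector_derivative[OF bounded_linear_snd that])+
  note d1 = f[OF z] and d2 = f[OF s[OF z]] and d3 = f[OF s[OF s[OF z]]]
    and d4 = f[OF s[OF s[OF s[OF z]]]] and d5 = s[OF s[OF s[OF s[OF z]]]]
  have e0: "snd (snd (snd (snd (truncated_field w)))) = 0" for w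
    by (simp add: truncated_field_def split_beta Let_def)
  have e: "snd (snd (snd (snd (z s)))) = E" for s
  proof -
    have "((\<lambda>s. snd (snd (snd (snd (z s))))) has_real_derivative 0) (at s)" for s
      using d5[of s] by (simp add: e0 has_real_derivative_iff_has_vector_derivative)
    then have "snd (snd (snd (snd (z s)))) = snd (snd (snd (snd (z 0))))"
      by (intro DERIV_isconst_all) auto
    then show ?thesis by (simp add: z0)
  qed
  then show "snd (snd (snd (snd (z s)))) = E" .
  have E12: "trunc 12 E = E" using E by (intro trunc_id) simp
  show "truncated_solution E (\<lambda>s. fst (z s)) (\<lambda>s. fst (snd (z s)))
           (\<lambda>s. fst (snd (snd (z s)))) (\<lambda>s. fst (snd (snd (snd (z s)))))"
    using d1 d2 d3 d4 E unfolding has_real_derivative_iff_has_vector_derivative[symmetric]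
    by unfold_locales (auto simp: z0 truncated_field_def split_beta Let_def e E12)
qed

section \<open>Shooting from a collision to the diagonal\<close>

text \<open>With \<open>r\<close> for the root, the partial derivative in \<open>x\<close> is
  \<open>2 * x * y\<^sup>2 * (r\<^sup>2 - x ^ 4) / r ^ 3\<close>, and
  \<open>r\<^sup>2 - x ^ 4\<close> is \<open>y ^ 4\<close>; likewise in \<open>y\<close>.\<close>

lemma DERIV_rect_potential:
  fixes x y :: "real \<Rightarrow> real"
  assumes "(x has_real_derivative x') (at s)" "(y has_real_derivative y') (at s)"
    and pos: "x s ^ 4 + y s ^ 4 > 0"
  shows "((\<lambda>s. (x s)\<^sup>2 * (y s)\<^sup>2 / sqrt (x s ^ 4 + y s ^ 4)) has_real_derivative
      2 * x s * (y s ^ 6 / sqrt (x s ^ 4 + y s ^ 4) ^ 3) * x'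
      + 2 * y s * (x s ^ 6 / sqrt (x s ^ 4 + y s ^ 4) ^ 3) * y') (at s)"
proof -
  define r where "r = sqrt (x s ^ 4 + y s ^ 4)"
  have r: "r > 0" "r\<^sup>2 = x s ^ 4 + y s ^ 4" using pos by (simp_all add: r_def)
  have n: "((\<lambda>s. x s ^ 4 + y s ^ 4) has_real_derivative 4 * x s ^ 3 * x' + 4 * y s ^ 3 * y') (at s)"
    using assms(1,2) by (auto intro!: derivative_eq_intros)
  have rd: "((\<lambda>s. sqrt (x s ^ 4 + y s ^ 4)) has_real_derivative (4 * x s ^ 3 * x' + 4 * y s ^ 3 * y') / (2 * r)) (at s)"
  proof -
    have "(sqrt has_real_derivative inverse r / 2) (at (x s ^ 4 + y s ^ 4))"
      using DERIV_real_sqrt[OF pos] by (simp only: r_def)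
    from DERIV_chain2[where f = sqrt and g = "\<lambda>s. x s ^ 4 + y s ^ 4" and x = s, OF this n]
    have "((\<lambda>s. sqrt (x s ^ 4 + y s ^ 4)) has_real_derivative
        inverse r / 2 * (4 * x s ^ 3 * x' + 4 * y s ^ 3 * y')) (at s)" .
    moreover have "inverse r / 2 * c = c / (2 * r)" for c by (simp add: field_simps)
    ultimately show ?thesis by (simp only:)
  qed
  have nd: "((\<lambda>s. (x s)\<^sup>2 * (y s)\<^sup>2) has_real_derivative 2 * x s * x' * (y s)\<^sup>2 + (x s)\<^sup>2 * (2 * y s * y')) (at s)"
    using assms(1,2) by (auto intro!: derivative_eq_intros)
  have "((2 * x s * x' * (y s)\<^sup>2 + (x s)\<^sup>2 * (2 * y s * y')) * r
      - (x s)\<^sup>2 * (y s)\<^sup>2 * ((4 * x s ^ 3 * x' + 4 * y s ^ 3 * y') / (2 * r))) / (r * r)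
    = ((2 * x s * x' * (y s)\<^sup>2 + (x s)\<^sup>2 * (2 * y s * y')) * r\<^sup>2
      - (x s)\<^sup>2 * (y s)\<^sup>2 * (2 * x s ^ 3 * x' + 2 * y s ^ 3 * y')) / r ^ 3"
    using r(1) by (simp add: field_simps power2_eq_square power3_eq_cube)
  also have "\<dots> = (2 * x s * y s ^ 6 * x' + 2 * y s * x s ^ 6 * y') / r ^ 3"
    unfolding r(2) by (rule arg_cong[where f = "\<lambda>a. a / r ^ 3"]) algebra
  finally show ?thesis
    using DERIV_divide[OF nd rd] r(1) by (simp add: r_def add_divide_distrib algebra_simps)
qed

lemma DERIV_rect_energy:
  fixes x y p q :: "real \<Rightarrow> real"
  assumes dx: "(x has_real_derivative p s * (y s)\<^sup>2 / 4) (at s)"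
    and dy: "(y has_real_derivative q s * (x s)\<^sup>2 / 4) (at s)"
    and dp: "(p has_real_derivative rect_force E (x s) (y s) (q s)) (at s)"
    and dq: "(q has_real_derivative rect_force E (y s) (x s) (p s)) (at s)"
    and pos: "x s ^ 4 + y s ^ 4 > 0"
  shows "((\<lambda>s. rect_energy E (x s) (y s) (p s) (q s)) has_real_derivative 0) (at s)"
proof -
  define G where "G s = (x s)\<^sup>2 * (y s)\<^sup>2 / sqrt (x s ^ 4 + y s ^ 4)" for s
  note dG = DERIV_rect_potential[OF dx dy pos, folded G_def]
  have "((\<lambda>s. 1/8 * ((p s)\<^sup>2 * (y s)\<^sup>2 + (q s)\<^sup>2 * (x s)\<^sup>2) - 2 * G s - 2 * ((x s)\<^sup>2 + (y s)\<^sup>2)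
      - E * (x s)\<^sup>2 * (y s)\<^sup>2) has_real_derivative 0) (at s)"
  proof (rule DERIV_cong, (rule derivative_eq_intros dx dy dp dq dG refl)+, goal_cases)
    case 1
    define a b where "a = y s ^ 6 / sqrt (x s ^ 4 + y s ^ 4) ^ 3" and "b = x s ^ 6 / sqrt (x s ^ 4 + y s ^ 4) ^ 3"
    have f: "rect_force E (x s) (y s) (q s) = x s * (4 - (q s)\<^sup>2 / 4 + 4 * a + 2 * E * (y s)\<^sup>2)"
      "rect_force E (y s) (x s) (p s) = y s * (4 - (p s)\<^sup>2 / 4 + 4 * b + 2 * E * (x s)\<^sup>2)"
      by (simp_all add: rect_force_def a_def b_def add.commute[of "y s ^ 4"])
    show ?case
      unfolding f a_def[symmetric] b_def[symmetric] by (simp add: field_simps power2_eq_square)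
  qed
  then show ?thesis by (simp add: rect_energy_def G_def)
qed

text \<open>On the zero level the term with \<open>E\<close> can be expressed by the momenta and the
  potential. After this elimination the sign of the factor in the force on \<open>q\<close> is
  decided by the size of \<open>q\<close> alone, uniformly in the energy.\<close>

lemma rect_energy_zero_identity:
  assumes "rect_energy E x y p q = 0" and n: "x ^ 4 + y ^ 4 > 0"
  shows "y\<^sup>2 * (4 - p\<^sup>2 / 4 + 4 * (x ^ 6 / sqrt (x ^ 4 + y ^ 4) ^ 3) + 2 * E * x\<^sup>2)
    = x\<^sup>2 * (q\<^sup>2 / 4 - 4 - 4 * (y ^ 6 / sqrt (x ^ 4 + y ^ 4) ^ 3))"
proof -
  define r where "r = sqrt (x ^ 4 + y ^ 4)"
  have r: "r > 0" "r\<^sup>2 = x ^ 4 + y ^ 4" using n by (simp_all add: r_def)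
  have "x\<^sup>2 * y\<^sup>2 / r = x\<^sup>2 * y\<^sup>2 * r\<^sup>2 / r ^ 3"
    using r(1) by (simp add: power2_eq_square power3_eq_cube)
  also have "\<dots> = x\<^sup>2 * (y ^ 6 / r ^ 3) + y\<^sup>2 * (x ^ 6 / r ^ 3)"
    unfolding r(2) by (simp add: add_divide_distrib algebra_simps)
  finally have "x\<^sup>2 * y\<^sup>2 / r = x\<^sup>2 * (y ^ 6 / r ^ 3) + y\<^sup>2 * (x ^ 6 / r ^ 3)" .
  then show ?thesis
    using assms(1) unfolding rect_energy_def r_def[symmetric] by algebra
qed

lemma rect_energy_commute: "rect_energy E y x q p = rect_energy E x y p q"
  unfolding rect_energy_def by (simp add: add.commute[of "y ^ 4"] algebra_simps)

text \<open>In the original variables \<open>q / y\<close> is a momentum belonging to the side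
  \<open>y\<^sup>2\<close> of the rectangle. Newtonian attraction shortens the sides, so the
  derivative has a sign for every energy; it is the rate of time
  \<open>x\<^sup>2 * y\<^sup>2\<close> times the force.\<close>

lemma DERIV_slope:
  fixes x y p q :: "real \<Rightarrow> real"
  assumes dy: "(y has_real_derivative q s * (x s)\<^sup>2 / 4) (at s)"
    and dq: "(q has_real_derivative rect_force E (y s) (x s) (p s)) (at s)"
    and energy: "rect_energy E (x s) (y s) (p s) (q s) = 0"
    and pos: "x s ^ 4 + y s ^ 4 > 0" and y: "y s \<noteq> 0"
  shows "((\<lambda>s. q s / y s) has_real_derivative
    - (4 * (x s)\<^sup>2 / (y s)\<^sup>2) * (1 + y s ^ 6 / sqrt (x s ^ 4 + y s ^ 4) ^ 3)) (at s)"
proof -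
  define a where "a = y s ^ 6 / sqrt (x s ^ 4 + y s ^ 4) ^ 3"
  define b where "b = 4 - (p s)\<^sup>2 / 4 + 4 * (x s ^ 6 / sqrt (x s ^ 4 + y s ^ 4) ^ 3) + 2 * E * (x s)\<^sup>2"
  have id: "(y s)\<^sup>2 * b = (x s)\<^sup>2 * ((q s)\<^sup>2 / 4 - 4 - 4 * a)"
    using rect_energy_zero_identity[OF energy pos] by (simp add: a_def b_def)
  have f: "rect_force E (y s) (x s) (p s) = y s * b"
    by (simp add: rect_force_def b_def add.commute)
  have "((\<lambda>s. q s / y s) has_real_derivative
      (y s * b * y s - q s * (q s * (x s)\<^sup>2 / 4)) / (y s * y s)) (at s)"
    using DERIV_divide[OF dq dy] y by (simp add: f)
  moreover have "(y s * b * y s - q s * (q s * (x s)\<^sup>2 / 4)) / (y s * y s) = - (4 * (x s)\<^sup>2 / (y s)\<^sup>2) * (1 + a)"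
  proof -
    have "y s * b * y s - q s * (q s * (x s)\<^sup>2 / 4) = - (4 * (x s)\<^sup>2 * (1 + a))"
    proof -
      have "y s * b * y s = (x s)\<^sup>2 * ((q s)\<^sup>2 / 4 - 4 - 4 * a)" using id by (simp add: power2_eq_square mult_ac)
      then show ?thesis by (simp add: field_simps power2_eq_square)
    qed
    then show ?thesis by (simp add: power2_eq_square)
  qed
  ultimately show ?thesis by (simp add: a_def)
qed

section \<open>A priori bounds up to the exit from the region below the diagonal\<close>

context truncated_solution
begin

text \<open>An open region for a continuation argument, with a closed companion that persists up to
  the exit time itself. Only the conditions \<open>x s < y s\<close> and
  \<open>0 < p s + q s\<close> are meant to fail; the remaining constants leave slack over what
  \<open>a_priori_bounds\<close> proves.\<close>

definition inside :: "real \<Rightarrow> bool" where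
  "inside s \<longleftrightarrow> -1 < x s \<and> x s < y s \<and> 0 < p s + q s \<and> \<bar>p s\<bar> < 10 \<and> \<bar>q s\<bar> < 10 \<and>
     1/2 < y s \<and> y s < 2"

definition weakly_inside :: "real \<Rightarrow> bool" where
  "weakly_inside s \<longleftrightarrow> -1 \<le> x s \<and> x s \<le> y s \<and> 0 \<le> p s + q s \<and> \<bar>p s\<bar> \<le> 10 \<and> \<bar>q s\<bar> \<le> 10 \<and>
     1/2 \<le> y s \<and> y s \<le> 2"

lemma inside_weakly_inside: "inside s \<Longrightarrow> weakly_inside s"
  by (simp add: inside_def weakly_inside_def)

lemma continuous_coordinates [continuous_intros]:
  "continuous_on S x" "continuous_on S y" "continuous_on S p" "continuous_on S q"
  by (rule DERIV_continuous_on, rule has_field_derivative_at_within, rule dx dy dp dq)+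

lemma closed_weakly_inside: "closed {s. weakly_inside s}"
  unfolding weakly_inside_def
  by (intro closed_Collect_conj closed_Collect_le continuous_intros)

lemma open_inside: "open {s. inside s}"
  unfolding inside_def
  by (intro open_Collect_conj open_Collect_less continuous_intros)

text \<open>The hypotheses involve only absolute values and even powers. They therefore survive the
  reflections, while \<open>weakly_inside\<close> does not.\<close>

lemma untruncated:
  assumes "\<bar>x s\<bar> \<le> 2" "\<bar>y s\<bar> \<le> 2" "\<bar>p s\<bar> \<le> 10" "\<bar>q s\<bar> \<le> 10" and n: "1/16 \<le> x s ^ 4 + y s ^ 4"
  shows "(x has_real_derivative p s * (y s)\<^sup>2 / 4) (at s)"
    "(y has_real_derivative q s * (x s)\<^sup>2 / 4) (at s)"
    "(p has_real_derivative rect_force E (x s) (y s) (q s)) (at s)"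
    "(q has_real_derivative rect_force E (y s) (x s) (p s)) (at s)"
proof -
  have t: "trunc 10 (p s) = p s" "trunc 10 (q s) = q s" "trunc 2 (x s) = x s" "trunc 2 (y s) = y s"
    using assms by (auto intro!: trunc_id)
  have "truncated_force E (x s) (y s) (q s) = rect_force E (x s) (y s) (q s)"
    "truncated_force E (y s) (x s) (p s) = rect_force E (y s) (x s) (p s)"
    using n by (simp_all add: truncated_force_def rect_force_def max_def add.commute)
  then show "(x has_real_derivative p s * (y s)\<^sup>2 / 4) (at s)"
    "(y has_real_derivative q s * (x s)\<^sup>2 / 4) (at s)"
    "(p has_real_derivative rect_force E (x s) (y s) (q s)) (at s)"
    "(q has_real_derivative rect_force E (y s) (x s) (p s)) (at s)"
    using dx[of s] dy[of s] dp[of s] dq[of s] by (simp_all add: t)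
qed

lemma weakly_inside_bounds:
  assumes "weakly_inside s"
  shows "\<bar>x s\<bar> \<le> 2" "\<bar>y s\<bar> \<le> 2" "\<bar>p s\<bar> \<le> 10" "\<bar>q s\<bar> \<le> 10" "1/16 \<le> x s ^ 4 + y s ^ 4"
proof -
  show "\<bar>x s\<bar> \<le> 2" "\<bar>y s\<bar> \<le> 2" "\<bar>p s\<bar> \<le> 10" "\<bar>q s\<bar> \<le> 10"
    using assms by (auto simp: weakly_inside_def)
  have "(1/2) ^ 4 \<le> y s ^ 4"
    using assms by (intro power_mono) (auto simp: weakly_inside_def)
  then show "1/16 \<le> x s ^ 4 + y s ^ 4"
    by (simp add: power_one_over add_increasing)
qed

lemma true_derivatives:
  assumes "weakly_inside s"
  shows "(x has_real_derivative p s * (y s)\<^sup>2 / 4) (at s)"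
    "(y has_real_derivative q s * (x s)\<^sup>2 / 4) (at s)"
    "(p has_real_derivative rect_force E (x s) (y s) (q s)) (at s)"
    "(q has_real_derivative rect_force E (y s) (x s) (p s)) (at s)"
    "x s ^ 4 + y s ^ 4 > 0"
  using untruncated[OF weakly_inside_bounds[OF assms]] weakly_inside_bounds(5)[OF assms] by simp_all

lemma x_rising:
  assumes "weakly_inside s" "0 \<le> p s"
  shows "\<exists>d. (x has_real_derivative d) (at s) \<and> 0 \<le> d"
  using true_derivatives(1)[OF assms(1)] assms(2)
  by (intro exI[of _ "p s * (y s)\<^sup>2 / 4"]) simp

lemma energy_zero:
  assumes "t \<ge> 0" and W: "\<And>s. 0 \<le> s \<Longrightarrow> s \<le> t \<Longrightarrow> weakly_inside s"
  shows "rect_energy E (x t) (y t) (p t) (q t) = 0"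
proof (cases "t = 0")
  case True
  then show ?thesis by (simp add: init rect_energy_def)
next
  case False
  let ?h = "\<lambda>s. rect_energy E (x s) (y s) (p s) (q s)"
  have d: "(?h has_real_derivative 0) (at s)" if "0 \<le> s" "s \<le> t" for s
    using DERIV_rect_energy[OF true_derivatives[OF W[OF that]]] .
  have "?h t = ?h 0"
  proof (rule DERIV_isconst2[of 0 t])
    show "continuous_on {0..t} ?h"
      by (intro continuous_at_imp_continuous_on ballI DERIV_isCont[OF d]) auto
  qed (use False assms(1) d in auto)
  then show ?thesis by (simp add: init rect_energy_def)
qed

lemma slope_derivative:
  assumes "weakly_inside s" "rect_energy E (x s) (y s) (p s) (q s) = 0"
  shows "((\<lambda>s. q s / y s) has_real_derivative
    - (4 * (x s)\<^sup>2 / (y s)\<^sup>2) * (1 + y s ^ 6 / sqrt (x s ^ 4 + y s ^ 4) ^ 3)) (at s)"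
  using true_derivatives[OF assms(1)] assms by (intro DERIV_slope) (auto simp: weakly_inside_def)

text \<open>The signs come in a chain. The slope \<open>q / y\<close> falls from 0, so
  \<open>q\<close> is nonpositive; \<open>p + q \<ge> 0\<close> then makes \<open>p\<close>
  nonnegative; hence \<open>x\<close> grows from 0 and \<open>y\<close> shrinks from 1. Together
  with \<open>x \<le> y\<close> these signs make \<open>x\<^sup>2 + y\<^sup>2\<close> grow from 1,
  which leaves at least 1/2 for \<open>y\<^sup>2\<close>. The bounds on the momenta are quantitative
  versions of the slope equation and of the zero level.\<close>

lemma a_priori_bounds:
  assumes "t \<ge> 0" and W: "\<And>s. 0 \<le> s \<Longrightarrow> s \<le> t \<Longrightarrow> weakly_inside s"
  shows "0 \<le> x t" "y t \<le> 1" "1 \<le> (x t)\<^sup>2 + (y t)\<^sup>2" "1/2 \<le> (y t)\<^sup>2" "q t \<le> 0" "0 \<le> p t"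
    "(q t)\<^sup>2 \<le> 16" "(p t)\<^sup>2 \<le> 96"
proof -
  have H: "rect_energy E (x s) (y s) (p s) (q s) = 0" if "0 \<le> s" "s \<le> t" for s
    using energy_zero[of s] that W by auto
  have ypos: "y s > 0" if "0 \<le> s" "s \<le> t" for s using W[OF that] by (simp add: weakly_inside_def)
  have apos: "y s ^ 6 / sqrt (x s ^ 4 + y s ^ 4) ^ 3 \<ge> 0" if "0 \<le> s" "s \<le> t" for s
    using ypos[OF that] by (intro divide_nonneg_nonneg zero_le_power) auto
  have q: "q s \<le> 0" if s: "0 \<le> s" "s \<le> t" for s
  proof -
    have "q s / y s \<le> q 0 / y 0"
    proof (rule DERIV_nonpos_imp_nonincreasing[of 0 s "\<lambda>s. q s / y s"])
      fix u assume u: "0 \<le> u" "u \<le> s"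
      have "- (4 * (x u)\<^sup>2 / (y u)\<^sup>2) * (1 + y u ^ 6 / sqrt (x u ^ 4 + y u ^ 4) ^ 3) \<le> 0"
        using apos[of u] u s by (simp add: mult_nonneg_nonneg)
      then show "\<exists>d. ((\<lambda>s. q s / y s) has_real_derivative d) (at u) \<and> d \<le> 0"
        using slope_derivative[of u] W[of u] H[of u] u s by (intro exI conjI) auto
    qed (rule s)
    then show ?thesis using ypos[OF s] by (simp add: init divide_le_0_iff)
  qed
  have p: "0 \<le> p s" if s: "0 \<le> s" "s \<le> t" for s
    using W[OF s] q[OF s] by (simp add: weakly_inside_def)
  have x: "0 \<le> x s" if s: "0 \<le> s" "s \<le> t" for s
  proof -
    have "x 0 \<le> x s"
    proof (rule DERIV_nonneg_imp_nondecreasing[OF s(1)])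
      fix u assume u: "0 \<le> u" "u \<le> s"
      show "\<exists>d. (x has_real_derivative d) (at u) \<and> 0 \<le> d"
        using x_rising[of u] W[of u] p[of u] u s by simp
    qed
    then show ?thesis by (simp add: init)
  qed
  show "0 \<le> x t" "q t \<le> 0" "0 \<le> p t" using x q p assms(1) by auto
  show "y t \<le> 1"
  proof -
    have "y t \<le> y 0"
    proof (rule DERIV_nonpos_imp_nonincreasing[OF assms(1)])
      fix u assume u: "0 \<le> u" "u \<le> t"
      show "\<exists>d. (y has_real_derivative d) (at u) \<and> d \<le> 0"
        using true_derivatives(2)[OF W[OF u]] q[OF u]
        by (intro exI[of _ "q u * (x u)\<^sup>2 / 4"]) (simp add: mult_nonpos_nonneg)
    qed
    then show ?thesis by (simp add: init)
  qed
  show xy: "1 \<le> (x t)\<^sup>2 + (y t)\<^sup>2"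
  proof -
    have "(x 0)\<^sup>2 + (y 0)\<^sup>2 \<le> (x t)\<^sup>2 + (y t)\<^sup>2"
    proof (rule DERIV_nonneg_imp_nondecreasing[OF assms(1)])
      fix u assume u: "0 \<le> u" "u \<le> t"
      note W = W[OF u] and x = x[OF u] and y = ypos[OF u] and p = p[OF u]
      have "p u * x u \<le> p u * y u" using W p by (intro mult_left_mono) (auto simp: weakly_inside_def)
      moreover have "- (p u * x u) \<le> q u * x u"
        using W x mult_right_mono[of "- p u" "q u" "x u"] by (simp add: weakly_inside_def)
      ultimately have nn: "0 \<le> x u * y u * (p u * y u + q u * x u) / 2"
        using x y by (simp add: mult_nonneg_nonneg)
      have "((\<lambda>s. (x s)\<^sup>2 + (y s)\<^sup>2) has_real_derivative x u * y u * (p u * y u + q u * x u) / 2) (at u)"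
        by (rule derivative_eq_intros true_derivatives[OF W] refl)+ (simp add: power2_eq_square field_simps)
      then show "\<exists>d. ((\<lambda>s. (x s)\<^sup>2 + (y s)\<^sup>2) has_real_derivative d) (at u) \<and> 0 \<le> d"
        using nn by blast
    qed
    then show ?thesis by (simp add: init)
  qed
  have "(x t)\<^sup>2 \<le> (y t)\<^sup>2"
    using W[of t] x[of t] assms(1) by (intro power_mono) (auto simp: weakly_inside_def)
  then show y2: "1/2 \<le> (y t)\<^sup>2" using xy by linarith
  show "(q t)\<^sup>2 \<le> 16"
  proof -
    \<comment> \<open>If \<open>a\<close> below is replaced by its upper bound 1, this expression is
      conserved: it is the energy of a one-dimensional Kepler problem for the side
      \<open>y\<^sup>2\<close>. With the true, weaker attraction it can only decrease, and this
      yields \<open>q\<^sup>2 \<le> 32 - 32 * y\<^sup>2 \<le> 16\<close>.\<close>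
    have "(q t / y t)\<^sup>2 - 32 / (y t)\<^sup>2 \<le> (q 0 / y 0)\<^sup>2 - 32 / (y 0)\<^sup>2"
    proof (rule DERIV_nonpos_imp_nonincreasing[of 0 t "\<lambda>s. (q s / y s)\<^sup>2 - 32 / (y s)\<^sup>2"])
      fix u assume u: "0 \<le> u" "u \<le> t"
      note W = W[OF u] and H = H[OF u] and y = ypos[OF u]
      define a where "a = y u ^ 6 / sqrt (x u ^ 4 + y u ^ 4) ^ 3"
      have "a \<le> 1"
      proof -
        have "(y u ^ 2) ^ 3 \<le> sqrt (x u ^ 4 + y u ^ 4) ^ 3"
          by (intro power_mono real_le_rsqrt) (auto simp flip: power_mult)
        then show ?thesis using true_derivatives(5)[OF W]
          by (simp add: a_def divide_le_eq flip: power_mult)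
      qed
      have d1: "((\<lambda>s. q s / y s) has_real_derivative - (4 * (x u)\<^sup>2 / (y u)\<^sup>2) * (1 + a)) (at u)"
        using slope_derivative[OF W H] by (simp add: a_def)
      have "((\<lambda>s. (q s / y s)\<^sup>2 - 32 / (y s)\<^sup>2) has_real_derivative
          8 * (q u * (x u)\<^sup>2 / y u ^ 3) * (1 - a)) (at u)"
      proof -
        have d2: "((\<lambda>s. 32 / (y s)\<^sup>2) has_real_derivative - (16 * (q u * (x u)\<^sup>2 / y u ^ 3))) (at u)"
          using true_derivatives(2)[OF W] y
          by (auto intro!: derivative_eq_intros simp: field_simps power2_eq_square power3_eq_cube)
        have "2 * (q u / y u) * (- (4 * (x u)\<^sup>2 / (y u)\<^sup>2) * (1 + a)) - - (16 * (q u * (x u)\<^sup>2 / y u ^ 3))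
            = 8 * (q u * (x u)\<^sup>2 / y u ^ 3) * (1 - a)"
          using y by (simp add: field_simps power2_eq_square power3_eq_cube)
        then show ?thesis
          using DERIV_diff[OF DERIV_power[OF d1, of 2] d2] by (simp add: mult_ac)
      qed
      moreover have "8 * (q u * (x u)\<^sup>2 / y u ^ 3) * (1 - a) \<le> 0"
      proof (rule mult_nonpos_nonneg)
        have "q u * (x u)\<^sup>2 \<le> 0" using q[OF u] by (simp add: mult_nonpos_nonneg)
        then show "8 * (q u * (x u)\<^sup>2 / y u ^ 3) \<le> 0" using y by (simp add: divide_le_0_iff)
      qed (use \<open>a \<le> 1\<close> in simp)
      ultimately show "\<exists>d. ((\<lambda>s. (q s / y s)\<^sup>2 - 32 / (y s)\<^sup>2) has_real_derivative d) (at u) \<and> d \<le> 0"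
        by blast
    qed (rule assms(1))
    then have "((q t)\<^sup>2 - 32) / (y t)\<^sup>2 \<le> -32"
      by (simp add: init power_divide diff_divide_distrib)
    then have "(q t)\<^sup>2 \<le> 32 - 32 * (y t)\<^sup>2"
      using ypos[of t] assms(1) by (simp add: divide_le_eq)
    then show ?thesis using y2 by linarith
  qed
  show "(p t)\<^sup>2 \<le> 96"
  proof -
    note W = W[OF assms(1) order_refl] and H = H[OF assms(1) order_refl]
    let ?r = "sqrt (x t ^ 4 + y t ^ 4)"
    have r: "(y t)\<^sup>2 \<le> ?r" by (intro real_le_rsqrt) (auto simp flip: power_mult)
    have y1: "(y t)\<^sup>2 \<le> 1" using \<open>y t \<le> 1\<close> ypos[of t] assms(1) by (simp add: power_le_one)
    have "(x t)\<^sup>2 * (y t)\<^sup>2 / ?r \<le> (x t)\<^sup>2 * ?r / ?r"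
      using r by (intro divide_right_mono mult_left_mono) auto
    also have "\<dots> \<le> 1" using true_derivatives(5)[OF W] \<open>(x t)\<^sup>2 \<le> (y t)\<^sup>2\<close> y1 by simp
    finally have b1: "(x t)\<^sup>2 * (y t)\<^sup>2 / ?r \<le> 1" .
    have "E * (x t)\<^sup>2 * (y t)\<^sup>2 \<le> 0" using E by (simp add: mult_nonpos_nonneg)
    \<comment> \<open>The zero level with its monomials as variables: \<open>F\<close> is the
      potential quotient and \<open>e\<close> the term with \<open>E\<close>. The constant is
      \<open>8 * (2 + 4)\<close>; division by \<open>y\<^sup>2 \<ge> 1/2\<close> then produces 96,
      which is below the square of the truncation level 10.\<close>
    moreover have "P \<le> 48" if "(P + Q) / 8 - 2 * F - 2 * (X + Y) - e = 0" "F \<le> 1" "X \<le> Y" "Y \<le> 1" "e \<le> 0" "0 \<le> Q"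
      for P Q F X Y e :: real
    proof -
      have "P + Q = 8 * (2 * F + 2 * (X + Y) + e)" using that(1) by (simp add: field_simps)
      then show ?thesis using that by argo
    qed
    ultimately have "(p t)\<^sup>2 * (y t)\<^sup>2 \<le> 48"
      using H b1 \<open>(x t)\<^sup>2 \<le> (y t)\<^sup>2\<close> y1 zero_le_power2[of "q t * x t"]
      unfolding rect_energy_def power_mult_distrib by blast
    moreover have "(p t)\<^sup>2 * (1/2) \<le> (p t)\<^sup>2 * (y t)\<^sup>2" using y2 by (intro mult_left_mono) auto
    ultimately show ?thesis by linarith
  qed
qed

lemma inside_0: "inside 0" by (simp add: inside_def init)

text \<open>At the collision the slope has derivative zero, so strictness has to come from later
  times: \<open>x\<close> leaves 0 with speed 1 and never falls back, hence the slope falls strictly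
  on the second half of \<open>[0, t]\<close>.\<close>

lemma x_pos_slope_neg:
  assumes "t > 0" and W: "\<And>s. 0 \<le> s \<Longrightarrow> s \<le> t \<Longrightarrow> weakly_inside s"
  shows "x t > 0" "q t < 0"
proof -
  have xmono: "x a \<le> x b" if "0 \<le> a" "a \<le> b" "b \<le> t" for a b
  proof (rule DERIV_nonneg_imp_nondecreasing[OF that(2)])
    fix u assume u: "a \<le> u" "u \<le> b"
    show "\<exists>d. (x has_real_derivative d) (at u) \<and> 0 \<le> d"
      using u that W by (intro x_rising a_priori_bounds(6)) auto
  qed
  have "(x has_real_derivative 1) (at 0)"
    using true_derivatives(1)[OF inside_weakly_inside[OF inside_0]] by (simp add: init)
  then obtain d where d: "d > 0" "\<And>h. 0 < h \<Longrightarrow> h < d \<Longrightarrow> x 0 < x (0 + h)"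
    using DERIV_pos_inc_right[of x 1 0] by auto
  have xpos: "x s > 0" if "0 < s" "s \<le> t" for s
  proof -
    have "0 < x (min s (d/2))" using d(2)[of "min s (d/2)"] d(1) that by (simp add: init)
    also have "\<dots> \<le> x s" using that d(1) by (intro xmono) auto
    finally show ?thesis .
  qed
  then show "x t > 0" using assms(1) by simp
  have "q t / y t < q (t/2) / y (t/2)"
  proof (rule DERIV_neg_imp_decreasing[of "t/2" t "\<lambda>s. q s / y s"])
    fix u assume u: "t/2 \<le> u" "u \<le> t"
    have y: "y u > 0" using W[of u] u assms(1) by (simp add: weakly_inside_def)
    have "y u ^ 6 / sqrt (x u ^ 4 + y u ^ 4) ^ 3 \<ge> 0"
      using y by (intro divide_nonneg_nonneg zero_le_power) auto
    moreover have "4 * (x u)\<^sup>2 / (y u)\<^sup>2 > 0" using y xpos[of u] u assms(1) by simp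
    ultimately have "- (4 * (x u)\<^sup>2 / (y u)\<^sup>2) * (1 + y u ^ 6 / sqrt (x u ^ 4 + y u ^ 4) ^ 3) < 0"
      by (intro mult_neg_pos) linarith+
    moreover have "rect_energy E (x u) (y u) (p u) (q u) = 0"
      using u assms W by (intro energy_zero) auto
    ultimately show "\<exists>d. ((\<lambda>s. q s / y s) has_real_derivative d) (at u) \<and> d < 0"
      using slope_derivative[of u] W[of u] u assms(1) by (intro exI conjI) auto
  qed (use assms in simp)
  also have "\<dots> \<le> 0"
  proof -
    have "q (t/2) \<le> 0" using a_priori_bounds(5)[of "t/2"] W assms(1) by auto
    moreover have "y (t/2) > 0" using W[of "t/2"] assms(1) by (simp add: weakly_inside_def)
    ultimately show ?thesis by (simp add: divide_le_0_iff)
  qed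
  finally show "q t < 0"
    using W[of t] assms(1) by (simp add: weakly_inside_def divide_less_0_iff)
qed

text \<open>From time 1 on \<open>x\<close> is at least \<open>c = x 1\<close> and \<open>y\<close>
  is at most 1, so the slope falls at a rate of at least \<open>4 * c\<^sup>2\<close>. Inside the
  region it can never go below -20, since \<open>\<bar>q s\<bar> < 10\<close> and
  \<open>y s > 1/2\<close>.\<close>

lemma not_always_inside: "\<exists>s\<ge>0. \<not> inside s"
proof (rule ccontr)
  assume "\<not> ?thesis"
  then have I: "inside s" if "0 \<le> s" for s using that by blast
  then have W: "weakly_inside s" if "0 \<le> s" for s using that inside_weakly_inside by blast
  define c where "c = x 1"
  have c: "c > 0" unfolding c_def using x_pos_slope_neg(1)[of 1] W by simp
  have "q s / y s + 4 * c\<^sup>2 * s \<le> q 1 / y 1 + 4 * c\<^sup>2 * 1" if s: "1 \<le> s" for s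
  proof (rule DERIV_nonpos_imp_nonincreasing[OF s, of "\<lambda>s. q s / y s + 4 * c\<^sup>2 * s"])
    fix u assume u: "1 \<le> u" "u \<le> s"
    have y: "0 < y u" "y u \<le> 1" using a_priori_bounds(2)[of u] W I[of u] u by (auto simp: inside_def)
    have "x 1 \<le> x u"
    proof (rule DERIV_nonneg_imp_nondecreasing[OF u(1)])
      fix w assume w: "1 \<le> w" "w \<le> u"
      show "\<exists>d. (x has_real_derivative d) (at w) \<and> 0 \<le> d"
        using w u W by (intro x_rising a_priori_bounds(6)) auto
    qed
    then have "c\<^sup>2 \<le> (x u)\<^sup>2" using c by (intro power_mono) (auto simp: c_def)
    also have "(x u)\<^sup>2 \<le> (x u)\<^sup>2 / (y u)\<^sup>2"
      using y by (simp add: le_divide_eq mult_left_le power_le_one)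
    finally have c2: "c\<^sup>2 \<le> (x u)\<^sup>2 / (y u)\<^sup>2" .
    define a where "a = y u ^ 6 / sqrt (x u ^ 4 + y u ^ 4) ^ 3"
    have "a \<ge> 0" unfolding a_def using y by (intro divide_nonneg_nonneg zero_le_power) auto
    then have "4 * ((x u)\<^sup>2 / (y u)\<^sup>2) * 1 \<le> 4 * ((x u)\<^sup>2 / (y u)\<^sup>2) * (1 + a)"
      by (intro mult_left_mono) auto
    then have "- (4 * (x u)\<^sup>2 / (y u)\<^sup>2) * (1 + a) + 4 * c\<^sup>2 \<le> 0"
      using c2 by simp
    moreover have "((\<lambda>s. q s / y s + 4 * c\<^sup>2 * s) has_real_derivative - (4 * (x u)\<^sup>2 / (y u)\<^sup>2) * (1 + a) + 4 * c\<^sup>2) (at u)"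
      unfolding a_def
      by (rule derivative_eq_intros slope_derivative W energy_zero refl | use u W in simp)+
    ultimately show "\<exists>d. ((\<lambda>s. q s / y s + 4 * c\<^sup>2 * s) has_real_derivative d) (at u) \<and> d \<le> 0"
      by blast
  qed
  moreover have "q 1 / y 1 \<le> 0" using a_priori_bounds(5)[of 1] W I[of 1] by (auto simp: inside_def divide_le_0_iff)
  moreover have "-20 \<le> q s / y s" if "0 \<le> s" for s
    using I[OF that] by (auto simp: inside_def le_divide_eq)
  ultimately have *: "4 * c\<^sup>2 * s \<le> 4 * c\<^sup>2 + 20" if "1 \<le> s" for s
    using that by (smt (verit))
  define s where "s = 2 + 20 / (4 * c\<^sup>2)"
  have "4 * c\<^sup>2 * s = 8 * c\<^sup>2 + 20" using c by (simp add: s_def field_simps)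
  moreover have "1 \<le> s" "c\<^sup>2 > 0" using c by (simp_all add: s_def)
  ultimately show False using *[of s] by linarith
qed

text \<open>At the first time outside the open region the weak inequalities still hold, and the a
  priori bounds make all but two of them strict. One of these two must then be an equality.\<close>

lemma exit:
  obtains t where "t > 0" "\<And>s. 0 \<le> s \<Longrightarrow> s < t \<Longrightarrow> inside s"
    "\<And>s. 0 \<le> s \<Longrightarrow> s \<le> t \<Longrightarrow> weakly_inside s" "x t = y t \<or> p t + q t = 0"
proof -
  define S where "S = {0..} \<inter> - {s. inside s}"
  have "closed S" unfolding S_def using open_inside by (intro closed_Int) (auto simp: closed_Compl)
  moreover have S: "S \<noteq> {}" "bdd_below S" using not_always_inside by (auto simp: S_def)
  ultimately have tS: "Inf S \<in> S" by (intro closed_contains_Inf)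
  define t where "t = Inf S"
  have t: "t > 0" "\<not> inside t" using tS inside_0 by (auto simp: S_def t_def less_le)
  have I: "inside s" if "0 \<le> s" "s < t" for s
  proof (rule ccontr)
    assume "\<not> inside s"
    then have "t \<le> s" unfolding t_def using that S by (intro cInf_lower) (auto simp: S_def)
    then show False using that by simp
  qed
  have "closure {0..<t} \<subseteq> {s. weakly_inside s}"
    using I inside_weakly_inside by (intro closure_minimal closed_weakly_inside) auto
  then have W: "weakly_inside s" if "0 \<le> s" "s \<le> t" for s
    using that t(1) by (auto simp: closure_atLeastLessThan)
  have b: "0 \<le> x t" "y t \<le> 1" "1/2 \<le> (y t)\<^sup>2" "(q t)\<^sup>2 \<le> 16" "(p t)\<^sup>2 \<le> 96"
    using a_priori_bounds[of t] W t(1) by auto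
  have "y t > 1/2"
  proof (rule ccontr)
    assume "\<not> ?thesis"
    then have "(y t)\<^sup>2 \<le> (1/2)\<^sup>2" using W[of t] t(1) by (intro power_mono) (auto simp: weakly_inside_def)
    then show False using b(3) by (simp add: power2_eq_square)
  qed
  moreover have "\<bar>q t\<bar> < 10" using b(4) power2_less_imp_less[of "\<bar>q t\<bar>" 10] by simp
  moreover have "\<bar>p t\<bar> < 10" using b(5) power2_less_imp_less[of "\<bar>p t\<bar>" 10] by simp
  moreover have "-1 < x t" "y t < 2" using b(1,2) by auto
  ultimately have "x t = y t \<or> p t + q t = 0"
    using t W[of t] by (auto simp: inside_def weakly_inside_def)
  then show ?thesis using that t(1) I W by blast
qed

end

section \<open>Transversality at the exit and the two extreme energies\<close>

context truncated_solution
begin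

text \<open>Where \<open>p + q = 0\<close> the bound \<open>q\<^sup>2 \<le> 16\<close> holds for
  \<open>p\<close> as well. The zero-level identity and its mirror image under exchange of the two
  sides then make both forces negative, so \<open>p + q\<close> crosses zero transversally.\<close>

lemma orthogonal_exit:
  assumes "t > 0" and W: "\<And>s. 0 \<le> s \<Longrightarrow> s \<le> t \<Longrightarrow> weakly_inside s"
    and sum: "p t + q t = 0" and e: "e > 0"
  shows "\<exists>s\<ge>0. p s + q s < 0 \<and> s < t + e"
proof -
  have Wt: "weakly_inside t" and xpos: "x t > 0" and ypos: "y t > 0"
    using W[of t] x_pos_slope_neg(1)[OF assms(1) W] assms(1) by (auto simp: weakly_inside_def)
  define a b where "a = y t ^ 6 / sqrt (x t ^ 4 + y t ^ 4) ^ 3" and "b = x t ^ 6 / sqrt (x t ^ 4 + y t ^ 4) ^ 3"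
  have H: "rect_energy E (x t) (y t) (p t) (q t) = 0" using energy_zero[of t] W assms(1) by simp
  then have H': "rect_energy E (y t) (x t) (q t) (p t) = 0" by (simp add: rect_energy_commute)
  have pos: "x t ^ 4 + y t ^ 4 > 0" "y t ^ 4 + x t ^ 4 > 0"
    using true_derivatives(5)[OF Wt] by (simp_all add: add.commute)
  have q16: "(q t)\<^sup>2 \<le> 16" using a_priori_bounds(7)[of t] W assms(1) by simp
  have p16: "(p t)\<^sup>2 \<le> 16"
  proof -
    have "p t = - q t" using sum by simp
    then show ?thesis using q16 by simp
  qed
  have ab: "a > 0" "b > 0" using xpos ypos by (simp_all add: a_def b_def add_pos_pos)
  have 1: "(y t)\<^sup>2 * (4 - (p t)\<^sup>2 / 4 + 4 * b + 2 * E * (x t)\<^sup>2) = (x t)\<^sup>2 * ((q t)\<^sup>2 / 4 - 4 - 4 * a)"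
    using rect_energy_zero_identity[OF H pos(1)] by (simp add: a_def b_def)
  have 2: "(x t)\<^sup>2 * (4 - (q t)\<^sup>2 / 4 + 4 * a + 2 * E * (y t)\<^sup>2) = (y t)\<^sup>2 * ((p t)\<^sup>2 / 4 - 4 - 4 * b)"
    using rect_energy_zero_identity[OF H' pos(2)] by (simp add: a_def b_def add.commute)
  have neg: "c < 0" if "X\<^sup>2 * c = Y\<^sup>2 * d" "d < 0" "Y > 0" for X Y c d :: real
    by (metis that mult_neg_pos mult_nonneg_nonneg not_le mult.commute zero_le_power2 zero_less_power)
  have "4 - (p t)\<^sup>2 / 4 + 4 * b + 2 * E * (x t)\<^sup>2 < 0" using neg[OF 1] q16 ab xpos by simp
  then have f1: "rect_force E (y t) (x t) (p t) < 0"
    using mult_pos_neg[OF ypos] by (simp only: rect_force_def b_def add.commute[of "y t ^ 4"])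
  have "4 - (q t)\<^sup>2 / 4 + 4 * a + 2 * E * (y t)\<^sup>2 < 0" using neg[OF 2] p16 ab ypos by simp
  then have f2: "rect_force E (x t) (y t) (q t) < 0"
    using mult_pos_neg[OF xpos] by (simp only: rect_force_def a_def)
  have "rect_force E (x t) (y t) (q t) + rect_force E (y t) (x t) (p t) < 0"
    using f1 f2 by simp
  moreover have "((\<lambda>s. p s + q s) has_real_derivative
      rect_force E (x t) (y t) (q t) + rect_force E (y t) (x t) (p t)) (at t)"
    using true_derivatives[OF Wt] by (intro DERIV_add)
  ultimately obtain d where d: "d > 0" "\<And>h. 0 < h \<Longrightarrow> h < d \<Longrightarrow> p (t + h) + q (t + h) < p t + q t"
    using DERIV_neg_dec_right by blast
  then have "p (t + min d e / 2) + q (t + min d e / 2) < 0"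
    using d(2)[of "min d e / 2"] e sum by simp
  then show ?thesis using assms(1) d(1) e by (intro exI[of _ "t + min d e / 2"]) (auto simp: min_def)
qed

text \<open>On the diagonal \<open>x - y\<close> has derivative
  \<open>(p - q) * x\<^sup>2 / 4\<close>, and \<open>p > - q > 0\<close> makes it positive: the
  crossing is transversal.\<close>

lemma diagonal_exit:
  assumes "t > 0" and W: "\<And>s. 0 \<le> s \<Longrightarrow> s \<le> t \<Longrightarrow> weakly_inside s"
    and diag: "x t = y t" and sum: "p t + q t > 0" and e: "e > 0"
  shows "\<exists>s\<ge>0. x s > y s \<and> s < t + e"
proof -
  have Wt: "weakly_inside t" and xpos: "x t > 0" and qneg: "q t < 0"
    using W[of t] x_pos_slope_neg[OF assms(1) W] assms(1) by auto
  have "((\<lambda>s. x s - y s) has_real_derivative p t * (y t)\<^sup>2 / 4 - q t * (x t)\<^sup>2 / 4) (at t)"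
    using true_derivatives[OF Wt] by (intro DERIV_diff)
  moreover have "p t * (y t)\<^sup>2 / 4 - q t * (x t)\<^sup>2 / 4 = (p t - q t) * (x t)\<^sup>2 / 4"
    by (simp add: diag left_diff_distrib diff_divide_distrib)
  moreover have "(p t - q t) * (x t)\<^sup>2 / 4 > 0" using sum qneg xpos by simp
  ultimately obtain d where d: "d > 0" "\<And>h. 0 < h \<Longrightarrow> h < d \<Longrightarrow> x t - y t < x (t + h) - y (t + h)"
    using DERIV_pos_inc_right[of "\<lambda>s. x s - y s"] by metis
  then have "x (t + min d e / 2) > y (t + min d e / 2)"
    using d(2)[of "min d e / 2"] e diag by simp
  then show ?thesis using assms(1) d(1) e by (intro exI[of _ "t + min d e / 2"]) (auto simp: min_def)
qed

text \<open>At zero energy the moment of inertia is convex in time (Lagrange--Jacobi); \<open>x p + y q\<close> is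
  its derivative up to a factor.\<close>

lemma sum_pos_at_zero_energy:
  assumes "E = 0" "t > 0" and W: "\<And>s. 0 \<le> s \<Longrightarrow> s \<le> t \<Longrightarrow> weakly_inside s"
  shows "p t + q t > 0"
proof -
  have "x 0 * p 0 + y 0 * q 0 < x t * p t + y t * q t"
  proof (rule DERIV_pos_imp_increasing[OF assms(2)])
    fix u assume u: "0 \<le> u" "u \<le> t"
    note d = true_derivatives[OF W[OF u]]
    define r where "r = sqrt (x u ^ 4 + y u ^ 4)"
    have r: "r > 0" "r\<^sup>2 = x u ^ 4 + y u ^ 4" using d(5) by (simp_all add: r_def)
    have der: "((\<lambda>s. x s * p s + y s * q s) has_real_derivative
        (p u * (y u)\<^sup>2 / 4) * p u + x u * rect_force E (x u) (y u) (q u)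
        + ((q u * (x u)\<^sup>2 / 4) * q u + y u * rect_force E (y u) (x u) (p u))) (at u)"
      using DERIV_add[OF DERIV_mult[OF d(1,3)] DERIV_mult[OF d(2,4)]] by (simp add: algebra_simps)
    have eq: "(p u * (y u)\<^sup>2 / 4) * p u + x u * rect_force E (x u) (y u) (q u)
        + ((q u * (x u)\<^sup>2 / 4) * q u + y u * rect_force E (y u) (x u) (p u))
        = 4 * ((x u)\<^sup>2 + (y u)\<^sup>2) + 4 * (x u)\<^sup>2 * (y u ^ 6 / r ^ 3) + 4 * (y u)\<^sup>2 * (x u ^ 6 / r ^ 3)"
      unfolding rect_force_def add.commute[of "y u ^ 4"] r_def[symmetric]
      by (simp add: assms(1) field_simps power2_eq_square)
    have "4 * ((x u)\<^sup>2 + (y u)\<^sup>2) + 4 * (x u)\<^sup>2 * (y u ^ 6 / r ^ 3) + 4 * (y u)\<^sup>2 * (x u ^ 6 / r ^ 3) > 0"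
    proof -
      have "4 * (x u)\<^sup>2 * (y u ^ 6 / r ^ 3) \<ge> 0" "4 * (y u)\<^sup>2 * (x u ^ 6 / r ^ 3) \<ge> 0"
        using r(1) by (auto intro!: mult_nonneg_nonneg divide_nonneg_nonneg)
      moreover have "4 * ((x u)\<^sup>2 + (y u)\<^sup>2) > 0" using a_priori_bounds(3)[of u] W u by simp
      ultimately show ?thesis by (simp only: add_pos_nonneg)
    qed
    then show "\<exists>d. ((\<lambda>s. x s * p s + y s * q s) has_real_derivative d) (at u) \<and> 0 < d"
      using der unfolding eq by blast
  qed
  then have "0 < x t * p t + y t * q t" by (simp add: init)
  also have "\<dots> \<le> y t * (p t + q t)"
    using W[of t] assms(2) a_priori_bounds(6)[of t] W
    by (auto simp: distrib_left weakly_inside_def intro!: mult_right_mono)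
  finally show ?thesis using W[of t] assms(2) by (simp add: weakly_inside_def zero_less_mult_iff)
qed

text \<open>On the diagonal the zero level and \<open>sqrt 2 \<ge> 4/3\<close> force
  \<open>12 * X \<le> 11/2\<close>, while the growth of \<open>x\<^sup>2 + y\<^sup>2\<close> gives
  \<open>X \<ge> 1/2\<close>. The same computation excludes every energy below -11, which is where
  the end point -12 of the interval comes from.\<close>

lemma diagonal_not_reached:
  assumes "E = -12" "t > 0" and W: "\<And>s. 0 \<le> s \<Longrightarrow> s \<le> t \<Longrightarrow> weakly_inside s"
  shows "x t \<noteq> y t"
proof
  assume diag: "x t = y t"
  define X where "X = (x t)\<^sup>2"
  have X: "X \<ge> 1/2" using a_priori_bounds(4)[of t] W assms(2) diag by (simp add: X_def)
  have s: "4/3 * X \<le> sqrt (X\<^sup>2 + X\<^sup>2)"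
    by (rule real_le_rsqrt) (simp add: power_mult_distrib power2_eq_square)
  have "rect_energy E (x t) (y t) (p t) (q t) = 0" using energy_zero[of t] W assms(2) by simp
  then have "(((p t)\<^sup>2 + (q t)\<^sup>2) * X) / 8 - 2 * (X * X / sqrt (X\<^sup>2 + X\<^sup>2)) - 4 * X + 12 * X * X = 0"
    unfolding rect_energy_def diag[symmetric] X_def assms(1)
    by (simp add: algebra_simps flip: power_mult)
  moreover have "X * X / sqrt (X\<^sup>2 + X\<^sup>2) \<le> X * X / (4/3 * X)"
    using s X by (intro divide_left_mono mult_pos_pos) auto
  moreover have "X * X / (4/3 * X) = 3/4 * X" using X by simp
  moreover have "((p t)\<^sup>2 + (q t)\<^sup>2) * X / 8 \<ge> 0" using X by simp
  ultimately have "12 * X * X \<le> 11/2 * X" by argo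
  moreover have "6 * X \<le> 12 * X * X" using X by simp
  ultimately show False using X by argo
qed

end

text \<open>The same time \<open>s\<close> serves as witness for nearby parameters. On the compact
  interval \<open>{0..s}\<close> the function \<open>g\<close> keeps a positive minimum, and the
  exponential estimate keeps the displacement of the solution below the margin \<open>m\<close> on
  the whole interval.\<close>

lemma open_shooting_set:
  fixes z :: "real \<Rightarrow> real \<Rightarrow> 'a::real_normed_vector"
  assumes dep: "\<And>a b u. u \<ge> 0 \<Longrightarrow> norm (z a u - z b u) \<le> exp (K * u) * \<bar>a - b\<bar>"
    and cont: "\<And>a. continuous_on UNIV (z a)" and "K \<ge> 0"
    and f: "bounded_linear f" and g: "bounded_linear g"
  shows "open {a. \<exists>s\<ge>0. 0 < (f (z a s) :: real) \<and> (\<forall>u\<in>{0..s}. 0 < (g (z a u) :: real))}"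
proof (rule openI)
  fix a assume "a \<in> {a. \<exists>s\<ge>0. 0 < f (z a s) \<and> (\<forall>u\<in>{0..s}. 0 < g (z a u))}"
  then obtain s where s: "s \<ge> 0" "0 < f (z a s)" "\<forall>u\<in>{0..s}. 0 < g (z a u)" by blast
  obtain Bf where Bf: "Bf > 0" "\<And>w. \<bar>f w\<bar> \<le> norm w * Bf"
    using bounded_linear.pos_bounded[OF f] by auto
  obtain Bg where Bg: "Bg > 0" "\<And>w. \<bar>g w\<bar> \<le> norm w * Bg"
    using bounded_linear.pos_bounded[OF g] by auto
  have "continuous_on {0..s} (\<lambda>u. g (z a u))"
    by (intro bounded_linear.continuous_on[OF g] continuous_on_subset[OF cont]) auto
  then obtain u0 where u0: "u0 \<in> {0..s}" "\<And>u. u \<in> {0..s} \<Longrightarrow> g (z a u0) \<le> g (z a u)"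
    using continuous_attains_inf[of "{0..s}" "\<lambda>u. g (z a u)"] s(1) by auto
  define m where "m = min (f (z a s)) (g (z a u0))"
  have m: "m > 0" using s u0 by (simp add: m_def)
  define d where "d = m / (exp (K * s) * (Bf + Bg))"
  have d: "d > 0" using m Bf Bg by (simp add: d_def add_pos_pos)
  have close: "norm (z a u - z b u) * Bf < m" "norm (z a u - z b u) * Bg < m"
    if "b \<in> ball a d" "u \<in> {0..s}" for b u
  proof -
    have "norm (z a u - z b u) \<le> exp (K * u) * \<bar>a - b\<bar>" using dep that by simp
    also have "\<dots> \<le> exp (K * s) * \<bar>a - b\<bar>"
      using that assms(3) by (intro mult_right_mono) (auto intro: mult_left_mono)
    finally have "norm (z a u - z b u) * (Bf + Bg) \<le> exp (K * s) * \<bar>a - b\<bar> * (Bf + Bg)"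
      using Bf Bg by (intro mult_right_mono) auto
    also have "\<dots> < exp (K * s) * d * (Bf + Bg)"
      using that Bf Bg by (auto simp: dist_real_def)
    also have "\<dots> = m" using Bf Bg by (simp add: d_def add_pos_pos less_imp_neq[symmetric])
    finally have *: "norm (z a u - z b u) * (Bf + Bg) < m" .
    have "norm (z a u - z b u) * Bf \<le> norm (z a u - z b u) * (Bf + Bg)"
      "norm (z a u - z b u) * Bg \<le> norm (z a u - z b u) * (Bf + Bg)"
      using Bf Bg by (auto intro!: mult_left_mono)
    then show "norm (z a u - z b u) * Bf < m" "norm (z a u - z b u) * Bg < m"
      using * by linarith+
  qed
  have "b \<in> {a. \<exists>s\<ge>0. 0 < f (z a s) \<and> (\<forall>u\<in>{0..s}. 0 < g (z a u))}" if b: "b \<in> ball a d" for b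
  proof -
    have "0 < f (z b s)"
      using Bf(2)[of "z a s - z b s"] close(1)[OF b, of s] s(1)
      by (auto simp: linear_diff[OF bounded_linear.linear[OF f]] m_def)
    moreover have "0 < g (z b u)" if "u \<in> {0..s}" for u
      using Bg(2)[of "z a u - z b u"] close(2)[OF b that] u0(2)[OF that]
      by (auto simp: linear_diff[OF bounded_linear.linear[OF g]] m_def)
    ultimately show ?thesis using s(1) by auto
  qed
  then show "\<exists>\<epsilon>>0. ball a \<epsilon> \<subseteq> {a. \<exists>s\<ge>0. 0 < f (z a s) \<and> (\<forall>u\<in>{0..s}. 0 < g (z a u))}"
    using d by blast
qed

context truncated_solution
begin

text \<open>Reaching the diagonal is not stable under perturbation, a strict overshoot is.
  Transversality gives overshoots arbitrarily soon after \<open>t\<close>, and by continuity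
  \<open>p + q\<close> is still positive then.\<close>

lemma crosses_diagonal_first:
  assumes t: "t > 0" and I: "\<And>s. 0 \<le> s \<Longrightarrow> s < t \<Longrightarrow> inside s"
    and W: "\<And>s. 0 \<le> s \<Longrightarrow> s \<le> t \<Longrightarrow> weakly_inside s"
    and diag: "x t = y t" and sum: "p t + q t > 0"
  shows "\<exists>s\<ge>0. x s > y s \<and> (\<forall>u\<in>{0..s}. p u + q u > 0)"
proof -
  have "open {s. 0 < p s + q s}" by (intro open_Collect_less continuous_intros)
  moreover have "t \<in> {s. 0 < p s + q s}" using sum by simp
  ultimately obtain e where "e > 0" "ball t e \<subseteq> {s. 0 < p s + q s}"
    by (auto simp: open_contains_ball)
  then have e: "e > 0" "\<And>u. \<bar>u - t\<bar> < e \<Longrightarrow> 0 < p u + q u"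
    by (auto simp: ball_def dist_real_def abs_minus_commute)
  obtain s where s: "s \<ge> 0" "x s > y s" "s < t + e"
    using diagonal_exit[OF t W diag sum e(1)] by auto
  have "p u + q u > 0" if "u \<in> {0..s}" for u
  proof (cases "u < t")
    case True
    then show ?thesis using I[of u] that by (simp add: inside_def)
  next
    case False
    then show ?thesis using e(2)[of u] that s(3) by auto
  qed
  then show ?thesis using s by blast
qed

lemma turns_first:
  assumes t: "t > 0" and I: "\<And>s. 0 \<le> s \<Longrightarrow> s < t \<Longrightarrow> inside s"
    and W: "\<And>s. 0 \<le> s \<Longrightarrow> s \<le> t \<Longrightarrow> weakly_inside s"
    and sum: "p t + q t = 0" and below: "x t < y t"
  shows "\<exists>s\<ge>0. p s + q s < 0 \<and> (\<forall>u\<in>{0..s}. x u < y u)"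
proof -
  have "open {s. 0 < y s - x s}" by (intro open_Collect_less continuous_intros)
  moreover have "t \<in> {s. 0 < y s - x s}" using below by simp
  ultimately obtain e where "e > 0" "ball t e \<subseteq> {s. 0 < y s - x s}"
    by (auto simp: open_contains_ball)
  then have e: "e > 0" "\<And>u. \<bar>u - t\<bar> < e \<Longrightarrow> 0 < y u - x u"
    by (auto simp: ball_def dist_real_def abs_minus_commute)
  obtain s where s: "s \<ge> 0" "p s + q s < 0" "s < t + e"
    using orthogonal_exit[OF t W sum e(1)] by auto
  have "x u < y u" if "u \<in> {0..s}" for u
  proof (cases "u < t")
    case True
    then show ?thesis using I[of u] that by (simp add: inside_def)
  next
    case False
    then show ?thesis using e(2)[of u] that s(3) by auto
  qed
  then show ?thesis using s by blast
qed

end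

text \<open>The energies for which the diagonal is crossed while \<open>p + q > 0\<close> and those for which
  \<open>p + q\<close> changes sign before the diagonal form disjoint open sets, so they do not exhaust
  \<open>[-12, 0]\<close>; for an energy outside both, the orbit meets the diagonal orthogonally.\<close>

lemma orthogonal_shooting:
  obtains E :: real and z :: "real \<Rightarrow> state" and t :: real
  where "E < 0" "\<And>s. (z has_vector_derivative truncated_field (z s)) (at s)"
    "z 0 = (0, 1, 4, 0, E)" "t > 0"
    "truncated_solution E (\<lambda>s. fst (z s)) (\<lambda>s. fst (snd (z s)))
       (\<lambda>s. fst (snd (snd (z s)))) (\<lambda>s. fst (snd (snd (snd (z s)))))"
    "\<And>s. 0 \<le> s \<Longrightarrow> s \<le> t \<Longrightarrow> truncated_solution.weakly_inside (\<lambda>s. fst (z s)) (\<lambda>s. fst (snd (z s)))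
       (\<lambda>s. fst (snd (snd (z s)))) (\<lambda>s. fst (snd (snd (snd (z s))))) s"
    "fst (z t) = fst (snd (z t))" "fst (snd (snd (z t))) + fst (snd (snd (snd (z t)))) = 0"
    "\<And>s. snd (snd (snd (snd (z s)))) = E"
proof -
  obtain K where K: "K-lipschitz_on UNIV truncated_field"
    using truncated_field_lipschitz by blast
  have "\<exists>z. z 0 = (0, 1, 4, 0, E) \<and> (\<forall>s. (z has_vector_derivative truncated_field (z s)) (at s))" for E
    using lipschitz_ode[OF K, of "(0, 1, 4, 0, E)"] by metis
  then obtain z where z0: "\<And>E. z E 0 = (0, 1, 4, 0, E)"
    and z: "\<And>E s. (z E has_vector_derivative truncated_field (z E s)) (at s)" by metis
  define x y p q where "x E = (\<lambda>s. fst (z E s))" and "y E = (\<lambda>s. fst (snd (z E s)))"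
    and "p E = (\<lambda>s. fst (snd (snd (z E s))))" and "q E = (\<lambda>s. fst (snd (snd (snd (z E s)))))" for E
  have ts: "truncated_solution E (x E) (y E) (p E) (q E)" if "E \<in> {-12..0}" for E
    using truncated_solution_components(1)[OF z z0] that unfolding x_def y_def p_def q_def by simp
  \<comment> \<open>The initial states differ only in the fifth coordinate, by exactly
    \<open>a - b\<close>.\<close>
  have dep: "norm (z a u - z b u) \<le> exp (K * u) * \<bar>a - b\<bar>" if "u \<ge> 0" for a b u
    using lipschitz_ode_dependence_forward[OF K z z that] by (simp add: z0 norm_Pair)
  have cont: "continuous_on UNIV (z a)" for a
    using z by (auto intro!: continuous_at_imp_continuous_on has_vector_derivative_continuous)
  have K0: "K \<ge> 0" using K by (rule lipschitz_on_nonneg)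
  have lin: "bounded_linear (\<lambda>w::state. fst w - fst (snd w))" "bounded_linear (\<lambda>w::state. fst (snd w) - fst w)"
    "bounded_linear (\<lambda>w::state. fst (snd (snd w)) + fst (snd (snd (snd w))))"
    "bounded_linear (\<lambda>w::state. - (fst (snd (snd w)) + fst (snd (snd (snd w)))))"
    by (intro bounded_linear_sub bounded_linear_add bounded_linear_minus bounded_linear_fst
        bounded_linear_fst_comp bounded_linear_snd_comp bounded_linear_snd)+
  define P where "P = {a. \<exists>s\<ge>0. 0 < x a s - y a s \<and> (\<forall>u\<in>{0..s}. 0 < p a u + q a u)}"
  define Q where "Q = {a. \<exists>s\<ge>0. 0 < - (p a s + q a s) \<and> (\<forall>u\<in>{0..s}. 0 < y a u - x a u)}"
  have opens: "open P" "open Q"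
    unfolding P_def Q_def x_def y_def p_def q_def
    using open_shooting_set[of z K, OF dep cont K0 lin(1) lin(3)]
      open_shooting_set[of z K, OF dep cont K0 lin(4) lin(2)] by simp_all
  \<comment> \<open>Whichever of the two witness times is earlier, the event at that time
    contradicts the positivity that the other outcome demands on its whole interval.\<close>
  have disjoint: "P \<inter> Q = {}"
  proof -
    have False if "0 \<le> s" "0 < x a s - y a s" "\<forall>u\<in>{0..s}. 0 < p a u + q a u"
      "0 \<le> s'" "0 < - (p a s' + q a s')" "\<forall>u\<in>{0..s'}. 0 < y a u - x a u" for a s s'
    proof (cases "s \<le> s'")
      case True
      then show ?thesis using that(6)[rule_format, of s] that(1,2) by simp
    next
      case False
      then show ?thesis using that(3)[rule_format, of s'] that(4,5) by simp
    qed
    then show ?thesis unfolding P_def Q_def by blast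
  qed
  define both where "both a \<longleftrightarrow>
      (\<exists>t>0. (\<forall>s. 0 \<le> s \<longrightarrow> s \<le> t \<longrightarrow> truncated_solution.weakly_inside (x a) (y a) (p a) (q a) s) \<and>
        x a t = y a t \<and> p a t + q a t = 0)" for a
  have alt: "a \<in> P \<or> a \<in> Q \<or> both a"
    and at0: "a = 0 \<Longrightarrow> a \<in> P \<and> \<not> both a" and at12: "a = -12 \<Longrightarrow> a \<in> Q"
    if a: "a \<in> {-12..0}" for a
  proof -
    interpret truncated_solution a "x a" "y a" "p a" "q a" by (rule ts[OF a])
    obtain t where t: "t > 0" and I: "\<And>s. 0 \<le> s \<Longrightarrow> s < t \<Longrightarrow> inside s"
      and W: "\<And>s. 0 \<le> s \<Longrightarrow> s \<le> t \<Longrightarrow> weakly_inside s"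
      and e: "x a t = y a t \<or> p a t + q a t = 0" by (rule exit) blast
    have Wt: "x a t \<le> y a t" "0 \<le> p a t + q a t"
      using W[of t] t by (simp_all add: weakly_inside_def)
    have P: "a \<in> P" if "x a t = y a t" "0 < p a t + q a t"
      using crosses_diagonal_first[OF t I W that] by (simp add: P_def)
    have Q: "a \<in> Q" if *: "p a t + q a t = 0" "x a t < y a t"
    proof -
      obtain s where "s \<ge> 0" "p a s + q a s < 0" "\<forall>u\<in>{0..s}. x a u < y a u"
        using turns_first[OF t I W *] by blast
      then show ?thesis unfolding Q_def by (intro CollectI exI[of _ s]) auto
    qed
    show "a \<in> P \<or> a \<in> Q \<or> both a"
    proof (cases "x a t = y a t \<and> p a t + q a t = 0")
      case True
      then show ?thesis using t W unfolding both_def by blast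
    next
      case False
      then show ?thesis using P Q e Wt by force
    qed
    show "a \<in> P \<and> \<not> both a" if "a = 0"
    proof
      have "0 < p a t + q a t" by (rule sum_pos_at_zero_energy[OF that t W])
      then show "a \<in> P" using P e by simp
      show "\<not> both a"
      proof
        assume "both a"
        then obtain u where u: "u > 0" "p a u + q a u = 0" "\<And>s. 0 \<le> s \<Longrightarrow> s \<le> u \<Longrightarrow> weakly_inside s"
          unfolding both_def by blast
        show False using u(2) sum_pos_at_zero_energy[OF that u(1,3)] by simp
      qed
    qed
    show "a \<in> Q" if "a = -12"
      using Q diagonal_not_reached[OF that t W] e Wt by simp
  qed
  have "\<not> {-12..0} \<subseteq> P \<union> Q"
  proof
    assume "{-12..0} \<subseteq> P \<union> Q"
    then have "P \<inter> {-12..0} = {} \<or> Q \<inter> {-12..0} = {}"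
      using connectedD[of "{-12..0::real}" P Q] opens disjoint by auto
    moreover have "0 \<in> P \<inter> {-12..0}" "-12 \<in> Q \<inter> {-12..0}"
      using at0[of 0] at12[of "-12"] by auto
    ultimately show False by blast
  qed
  then obtain a where a: "a \<in> {-12..0}" "a \<notin> P" "a \<notin> Q" by blast
  then obtain t where t: "t > 0" "\<And>s. 0 \<le> s \<Longrightarrow> s \<le> t \<Longrightarrow> truncated_solution.weakly_inside (x a) (y a) (p a) (q a) s"
      "x a t = y a t" "p a t + q a t = 0"
    using alt[OF a(1)] unfolding both_def by blast
  have "a \<noteq> 0" using at0[OF a(1)] a(2) by blast
  then have "a < 0" using a(1) by simp
  show ?thesis
  proof (rule that[of a "z a" t])
    show "snd (snd (snd (snd (z a s)))) = a" for s
      using truncated_solution_components(2)[OF z z0] a(1) by simp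
  qed (use \<open>a < 0\<close> z z0 t ts[OF a(1)] in \<open>simp_all add: x_def y_def p_def q_def\<close>)
qed

section \<open>The periodic orbit of the rectangle problem\<close>

text \<open>\<open>L\<close> is the time from the collision at time 0 to the diagonal.
  \<open>quarter\<close> is the product of the reflections in the collision and in the diagonal; it
  has order four. The positivity conditions serve to locate all collisions.\<close>

locale rectangle_orbit =
  fixes E :: real and x y p q :: "real \<Rightarrow> real" and L :: real
  assumes L: "L > 0"
    and dx: "\<And>s. (x has_real_derivative p s * (y s)\<^sup>2 / 4) (at s)"
    and dy: "\<And>s. (y has_real_derivative q s * (x s)\<^sup>2 / 4) (at s)"
    and dp: "\<And>s. (p has_real_derivative rect_force E (x s) (y s) (q s)) (at s)"
    and dq: "\<And>s. (q has_real_derivative rect_force E (y s) (x s) (p s)) (at s)"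
    and energy: "\<And>s. rect_energy E (x s) (y s) (p s) (q s) = 0"
    and off_origin: "\<And>s. x s ^ 4 + y s ^ 4 > 0"
    and reflect: "\<And>s. x (- s) = - x s" "\<And>s. y (- s) = y s" "\<And>s. p (- s) = p s" "\<And>s. q (- s) = - q s"
    and quarter: "\<And>s. x (s + 2 * L) = y s" "\<And>s. y (s + 2 * L) = - x s"
      "\<And>s. p (s + 2 * L) = q s" "\<And>s. q (s + 2 * L) = - p s"
    and x_pos: "\<And>s. 0 < s \<Longrightarrow> s \<le> L \<Longrightarrow> x s > 0"
    and y_pos: "\<And>s. 0 \<le> s \<Longrightarrow> s \<le> L \<Longrightarrow> y s > 0"
    and diagonal: "x L = y L" "q L = - p L" "p L > 0"

text \<open>\<open>[- L, L]\<close> is a fundamental domain of the shift by \<open>2 * L\<close>;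
  each induction step adds one translate on either side.\<close>

lemma shift_invariant_from_period:
  fixes P :: "real \<Rightarrow> bool"
  assumes "L > 0" and base: "\<And>s. - L \<le> s \<Longrightarrow> s \<le> L \<Longrightarrow> P s"
    and shift: "\<And>s. P (s + 2 * L) \<longleftrightarrow> P s"
  shows "P s"
proof -
  have "\<forall>s. - (2 * real n + 1) * L \<le> s \<and> s \<le> (2 * real n + 1) * L \<longrightarrow> P s" for n
  proof (induction n)
    case 0
    then show ?case using base by simp
  next
    case (Suc n)
    show ?case
    proof (intro allI impI)
      fix s assume s: "- (2 * real (Suc n) + 1) * L \<le> s \<and> s \<le> (2 * real (Suc n) + 1) * L"
      define N where "N = real n * L"
      have N: "0 \<le> N" using assms(1) by (simp add: N_def)
      have bounds: "(2 * real n + 1) * L = 2 * N + L" "(2 * real (Suc n) + 1) * L = 2 * N + 3 * L"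
        by (simp_all add: N_def algebra_simps)
      consider "\<bar>s\<bar> \<le> L" | "s > L" | "s < - L" by linarith
      then show "P s"
      proof cases
        case 1
        then show ?thesis using base by auto
      next
        case 2
        then have "P (s - 2 * L)" using Suc s N assms(1) unfolding minus_mult_left[symmetric] bounds by auto
        then show ?thesis using shift[of "s - 2 * L"] by simp
      next
        case 3
        then have "P (s + 2 * L)" using Suc s N assms(1) unfolding minus_mult_left[symmetric] bounds by auto
        then show ?thesis using shift by simp
      qed
    qed
  qed
  moreover obtain n where "\<bar>s\<bar> / L \<le> real n" using real_arch_simple by blast
  then have "\<bar>s\<bar> \<le> real n * L" using assms(1) by (simp add: divide_le_eq)
  then have "- (2 * real n + 1) * L \<le> s \<and> s \<le> (2 * real n + 1) * L"
    using assms(1) by (auto simp: algebra_simps abs_le_iff)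
  ultimately show ?thesis by blast
qed

text \<open>A linear map that reverses the field sends a solution run backwards to a solution. If it
  moreover fixes the state at time \<open>c / 2\<close>, uniqueness makes it a symmetry of that
  solution.\<close>

lemma reversed_solution:
  fixes F :: "'a::real_normed_vector \<Rightarrow> 'a"
  assumes z: "\<And>s. (z has_vector_derivative F (z s)) (at s)"
    and A: "bounded_linear A" and rev: "\<And>w. F (A w) = - A (F w)"
  shows "((\<lambda>s. A (z (c - s))) has_vector_derivative F (A (z (c - s)))) (at s)"
proof -
  have "((\<lambda>s. c - s) has_vector_derivative -1) (at s)"
    by (auto intro!: derivative_eq_intros simp flip: has_real_derivative_iff_has_vector_derivative)
  from vector_diff_chain_at[OF this z]
  have "((\<lambda>s. z (c - s)) has_vector_derivative - F (z (c - s))) (at s)" by (simp add: o_def)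
  from bounded_linear.has_vector_derivative[OF A this]
  show ?thesis by (simp add: rev linear_neg[OF bounded_linear.linear[OF A]])
qed

lemma rectangle_orbit_exists: "\<exists>E x y p q L. E < 0 \<and> rectangle_orbit E x y p q L"
proof -
  obtain E z t where neg: "E < 0" and z: "\<And>s. (z has_vector_derivative truncated_field (z s)) (at s)"
    and z0: "z 0 = (0, 1, 4, 0, E)" and t: "t > 0"
    and ts: "truncated_solution E (\<lambda>s. fst (z s)) (\<lambda>s. fst (snd (z s)))
       (\<lambda>s. fst (snd (snd (z s)))) (\<lambda>s. fst (snd (snd (snd (z s)))))"
    and W: "\<And>s. 0 \<le> s \<Longrightarrow> s \<le> t \<Longrightarrow> truncated_solution.weakly_inside (\<lambda>s. fst (z s)) (\<lambda>s. fst (snd (z s)))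
       (\<lambda>s. fst (snd (snd (z s)))) (\<lambda>s. fst (snd (snd (snd (z s))))) s"
    and diag: "fst (z t) = fst (snd (z t))" "fst (snd (snd (z t))) + fst (snd (snd (snd (z t)))) = 0"
    and e: "\<And>s. snd (snd (snd (snd (z s)))) = E"
    by (rule orthogonal_shooting) blast
  define x y p q where "x = (\<lambda>s. fst (z s))" and "y = (\<lambda>s. fst (snd (z s)))"
    and "p = (\<lambda>s. fst (snd (snd (z s))))" and "q = (\<lambda>s. fst (snd (snd (snd (z s)))))"
  have zs: "z s = (x s, y s, p s, q s, E)" for s
    using e[of s] by (simp add: x_def y_def p_def q_def prod_eq_iff)
  interpret truncated_solution E x y p q
    using ts by (simp add: x_def y_def p_def q_def)
  have W: "weakly_inside s" if "0 \<le> s" "s \<le> t" for s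
    using W[OF that] by (simp add: x_def y_def p_def q_def)
  have diag: "x t = y t" "q t = - p t" using diag by (simp_all add: x_def y_def p_def q_def)
  obtain K where K: "K-lipschitz_on UNIV truncated_field"
    using truncated_field_lipschitz by blast
  \<comment> \<open>\<open>A\<close> is the reflection in the collision and fixes
    \<open>z 0\<close>; \<open>B\<close> is the reflection in the diagonal and fixes
    \<open>z t\<close>, precisely because the arrival is orthogonal. Both reverse the truncated
    field.\<close>
  define A where "A w = (- fst w, fst (snd w), fst (snd (snd w)), - fst (snd (snd (snd w))), snd (snd (snd (snd w))))"
    for w :: state
  define B where "B w = (fst (snd w), fst w, - fst (snd (snd (snd w))), - fst (snd (snd w)), snd (snd (snd (snd w))))"
    for w :: state
  have lin: "bounded_linear A" "bounded_linear B"
    unfolding A_def B_def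
    by (intro bounded_linear_Pair bounded_linear_minus bounded_linear_fst
        bounded_linear_fst_comp bounded_linear_snd_comp bounded_linear_snd)+
  have rev: "truncated_field (A w) = - A (truncated_field w)" "truncated_field (B w) = - B (truncated_field w)" for w
    by (simp_all add: truncated_field_def A_def B_def Let_def split_beta truncated_force_def add.commute)
  have zA: "z (- s) = A (z s)" for s
  proof -
    have "A (z (0 - (- s))) = z (- s)"
      by (rule lipschitz_ode_unique[OF K reversed_solution[OF z lin(1) rev(1)] z, of 0 0])
        (simp add: z0 A_def)
    then show ?thesis by simp
  qed
  have zB: "z (2 * t - s) = B (z s)" for s
  proof -
    have "B (z (2 * t - (2 * t - s))) = z (2 * t - s)"
      by (rule lipschitz_ode_unique[OF K reversed_solution[OF z lin(2) rev(2)] z, of "2 * t" t])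
        (simp add: zs B_def diag)
    then show ?thesis by simp
  qed
  have reflect: "x (- s) = - x s" "y (- s) = y s" "p (- s) = p s" "q (- s) = - q s" for s
    using zA[of s] by (simp_all add: zs A_def)
  have quarter: "x (s + 2 * t) = y s" "y (s + 2 * t) = - x s" "p (s + 2 * t) = q s" "q (s + 2 * t) = - p s" for s
    using zB[of "- s"] by (simp_all add: zs B_def reflect add.commute)
  \<comment> \<open>The truncation is known to be inactive only on \<open>[0, t]\<close>. All
    conditions in \<open>good\<close> are invariant under the reflection in the collision and the
    quarter shift, so they spread to all times and the true equations hold everywhere.\<close>
  define good where "good s \<longleftrightarrow> \<bar>x s\<bar> \<le> 2 \<and> \<bar>y s\<bar> \<le> 2 \<and> \<bar>p s\<bar> \<le> 10 \<and> \<bar>q s\<bar> \<le> 10 \<and>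
    1/16 \<le> x s ^ 4 + y s ^ 4 \<and> rect_energy E (x s) (y s) (p s) (q s) = 0" for s
  have good_pos: "good s" if "0 \<le> s" "s \<le> t" for s
    using weakly_inside_bounds[OF W[OF that]] energy_zero[OF that(1) W] that by (simp add: good_def)
  have good: "good s" for s
  proof (rule shift_invariant_from_period[OF t])
    fix s assume "- t \<le> s" "s \<le> t"
    then show "good s"
    proof (cases "s \<ge> 0")
      case False
      then have "good (- s)" using good_pos \<open>- t \<le> s\<close> by simp
      then show ?thesis by (simp add: good_def reflect rect_energy_def)
    qed (use good_pos in simp)
  next
    have "rect_energy E (y s) (- x s) (q s) (- p s) = rect_energy E (x s) (y s) (p s) (q s)" for s
      using rect_energy_commute[of E "y s" "x s" "q s" "p s"] by (simp add: rect_energy_def)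
    then show "good (s + 2 * t) \<longleftrightarrow> good s" for s
      unfolding good_def quarter by (auto simp: add.commute)
  qed
  have pt: "p t > 0" using x_pos_slope_neg(2)[OF t W] diag(2) by simp
  have "rectangle_orbit E x y p q t"
  proof
    fix s
    note u = untruncated[of s] and g = good[of s, unfolded good_def]
    show "(x has_real_derivative p s * (y s)\<^sup>2 / 4) (at s)"
      "(y has_real_derivative q s * (x s)\<^sup>2 / 4) (at s)"
      "(p has_real_derivative rect_force E (x s) (y s) (q s)) (at s)"
      "(q has_real_derivative rect_force E (y s) (x s) (p s)) (at s)"
      using g u by simp_all
    show "rect_energy E (x s) (y s) (p s) (q s) = 0" using g by simp
    show "x s ^ 4 + y s ^ 4 > 0" using g by simp
    show "x s > 0" if "0 < s" "s \<le> t" using x_pos_slope_neg(1)[OF that(1)] W that by simp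
    show "y s > 0" if "0 \<le> s" "s \<le> t" using W[OF that] by (simp add: weakly_inside_def)
  qed (fact t reflect quarter diag pt)+
  then show ?thesis using neg by blast
qed

text \<open>Homogeneity of the Newtonian potential: lengths are squares of \<open>x\<close> and
  \<open>y\<close>, so they scale by \<open>c\<^sup>2\<close> and energies by its inverse. The
  regularized momenta keep their values, and regularized time is divided by
  \<open>c\<close>.\<close>

lemma rectangle_orbit_scaled:
  assumes "rectangle_orbit E x y p q L" "c > 0"
  shows "rectangle_orbit (E / c\<^sup>2) (\<lambda>s. c * x (c * s)) (\<lambda>s. c * y (c * s)) (\<lambda>s. p (c * s)) (\<lambda>s. q (c * s)) (L / c)"
proof -
  interpret rectangle_orbit E x y p q L by fact
  have root: "sqrt ((c * a) ^ 4 + (c * b) ^ 4) = c\<^sup>2 * sqrt (a ^ 4 + b ^ 4)" for a b :: real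
  proof -
    have "(c * a) ^ 4 + (c * b) ^ 4 = (c\<^sup>2)\<^sup>2 * (a ^ 4 + b ^ 4)"
      by (simp add: power_mult_distrib distrib_left)
    then show ?thesis by (simp only: real_sqrt_mult real_sqrt_abs) simp
  qed
  have force: "rect_force (E / c\<^sup>2) (c * a) (c * b) d = c * rect_force E a b d" for a b d
    using assms(2) unfolding rect_force_def root by (simp add: power_mult_distrib)
  have en: "rect_energy (E / c\<^sup>2) (c * a) (c * b) d e = c\<^sup>2 * rect_energy E a b d e" for a b d e
    using assms(2) unfolding rect_energy_def root by (simp add: power_mult_distrib field_simps power2_eq_square)
  have chain: "((\<lambda>s. f (c * s)) has_real_derivative c * f') (at s)"
    if "(f has_real_derivative f') (at (c * s))" for f f' s
  proof -
    have "((\<lambda>s. c * s) has_real_derivative c) (at s)" by (auto intro!: derivative_eq_intros)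
    from DERIV_chain2[where f = f and g = "\<lambda>s. c * s" and x = s, OF that this]
    show ?thesis by (simp add: mult.commute)
  qed
  show ?thesis
  proof
    fix s
    show "((\<lambda>s. c * x (c * s)) has_real_derivative p (c * s) * (c * y (c * s))\<^sup>2 / 4) (at s)"
      using DERIV_cmult[OF chain[OF dx], of c s] by (simp add: power_mult_distrib power2_eq_square mult_ac)
    show "((\<lambda>s. c * y (c * s)) has_real_derivative q (c * s) * (c * x (c * s))\<^sup>2 / 4) (at s)"
      using DERIV_cmult[OF chain[OF dy], of c s] by (simp add: power_mult_distrib power2_eq_square mult_ac)
    show "((\<lambda>s. p (c * s)) has_real_derivative rect_force (E / c\<^sup>2) (c * x (c * s)) (c * y (c * s)) (q (c * s))) (at s)"
      using chain[OF dp] by (simp add: force)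
    show "((\<lambda>s. q (c * s)) has_real_derivative rect_force (E / c\<^sup>2) (c * y (c * s)) (c * x (c * s)) (p (c * s))) (at s)"
      using chain[OF dq] by (simp add: force)
    have "c * (s + 2 * (L / c)) = c * s + 2 * L" using assms(2) by (simp add: field_simps)
    then show "c * x (c * (s + 2 * (L / c))) = c * y (c * s)" "c * y (c * (s + 2 * (L / c))) = - (c * x (c * s))"
      "p (c * (s + 2 * (L / c))) = q (c * s)" "q (c * (s + 2 * (L / c))) = - p (c * s)"
      by (simp_all add: quarter)
    show "(c * x (c * s)) ^ 4 + (c * y (c * s)) ^ 4 > 0"
      using off_origin[of "c * s"] assms(2) by (simp add: power_mult_distrib flip: distrib_left)
  qed (use assms(2) L x_pos y_pos diagonal in \<open>auto simp: en energy reflect le_divide_eq mult.commute\<close>)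
qed

lemma rectangle_orbit_every_energy:
  assumes "E < 0"
  obtains x y p q L where "rectangle_orbit E x y p q L"
proof -
  obtain E0 x y p q L where 0: "E0 < 0" "rectangle_orbit E0 x y p q L"
    using rectangle_orbit_exists by blast
  have "sqrt (E0 / E) > 0" "E0 / (sqrt (E0 / E))\<^sup>2 = E"
    using 0(1) assms by (simp_all add: divide_neg_neg less_imp_le)
  then show ?thesis using rectangle_orbit_scaled[OF 0(2), of "sqrt (E0 / E)"] that by metis
qed

section \<open>The invariant plane\<close>

text \<open>The first two identities express that pi/4 - pi/8 = pi/8. In this form cosine and sine
  of pi/8 never have to be written as nested radicals.\<close>

lemma cos_sin_pi_8:
  "cos (pi/4) * (cos (pi/8) + sin (pi/8)) = cos (pi/8)"
  "cos (pi/4) * (cos (pi/8) - sin (pi/8)) = sin (pi/8)"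
  "(cos (pi/8))\<^sup>2 - (sin (pi/8))\<^sup>2 = cos (pi/4)"
  "2 * cos (pi/8) * sin (pi/8) = cos (pi/4)"
  "cos (pi/4) * cos (pi/4) = 1/2"
proof -
  have k: "sin (pi/4) = cos (pi/4)" by (simp add: sin_45 cos_45)
  have "cos (pi/4 - pi/8) = cos (pi/8)" "sin (pi/4 - pi/8) = sin (pi/8)" by simp_all
  then show "cos (pi/4) * (cos (pi/8) + sin (pi/8)) = cos (pi/8)"
    "cos (pi/4) * (cos (pi/8) - sin (pi/8)) = sin (pi/8)"
    unfolding cos_diff sin_diff k by (simp_all add: algebra_simps)
  show "(cos (pi/8))\<^sup>2 - (sin (pi/8))\<^sup>2 = cos (pi/4)" using cos_double[of "pi/8"] by simp
  show "2 * cos (pi/8) * sin (pi/8) = cos (pi/4)" using sin_double[of "pi/8"] k by simp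
  show "cos (pi/4) * cos (pi/4) = 1/2" by (simp add: cos_45)
qed

text \<open>The squaring in the regularization doubles the arguments -pi/8 and pi/8, so that the
  vectors \<open>(g\<^sub>1, g\<^sub>2)\<close> and \<open>(g\<^sub>3, g\<^sub>4)\<close> become
  perpendicular: they are the sides of the rectangle.\<close>

definition plane :: "real \<Rightarrow> real \<Rightarrow> real^4" where
  "plane a b = vector [cos (pi/8) * a, - sin (pi/8) * a, cos (pi/8) * b, sin (pi/8) * b]"

lemma plane_nth [simp]:
  "plane a b $ 1 = cos (pi/8) * a" "plane a b $ 2 = - sin (pi/8) * a"
  "plane a b $ 3 = cos (pi/8) * b" "plane a b $ 4 = sin (pi/8) * b"
  by (simp_all add: plane_def)

lemma vec4_eq_iff: "(v :: 'a^4) = w \<longleftrightarrow> v $ 1 = w $ 1 \<and> v $ 2 = w $ 2 \<and> v $ 3 = w $ 3 \<and> v $ 4 = w $ 4"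
  by (simp add: vec_eq_iff forall_4)

lemma inner_vec4: "(v :: real^4) \<bullet> w = v $ 1 * w $ 1 + v $ 2 * w $ 2 + v $ 3 * w $ 3 + v $ 4 * w $ 4"
  by (simp add: inner_vec_def sum_4)

lemma plane_eq: "plane a b = a *\<^sub>R plane 1 0 + b *\<^sub>R plane 0 1"
  by (simp add: vec4_eq_iff)

lemma plane_minus: "- plane a b = plane (- a) (- b)"
  by (simp add: vec4_eq_iff)

lemma plane_squares:
  "(plane a b $ 1)\<^sup>2 + (plane a b $ 2)\<^sup>2 = a\<^sup>2" "(plane a b $ 3)\<^sup>2 + (plane a b $ 4)\<^sup>2 = b\<^sup>2"
  by (simp_all add: power_mult_distrib flip: distrib_right)

lemma plane_complex_squares:
  "(plane a b $ 1)\<^sup>2 - (plane a b $ 2)\<^sup>2 = cos (pi/4) * a\<^sup>2" "2 * plane a b $ 1 * plane a b $ 2 = - (cos (pi/4) * a\<^sup>2)"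
  "(plane a b $ 3)\<^sup>2 - (plane a b $ 4)\<^sup>2 = cos (pi/4) * b\<^sup>2" "2 * plane a b $ 3 * plane a b $ 4 = cos (pi/4) * b\<^sup>2"
proof -
  have "(cos (pi/8))\<^sup>2 * c - (sin (pi/8))\<^sup>2 * c = cos (pi/4) * c" "2 * cos (pi/8) * sin (pi/8) * c = cos (pi/4) * c" for c
    by (simp_all only: cos_sin_pi_8(3,4) flip: left_diff_distrib)
  from this[of "a\<^sup>2"] this[of "b\<^sup>2"]
  show "(plane a b $ 1)\<^sup>2 - (plane a b $ 2)\<^sup>2 = cos (pi/4) * a\<^sup>2" "2 * plane a b $ 1 * plane a b $ 2 = - (cos (pi/4) * a\<^sup>2)"
    "(plane a b $ 3)\<^sup>2 - (plane a b $ 4)\<^sup>2 = cos (pi/4) * b\<^sup>2" "2 * plane a b $ 3 * plane a b $ 4 = cos (pi/4) * b\<^sup>2"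
    by (simp_all add: power2_eq_square mult_ac)
qed

text \<open>Pythagoras: both quartics are squared diagonals of the rectangle with sides
  \<open>a\<^sup>2\<close> and \<open>b\<^sup>2\<close>. That the diagonals agree is what allows a
  single root in the reduced Hamiltonian.\<close>

lemma plane_quartic:
  "((plane a b $ 1)\<^sup>2 - (plane a b $ 2)\<^sup>2 + (plane a b $ 3)\<^sup>2 - (plane a b $ 4)\<^sup>2)\<^sup>2
    + (2 * plane a b $ 1 * plane a b $ 2 + 2 * plane a b $ 3 * plane a b $ 4)\<^sup>2 = a ^ 4 + b ^ 4" (is "?A = _")
  "((plane a b $ 1)\<^sup>2 - (plane a b $ 2)\<^sup>2 - (plane a b $ 3)\<^sup>2 + (plane a b $ 4)\<^sup>2)\<^sup>2
    + (2 * plane a b $ 1 * plane a b $ 2 - 2 * plane a b $ 3 * plane a b $ 4)\<^sup>2 = a ^ 4 + b ^ 4" (is "?B = _")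
proof -
  define k where "k = cos (pi/4)"
  have k: "2 * k\<^sup>2 = 1" using cos_sin_pi_8(5) by (simp add: k_def power2_eq_square)
  have e: "u - v + w - z = (u - v) + (w - z)" "u - v - w + z = (u - v) - (w - z)" for u v w z :: real by simp_all
  have "?A = (k * a\<^sup>2 + k * b\<^sup>2)\<^sup>2 + (- (k * a\<^sup>2) + k * b\<^sup>2)\<^sup>2"
    unfolding e unfolding plane_complex_squares k_def ..
  also have "\<dots> = 2 * k\<^sup>2 * (a ^ 4 + b ^ 4)" by algebra
  finally show "?A = a ^ 4 + b ^ 4" by (simp add: k)
  have "?B = (k * a\<^sup>2 - k * b\<^sup>2)\<^sup>2 + (- (k * a\<^sup>2) - k * b\<^sup>2)\<^sup>2"
    unfolding e unfolding plane_complex_squares k_def ..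
  also have "\<dots> = 2 * k\<^sup>2 * (a ^ 4 + b ^ 4)" by algebra
  finally show "?B = a ^ 4 + b ^ 4" by (simp add: k)
qed

section \<open>The regularized Hamiltonian and its gradient on the plane\<close>

lemma Gamma_hat_equal_masses:
  "Gamma_hat 1 E w =
     1/8 * (((snd w $ 1)\<^sup>2 + (snd w $ 2)\<^sup>2) * ((fst w $ 3)\<^sup>2 + (fst w $ 4)\<^sup>2)
       + ((snd w $ 3)\<^sup>2 + (snd w $ 4)\<^sup>2) * ((fst w $ 1)\<^sup>2 + (fst w $ 2)\<^sup>2))
     - ((fst w $ 1)\<^sup>2 + (fst w $ 2)\<^sup>2) * ((fst w $ 3)\<^sup>2 + (fst w $ 4)\<^sup>2)
         / sqrt (((fst w $ 1)\<^sup>2 - (fst w $ 2)\<^sup>2 + (fst w $ 3)\<^sup>2 - (fst w $ 4)\<^sup>2)\<^sup>2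
             + (2 * fst w $ 1 * fst w $ 2 + 2 * fst w $ 3 * fst w $ 4)\<^sup>2)
     - 2 * (((fst w $ 1)\<^sup>2 + (fst w $ 2)\<^sup>2) + ((fst w $ 3)\<^sup>2 + (fst w $ 4)\<^sup>2))
     - ((fst w $ 1)\<^sup>2 + (fst w $ 2)\<^sup>2) * ((fst w $ 3)\<^sup>2 + (fst w $ 4)\<^sup>2)
         / sqrt (((fst w $ 1)\<^sup>2 - (fst w $ 2)\<^sup>2 - (fst w $ 3)\<^sup>2 + (fst w $ 4)\<^sup>2)\<^sup>2
             + (2 * fst w $ 1 * fst w $ 2 - 2 * fst w $ 3 * fst w $ 4)\<^sup>2)
     - E * (((fst w $ 1)\<^sup>2 + (fst w $ 2)\<^sup>2) * ((fst w $ 3)\<^sup>2 + (fst w $ 4)\<^sup>2))"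
  by (cases w) (simp add: Gamma_hat_def Let_def)

lemma Gamma_hat_plane: "Gamma_hat 1 E (plane x y, plane p q) = rect_energy E x y p q"
  unfolding Gamma_hat_equal_masses fst_conv snd_conv plane_squares plane_quartic rect_energy_def
  by (simp add: algebra_simps)

lemma has_derivative_quotient_sqrt:
  fixes f A :: "'a::real_normed_vector \<Rightarrow> real"
  assumes f: "(f has_derivative f') (at w)" and A: "(A has_derivative A') (at w)" and pos: "A w > 0"
  shows "((\<lambda>w. f w / sqrt (A w)) has_derivative (\<lambda>h. f' h / sqrt (A w) - f w * A' h / (2 * sqrt (A w) ^ 3))) (at w)"
proof -
  have "((\<lambda>w. sqrt (A w)) has_derivative (\<lambda>h. A' h / (2 * sqrt (A w)))) (at w)"
    using has_derivative_real_sqrt[OF pos A] by (simp add: field_simps)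
  from has_derivative_divide'[OF f this] pos
  have "((\<lambda>w. f w / sqrt (A w)) has_derivative
      (\<lambda>h. (f' h * sqrt (A w) - f w * (A' h / (2 * sqrt (A w)))) / (sqrt (A w) * sqrt (A w)))) (at w)"
    by simp
  moreover have "(f' h * sqrt (A w) - f w * (A' h / (2 * sqrt (A w)))) / (sqrt (A w) * sqrt (A w))
      = f' h / sqrt (A w) - f w * A' h / (2 * sqrt (A w) ^ 3)" for h
  proof -
    have "(u * r - v * (c / (2 * r))) / (r * r) = u / r - v * c / (2 * r ^ 3)" if "r > 0" for u v c r :: real
      using that by (simp add: field_simps power3_eq_cube)
    from this[OF real_sqrt_gt_zero[OF pos]] show ?thesis .
  qed
  ultimately show ?thesis by simp
qed

text \<open>Neither differential of the two quartics \<open>A\<close>, \<open>B\<close> below is a combination of the components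
  \<open>l1\<close>, \<open>l2\<close> along the plane, but their sum is; this is where equality of the masses enters.\<close>

lemma GDERIV_Gamma_hat_plane:
  assumes pos: "x ^ 4 + y ^ 4 > 0"
  shows "GDERIV (Gamma_hat 1 E) (plane x y, plane p q) :>
    (plane (- rect_force E x y q) (- rect_force E y x p), plane (p * y\<^sup>2 / 4) (q * x\<^sup>2 / 4))"
proof -
  define P where "P = (plane x y, plane p q)"
  define al be k where "al = cos (pi/8)" and "be = sin (pi/8)" and "k = cos (pi/4)"
  \<comment> \<open>Inner products with the orthonormal vectors \<open>plane 1 0\<close> and
    \<open>plane 0 1\<close>. A gradient lies in the plane exactly when the differential is a
    combination of these two.\<close>
  define l1 l2 where "l1 h = al * h $ 1 - be * h $ 2" and "l2 h = al * h $ 3 + be * h $ 4" for h :: "real^4"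
  define r where "r = sqrt (x ^ 4 + y ^ 4)"
  have r: "r > 0" "r\<^sup>2 = x ^ 4 + y ^ 4" using pos by (simp_all add: r_def)
  have fst_d: "((\<lambda>w::phase. fst w $ i) has_derivative (\<lambda>h. fst h $ i)) (at P)"
    and snd_d: "((\<lambda>w::phase. snd w $ i) has_derivative (\<lambda>h. snd h $ i)) (at P)" for i
    by (rule bounded_linear_imp_has_derivative bounded_linear_compose[OF bounded_linear_vec_nth bounded_linear_fst]
        bounded_linear_compose[OF bounded_linear_vec_nth bounded_linear_snd])+
  have Pc: "fst P $ 1 = al * x" "fst P $ 2 = - be * x" "fst P $ 3 = al * y" "fst P $ 4 = be * y"
    "snd P $ 1 = al * p" "snd P $ 2 = - be * p" "snd P $ 3 = al * q" "snd P $ 4 = be * q"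
    by (simp_all add: P_def al_def be_def)
  define n1 n2 N1 N2 where "n1 w = (fst w $ 1)\<^sup>2 + (fst w $ 2)\<^sup>2" and "n2 w = (fst w $ 3)\<^sup>2 + (fst w $ 4)\<^sup>2"
    and "N1 w = (snd w $ 1)\<^sup>2 + (snd w $ 2)\<^sup>2" and "N2 w = (snd w $ 3)\<^sup>2 + (snd w $ 4)\<^sup>2" for w :: phase
  define A B where "A w = ((fst w $ 1)\<^sup>2 - (fst w $ 2)\<^sup>2 + (fst w $ 3)\<^sup>2 - (fst w $ 4)\<^sup>2)\<^sup>2
      + (2 * fst w $ 1 * fst w $ 2 + 2 * fst w $ 3 * fst w $ 4)\<^sup>2"
    and "B w = ((fst w $ 1)\<^sup>2 - (fst w $ 2)\<^sup>2 - (fst w $ 3)\<^sup>2 + (fst w $ 4)\<^sup>2)\<^sup>2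
      + (2 * fst w $ 1 * fst w $ 2 - 2 * fst w $ 3 * fst w $ 4)\<^sup>2" for w :: phase
  have n: "n1 P = x\<^sup>2" "n2 P = y\<^sup>2" "N1 P = p\<^sup>2" "N2 P = q\<^sup>2" "A P = x ^ 4 + y ^ 4" "B P = x ^ 4 + y ^ 4"
    unfolding n1_def n2_def N1_def N2_def A_def B_def P_def fst_conv snd_conv
    by (rule plane_squares plane_quartic)+
  have d: "(n1 has_derivative (\<lambda>h. 2 * x * l1 (fst h))) (at P)" "(n2 has_derivative (\<lambda>h. 2 * y * l2 (fst h))) (at P)"
    "(N1 has_derivative (\<lambda>h. 2 * p * l1 (snd h))) (at P)" "(N2 has_derivative (\<lambda>h. 2 * q * l2 (snd h))) (at P)"
    unfolding n1_def n2_def N1_def N2_def l1_def l2_def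
    by (rule derivative_eq_intros fst_d snd_d refl | simp add: Pc fun_eq_iff algebra_simps)+
  define m1 m2 m3 m4 where "m1 h = 2 * (al * x * h $ 1 + be * x * h $ 2)" and "m2 h = 2 * (al * x * h $ 2 - be * x * h $ 1)"
    and "m3 h = 2 * (al * y * h $ 3 - be * y * h $ 4)" and "m4 h = 2 * (al * y * h $ 4 + be * y * h $ 3)" for h :: "real^4"
  define a' b' where "a' h = 2 * k * ((x\<^sup>2 + y\<^sup>2) * (m1 h + m3 h) + (y\<^sup>2 - x\<^sup>2) * (m2 h + m4 h))"
    and "b' h = 2 * k * ((x\<^sup>2 - y\<^sup>2) * (m1 h - m3 h) - (x\<^sup>2 + y\<^sup>2) * (m2 h - m4 h))" for h
  have M: "(fst P $ 1)\<^sup>2 - (fst P $ 2)\<^sup>2 = k * x\<^sup>2" "2 * fst P $ 1 * fst P $ 2 = - (k * x\<^sup>2)"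
    "(fst P $ 3)\<^sup>2 - (fst P $ 4)\<^sup>2 = k * y\<^sup>2" "2 * fst P $ 3 * fst P $ 4 = k * y\<^sup>2"
    unfolding P_def fst_conv k_def by (rule plane_complex_squares)+
  define c1 c2 c3 c4 where "c1 w = (fst w $ 1)\<^sup>2 - (fst w $ 2)\<^sup>2" and "c2 w = 2 * fst w $ 1 * fst w $ 2"
    and "c3 w = (fst w $ 3)\<^sup>2 - (fst w $ 4)\<^sup>2" and "c4 w = 2 * fst w $ 3 * fst w $ 4" for w :: phase
  have cP: "c1 P = k * x\<^sup>2" "c2 P = - (k * x\<^sup>2)" "c3 P = k * y\<^sup>2" "c4 P = k * y\<^sup>2"
    unfolding c1_def c2_def c3_def c4_def by (rule M)+
  have cd: "(c1 has_derivative (\<lambda>h. m1 (fst h))) (at P)" "(c2 has_derivative (\<lambda>h. m2 (fst h))) (at P)"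
    "(c3 has_derivative (\<lambda>h. m3 (fst h))) (at P)" "(c4 has_derivative (\<lambda>h. m4 (fst h))) (at P)"
    unfolding c1_def c2_def c3_def c4_def m1_def m2_def m3_def m4_def
    by (rule derivative_eq_intros fst_d refl | simp add: Pc fun_eq_iff algebra_simps)+
  have AB: "A = (\<lambda>w. (c1 w + c3 w)\<^sup>2 + (c2 w + c4 w)\<^sup>2)" "B = (\<lambda>w. (c1 w - c3 w)\<^sup>2 + (c2 w - c4 w)\<^sup>2)"
    by (simp_all add: A_def B_def c1_def c2_def c3_def c4_def fun_eq_iff algebra_simps)
  have dA: "(A has_derivative (\<lambda>h. a' (fst h))) (at P)" and dB: "(B has_derivative (\<lambda>h. b' (fst h))) (at P)"
    unfolding AB a'_def b'_def
    by (rule derivative_eq_intros cd refl | simp add: cP fun_eq_iff algebra_simps)+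
  have sum: "a' h + b' h = 8 * x ^ 3 * l1 h + 8 * y ^ 3 * l2 h" for h
  proof -
    have "a' h + b' h = 8 * x ^ 3 * ((k * (al + be)) * h $ 1 - (k * (al - be)) * h $ 2)
        + 8 * y ^ 3 * ((k * (al + be)) * h $ 3 + (k * (al - be)) * h $ 4)"
      unfolding a'_def b'_def m1_def m2_def m3_def m4_def by algebra
    moreover have "k * (al + be) = al" "k * (al - be) = be"
      using cos_sin_pi_8(1,2) by (simp_all add: al_def be_def k_def)
    ultimately show ?thesis by (simp add: l1_def l2_def)
  qed
  have eq: "Gamma_hat 1 E = (\<lambda>w. 1/8 * (N1 w * n2 w + N2 w * n1 w) - n1 w * n2 w / sqrt (A w)
      - 2 * (n1 w + n2 w) - n1 w * n2 w / sqrt (B w) - E * (n1 w * n2 w))"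
    by (rule ext) (simp only: Gamma_hat_equal_masses n1_def n2_def N1_def N2_def A_def B_def)
  define f' where "f' h = 2 * x * l1 h * y\<^sup>2 + x\<^sup>2 * (2 * y * l2 h)" for h
  have dn: "((\<lambda>w. n1 w * n2 w) has_derivative (\<lambda>h. f' (fst h))) (at P)"
    unfolding f'_def by (rule derivative_eq_intros d refl | simp add: n fun_eq_iff algebra_simps)+
  have AP: "A P > 0" "B P > 0" using pos by (simp_all add: n)
  note dq = has_derivative_quotient_sqrt[OF dn dA AP(1), unfolded n r_def[symmetric]]
    has_derivative_quotient_sqrt[OF dn dB AP(2), unfolded n r_def[symmetric]]
  have dG: "(Gamma_hat 1 E has_derivative (\<lambda>h.
      1/8 * (2 * p * l1 (snd h) * y\<^sup>2 + p\<^sup>2 * (2 * y * l2 (fst h)) + (2 * q * l2 (snd h) * x\<^sup>2 + q\<^sup>2 * (2 * x * l1 (fst h))))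
      - (f' (fst h) / r - x\<^sup>2 * y\<^sup>2 * a' (fst h) / (2 * r ^ 3))
      - 2 * (2 * x * l1 (fst h) + 2 * y * l2 (fst h))
      - (f' (fst h) / r - x\<^sup>2 * y\<^sup>2 * b' (fst h) / (2 * r ^ 3)) - E * f' (fst h))) (at P)"
    unfolding eq
    by (rule derivative_eq_intros d dn dq refl | simp add: n fun_eq_iff algebra_simps)+
  have "1/8 * (2 * p * l1 (snd h) * y\<^sup>2 + p\<^sup>2 * (2 * y * l2 (fst h)) + (2 * q * l2 (snd h) * x\<^sup>2 + q\<^sup>2 * (2 * x * l1 (fst h))))
      - (f' (fst h) / r - x\<^sup>2 * y\<^sup>2 * a' (fst h) / (2 * r ^ 3))
      - 2 * (2 * x * l1 (fst h) + 2 * y * l2 (fst h))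
      - (f' (fst h) / r - x\<^sup>2 * y\<^sup>2 * b' (fst h) / (2 * r ^ 3)) - E * f' (fst h)
    = h \<bullet> (plane (- rect_force E x y q) (- rect_force E y x p), plane (p * y\<^sup>2 / 4) (q * x\<^sup>2 / 4))" for h :: phase
  proof -
    have inner: "h \<bullet> (plane a b, plane c d) = a * l1 (fst h) + b * l2 (fst h) + (c * l1 (snd h) + d * l2 (snd h))" for a b c d
      by (simp add: inner_prod_def inner_vec4 l1_def l2_def al_def be_def algebra_simps)
    have "1 / r = r\<^sup>2 / r ^ 3" using r(1) by (simp add: power2_eq_square power3_eq_cube)
    then have fr: "f' (fst h) / r = f' (fst h) * (x ^ 4 + y ^ 4) / r ^ 3"
      unfolding r(2) by (metis times_divide_eq_right mult.right_neutral)
    have "2 * (f' (fst h) * (x ^ 4 + y ^ 4) / r ^ 3) - x\<^sup>2 * y\<^sup>2 * (a' (fst h) + b' (fst h)) / (2 * r ^ 3)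
        = (2 * (f' (fst h) * (x ^ 4 + y ^ 4)) - x\<^sup>2 * y\<^sup>2 * (4 * x ^ 3 * l1 (fst h) + 4 * y ^ 3 * l2 (fst h))) / r ^ 3"
      unfolding sum using r(1) by (simp add: field_simps)
    also have "\<dots> = (4 * x * y ^ 6 * l1 (fst h) + 4 * y * x ^ 6 * l2 (fst h)) / r ^ 3"
      unfolding f'_def by (rule arg_cong[where f = "\<lambda>c. c / r ^ 3"]) algebra
    also have "\<dots> = 4 * x * (y ^ 6 / r ^ 3) * l1 (fst h) + 4 * y * (x ^ 6 / r ^ 3) * l2 (fst h)"
      by (simp add: add_divide_distrib)
    finally have key: "2 * (f' (fst h) / r) - x\<^sup>2 * y\<^sup>2 * (a' (fst h) + b' (fst h)) / (2 * r ^ 3)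
        = 4 * x * (y ^ 6 / r ^ 3) * l1 (fst h) + 4 * y * (x ^ 6 / r ^ 3) * l2 (fst h)"
      unfolding fr .
    have split: "2 * (f' (fst h) / r) - x\<^sup>2 * y\<^sup>2 * (a' (fst h) + b' (fst h)) / (2 * r ^ 3)
        = (f' (fst h) / r - x\<^sup>2 * y\<^sup>2 * a' (fst h) / (2 * r ^ 3)) + (f' (fst h) / r - x\<^sup>2 * y\<^sup>2 * b' (fst h) / (2 * r ^ 3))"
      by (simp add: distrib_left add_divide_distrib)
    have force: "rect_force E x y q = x * (4 - q\<^sup>2 / 4 + 4 * (y ^ 6 / r ^ 3) + 2 * E * y\<^sup>2)"
      "rect_force E y x p = y * (4 - p\<^sup>2 / 4 + 4 * (x ^ 6 / r ^ 3) + 2 * E * x\<^sup>2)"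
      by (simp_all add: rect_force_def r_def add.commute)
    \<comment> \<open>Only \<open>U + V\<close> has an expression in \<open>l1\<close> and
      \<open>l2\<close>, so \<open>V\<close> is eliminated in order that the terms in
      \<open>U\<close> cancel.\<close>
    define U V where "U = f' (fst h) / r - x\<^sup>2 * y\<^sup>2 * a' (fst h) / (2 * r ^ 3)"
      and "V = f' (fst h) / r - x\<^sup>2 * y\<^sup>2 * b' (fst h) / (2 * r ^ 3)"
    have UV: "V = 4 * x * (y ^ 6 / r ^ 3) * l1 (fst h) + 4 * y * (x ^ 6 / r ^ 3) * l2 (fst h) - U"
      using key split by (simp add: U_def V_def)
    show ?thesis
      unfolding inner force U_def[symmetric] V_def[symmetric] unfolding UV f'_def
      by (simp add: field_simps power2_eq_square)
  qed
  with dG show ?thesis by (simp only: gderiv_def P_def)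
qed

section \<open>The symmetry group\<close>

lemma BijGroup_UNIV:
  "carrier (BijGroup UNIV) = {f. bij f}" "\<one>\<^bsub>BijGroup UNIV\<^esub> = (\<lambda>x. x)"
  "bij f \<Longrightarrow> bij g \<Longrightarrow> f \<otimes>\<^bsub>BijGroup UNIV\<^esub> g = f \<circ> g"
  by (auto simp: BijGroup_def Bij_def extensional_def compose_def restrict_def o_def)

lemma S_F_nth [simp]:
  "fst (S_F w) $ 1 = - fst w $ 3" "fst (S_F w) $ 2 = fst w $ 4" "fst (S_F w) $ 3 = fst w $ 1" "fst (S_F w) $ 4 = - fst w $ 2"
  "snd (S_F w) $ 1 = - snd w $ 3" "snd (S_F w) $ 2 = snd w $ 4" "snd (S_F w) $ 3 = snd w $ 1" "snd (S_F w) $ 4 = - snd w $ 2"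
  by (simp_all add: S_F_def split_beta)

lemma S_G_nth [simp]:
  "fst (S_G w) $ 1 = - fst w $ 1" "fst (S_G w) $ 2 = - fst w $ 2" "fst (S_G w) $ 3 = fst w $ 3" "fst (S_G w) $ 4 = fst w $ 4"
  "snd (S_G w) $ 1 = snd w $ 1" "snd (S_G w) $ 2 = snd w $ 2" "snd (S_G w) $ 3 = - snd w $ 3" "snd (S_G w) $ 4 = - snd w $ 4"
  by (simp_all add: S_G_def split_beta)

lemma phase_eq_iff: "(w :: phase) = w' \<longleftrightarrow>
    fst w $ 1 = fst w' $ 1 \<and> fst w $ 2 = fst w' $ 2 \<and> fst w $ 3 = fst w' $ 3 \<and> fst w $ 4 = fst w' $ 4 \<and>
    snd w $ 1 = snd w' $ 1 \<and> snd w $ 2 = snd w' $ 2 \<and> snd w $ 3 = snd w' $ 3 \<and> snd w $ 4 = snd w' $ 4"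
  by (auto simp: prod_eq_iff vec4_eq_iff)

lemma symmetry_relations: "S_G (S_G w) = w" "S_F (S_F (S_F (S_F w))) = w" "S_G (S_F (S_G (S_F w))) = w"
  by (simp_all add: phase_eq_iff)

lemma symmetry_bij: "bij S_F" "bij S_G"
  by (rule o_bij[of "\<lambda>w. S_F (S_F (S_F w))"] o_bij[of S_G]; simp add: fun_eq_iff symmetry_relations)+

text \<open>The presentation of \<open>D4\<close> supplies the homomorphism. Its image is the
  generated group because generators go to generators, so only injectivity has to be checked by
  hand, on eight elements.\<close>

lemma FG_set_iso:
  obtains h where "h \<in> hom D4 (BijGroup UNIV)" "h (1, 0) = S_G" "h (0, 1) = S_F"
    "h ` carrier D4 = FG_set" "inj_on h (carrier D4)"
proof -
  let ?G = "BijGroup (UNIV :: phase set)"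
  interpret G: group ?G by (rule group_BijGroup)
  have ab: "S_G \<in> carrier ?G" "S_F \<in> carrier ?G" using symmetry_bij by (simp_all add: BijGroup_UNIV)
  note mult = BijGroup_UNIV(3) and bij = symmetry_bij bij_comp
  have sq: "f [^]\<^bsub>?G\<^esub> (2::nat) = f \<circ> f" if "bij f" for f
    using that G.nat_pow_Suc G.l_one by (simp add: numeral_2_eq_2 mult BijGroup_UNIV)
  have fourth: "S_F [^]\<^bsub>?G\<^esub> (4::nat) = (S_F \<circ> S_F) \<circ> (S_F \<circ> S_F)"
    using G.nat_pow_mult[OF ab(2), of 2 2] mult[OF bij_comp[OF bij(1) bij(1)] bij_comp[OF bij(1) bij(1)]]
    by (simp add: sq bij(1))
  have "\<exists>h \<in> hom D4 ?G. h (1, 0) = S_G \<and> h (0, 1) = S_F"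
  proof (rule D4_universal[OF group_BijGroup ab])
    show "S_G [^]\<^bsub>?G\<^esub> (2::nat) = \<one>\<^bsub>?G\<^esub>"
      using bij by (simp add: sq BijGroup_UNIV(2) fun_eq_iff symmetry_relations)
    show "S_F [^]\<^bsub>?G\<^esub> (4::nat) = \<one>\<^bsub>?G\<^esub>"
      by (simp add: fourth BijGroup_UNIV(2) fun_eq_iff symmetry_relations)
    show "(S_G \<otimes>\<^bsub>?G\<^esub> S_F) [^]\<^bsub>?G\<^esub> (2::nat) = \<one>\<^bsub>?G\<^esub>"
      using sq[OF bij_comp[OF bij(1,2)]] bij(1,2)
      by (simp add: mult BijGroup_UNIV(2) fun_eq_iff symmetry_relations)
  qed
  then obtain h where h: "h \<in> hom D4 ?G" "h (1, 0) = S_G" "h (0, 1) = S_F" by blast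
  interpret h: group_hom D4 ?G h
    by (intro group_hom.intro D4_group group_BijGroup group_hom_axioms.intro h)
  have "h ` carrier D4 = FG_set"
    unfolding D4_generated FG_set_def
    using h.generate_img[of "{(1, 0), (0, 1)}"] h by (simp add: D4_def insert_commute)
  moreover have "inj_on h (carrier D4)"
  proof -
    have c: "(i, j) \<in> carrier D4" if "i < 2" "j < 4" for i j using that by (simp add: D4_def)
    have m: "h (d \<otimes>\<^bsub>D4\<^esub> d') = h d \<circ> h d'" if "d \<in> carrier D4" "d' \<in> carrier D4" for d d'
      using h.hom_mult[OF that] h.hom_closed that by (simp add: mult BijGroup_UNIV(1))
    have v: "h (0, 0) = (\<lambda>w. w)" using h.hom_one by (simp add: D4_def BijGroup_UNIV(2))
    have prods: "(0, 1) \<otimes>\<^bsub>D4\<^esub> (0, 1) = (0, 2)" "(0, 1) \<otimes>\<^bsub>D4\<^esub> (0, 2) = (0, 3)"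
      "(1, 0) \<otimes>\<^bsub>D4\<^esub> (0, 1) = (1, 1)" "(1, 0) \<otimes>\<^bsub>D4\<^esub> (0, 2) = (1, 2)" "(1, 0) \<otimes>\<^bsub>D4\<^esub> (0, 3) = (1, 3)"
      by (simp_all add: D4_def)
    have v2: "h (0, 2) = S_F \<circ> S_F" using m[OF c c, of 0 1 0 1] by (simp only: prods h; simp)
    have v3: "h (0, 3) = S_F \<circ> (S_F \<circ> S_F)" using m[OF c c, of 0 1 0 2] by (simp only: prods h v2; simp)
    have w1: "h (1, 1) = S_G \<circ> S_F" using m[OF c c, of 1 0 0 1] by (simp only: prods h; simp)
    have w2: "h (1, 2) = S_G \<circ> (S_F \<circ> S_F)" using m[OF c c, of 1 0 0 2] by (simp only: prods h v2; simp)
    have w3: "h (1, 3) = S_G \<circ> (S_F \<circ> (S_F \<circ> S_F))" using m[OF c c, of 1 0 0 3] by (simp only: prods h v3; simp)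
    \<comment> \<open>A test point on which the eight maps differ: the first and third coordinates
      of its images run through all signed arrangements of 1 and 3.\<close>
    define pt :: phase where "pt = (vector [1, 2, 3, 4], 0)"
    have pt: "fst pt $ 1 = 1" "fst pt $ 2 = 2" "fst pt $ 3 = 3" "fst pt $ 4 = 4" by (simp_all add: pt_def)
    define e where "e f = (fst (f pt) $ 1, fst (f pt) $ 3)" for f :: "phase \<Rightarrow> phase"
    have "inj_on (\<lambda>d. e (h d)) (carrier D4)"
      by (auto simp: inj_on_def D4_def below_2 below_4 e_def v v2 v3 w1 w2 w3 h pt simp del: One_nat_def)
    then show ?thesis by (auto simp: inj_on_def)
  qed
  ultimately show ?thesis using that h by blast
qed

lemma time_symmetry_comp:
  "time_preserving \<gamma> S \<Longrightarrow> time_preserving \<gamma> S' \<Longrightarrow> time_preserving \<gamma> (S \<circ> S')"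
  "time_preserving \<gamma> S \<Longrightarrow> time_reversing \<gamma> S' \<Longrightarrow> time_reversing \<gamma> (S \<circ> S')"
  "time_reversing \<gamma> S \<Longrightarrow> time_preserving \<gamma> S' \<Longrightarrow> time_reversing \<gamma> (S \<circ> S')"
  "time_reversing \<gamma> S \<Longrightarrow> time_reversing \<gamma> S' \<Longrightarrow> time_preserving \<gamma> (S \<circ> S')"
proof -
  have pp: "\<exists>c. \<forall>s. \<gamma> (s + d + e) = \<gamma> (s + c)" and pr: "\<exists>c. \<forall>s. \<gamma> (d - s + e) = \<gamma> (c - s)"
    and rp: "\<exists>c. \<forall>s. \<gamma> (e - (s + d)) = \<gamma> (c - s)" and rr: "\<exists>c. \<forall>s. \<gamma> (e - (d - s)) = \<gamma> (s + c)" for d e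
    subgoal by (rule exI[of _ "d + e"]) (simp add: algebra_simps)
    subgoal by (rule exI[of _ "d + e"]) (simp add: algebra_simps)
    subgoal by (rule exI[of _ "e - d"]) (simp add: algebra_simps)
    subgoal by (rule exI[of _ "e - d"]) (simp add: algebra_simps)
    done
  show "time_preserving \<gamma> S \<Longrightarrow> time_preserving \<gamma> S' \<Longrightarrow> time_preserving \<gamma> (S \<circ> S')"
    "time_preserving \<gamma> S \<Longrightarrow> time_reversing \<gamma> S' \<Longrightarrow> time_reversing \<gamma> (S \<circ> S')"
    "time_reversing \<gamma> S \<Longrightarrow> time_preserving \<gamma> S' \<Longrightarrow> time_reversing \<gamma> (S \<circ> S')"
    "time_reversing \<gamma> S \<Longrightarrow> time_reversing \<gamma> S' \<Longrightarrow> time_preserving \<gamma> (S \<circ> S')"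
    unfolding time_preserving_def time_reversing_def using pp pr rp rr by auto
qed

text \<open>Symmetries are closed under composition and inversion, so two generators suffice: the
  symmetry group is then all of \<open>FG_set\<close>.\<close>

lemma symmetry_group_iso_D4:
  assumes F: "time_preserving \<gamma> S_F" and G: "time_reversing \<gamma> S_G"
  shows "symmetry_group \<gamma> \<cong> D4"
proof -
  obtain h where h: "h \<in> hom D4 (BijGroup UNIV)" "h (1, 0) = S_G" "h (0, 1) = S_F"
    "h ` carrier D4 = FG_set" "inj_on h (carrier D4)" by (rule FG_set_iso)
  let ?sym = "\<lambda>S. time_preserving \<gamma> S \<or> time_reversing \<gamma> S"
  have bij: "bij (h d)" if "d \<in> carrier D4" for d
    using h(1) that by (auto simp: hom_def BijGroup_UNIV)
  have "?sym (h d)" if d: "d \<in> carrier D4" for d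
  proof -
    have "d \<in> generate D4 {(1, 0), (0, 1)}" using d D4_generated by simp
    then show ?thesis
    proof induction
      case one
      have "h \<one>\<^bsub>D4\<^esub> = (\<lambda>w. w)"
        using hom_one[OF h(1) D4_group group_BijGroup] by (simp add: BijGroup_UNIV)
      then have "time_preserving \<gamma> (h \<one>\<^bsub>D4\<^esub>)" by (auto simp: time_preserving_def intro: exI[of _ 0])
      then show ?case ..
    next
      case (incl g)
      then show ?case using F G h by auto
    next
      case (inv g)
      interpret D: group D4 by (rule D4_group)
      have c: "g \<in> carrier D4" "inv\<^bsub>D4\<^esub> g \<in> carrier D4"
        using inv D.inv_closed by (auto simp: D4_def)
      have "h (inv\<^bsub>D4\<^esub> g) \<circ> h g = (\<lambda>w. w)" "h g \<circ> h (inv\<^bsub>D4\<^esub> g) = (\<lambda>w. w)"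
        using hom_mult[OF h(1) c(2,1)] hom_mult[OF h(1) c] c bij D.l_inv D.r_inv
          hom_one[OF h(1) D4_group group_BijGroup] by (simp_all add: BijGroup_UNIV)
      then have i: "h g (h (inv\<^bsub>D4\<^esub> g) w) = w" "h (inv\<^bsub>D4\<^esub> g) (h g w) = w" for w by (metis comp_apply)+
      from inv consider "h g = S_F" | "h g = S_G" using h by auto
      then show ?case
      proof cases
        case 1
        then obtain c where "\<And>s. h g (\<gamma> s) = \<gamma> (s + c)" using F by (auto simp: time_preserving_def)
        then have "h (inv\<^bsub>D4\<^esub> g) (\<gamma> s) = \<gamma> (s + - c)" for s using i(2)[of "\<gamma> (s + - c)"] by simp
        then show ?thesis unfolding time_preserving_def by blast
      next
        case 2
        then obtain c where "\<And>s. h g (\<gamma> s) = \<gamma> (c - s)" using G by (auto simp: time_reversing_def)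
        then have "h (inv\<^bsub>D4\<^esub> g) (\<gamma> s) = \<gamma> (c - s)" for s using i(2)[of "\<gamma> (c - s)"] by simp
        then show ?thesis unfolding time_reversing_def by blast
      qed
    next
      case (eng g g')
      then have "g \<in> carrier D4" "g' \<in> carrier D4" by (simp_all add: D4_generated)
      then have "h (g \<otimes>\<^bsub>D4\<^esub> g') = h g \<circ> h g'"
        using hom_mult[OF h(1)] bij by (simp add: BijGroup_UNIV)
      then show ?case using eng time_symmetry_comp by metis
    qed
  qed
  then have "?sym S" if "S \<in> FG_set" for S using that unfolding h(4)[symmetric] by (elim imageE) simp
  then have c: "carrier (symmetry_group \<gamma>) = FG_set"
    by (auto simp: symmetry_group_def)
  have "h \<in> iso D4 (symmetry_group \<gamma>)"
    using h c by (auto simp: iso_def hom_def bij_betw_def symmetry_group_def)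
  then have "D4 \<cong> symmetry_group \<gamma>" by (auto simp: is_iso_def)
  then show ?thesis by (rule group.iso_sym[OF D4_group])
qed

section \<open>The orbit of the four-body problem\<close>

text \<open>\<open>rect (x\<^sup>2) (y\<^sup>2)\<close> is the position and \<open>rect (p / x) (q / y)\<close> the momentum that correspond to
  \<open>(plane x y, plane p q)\<close>.\<close>

definition rect :: "real \<Rightarrow> real \<Rightarrow> real^4" where
  "rect a b = (cos (pi/4) / 2) *\<^sub>R vector [a + b, b - a, b - a, a + b]"

lemma rect_nth [simp]:
  "rect a b $ 1 = cos (pi/4) / 2 * (a + b)" "rect a b $ 2 = cos (pi/4) / 2 * (b - a)"
  "rect a b $ 3 = cos (pi/4) / 2 * (b - a)" "rect a b $ 4 = cos (pi/4) / 2 * (a + b)"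
  by (simp_all add: rect_def)

lemma rect_eq: "rect a b = a *\<^sub>R rect 1 0 + b *\<^sub>R rect 0 1"
  by (simp add: vec4_eq_iff field_simps)

lemma rect_minus: "- rect a b = rect (- a) (- b)"
  by (simp add: vec4_eq_iff field_simps)

text \<open>\<open>a\<close> and \<open>b\<close> are the side lengths; the first two values are
  squares of half a diagonal.\<close>

lemma rect_squares:
  "(rect a b $ 1)\<^sup>2 + (rect a b $ 2)\<^sup>2 = (a\<^sup>2 + b\<^sup>2) / 4" "(rect a b $ 3)\<^sup>2 + (rect a b $ 4)\<^sup>2 = (a\<^sup>2 + b\<^sup>2) / 4"
  "(rect a b $ 3 - rect a b $ 1)\<^sup>2 + (rect a b $ 4 - rect a b $ 2)\<^sup>2 = a\<^sup>2"
  "(rect a b $ 1 + rect a b $ 3)\<^sup>2 + (rect a b $ 2 + rect a b $ 4)\<^sup>2 = b\<^sup>2"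
proof -
  define k where "k = cos (pi/4)"
  have k: "k * k = 1/2" using cos_sin_pi_8(5) by (simp add: k_def)
  have "(k / 2 * (a + b))\<^sup>2 + (k / 2 * (b - a))\<^sup>2 = k * k * ((a\<^sup>2 + b\<^sup>2) / 2)"
    by (simp add: power2_eq_square field_simps)
  moreover have "(k / 2 * (b - a) - k / 2 * (a + b))\<^sup>2 + (k / 2 * (a + b) - k / 2 * (b - a))\<^sup>2 = k * k * (2 * a\<^sup>2)"
    "(k / 2 * (a + b) + k / 2 * (b - a))\<^sup>2 + (k / 2 * (b - a) + k / 2 * (a + b))\<^sup>2 = k * k * (2 * b\<^sup>2)"
    by (simp_all add: power2_eq_square field_simps)
  ultimately show "(rect a b $ 1)\<^sup>2 + (rect a b $ 2)\<^sup>2 = (a\<^sup>2 + b\<^sup>2) / 4" "(rect a b $ 3)\<^sup>2 + (rect a b $ 4)\<^sup>2 = (a\<^sup>2 + b\<^sup>2) / 4"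
    "(rect a b $ 3 - rect a b $ 1)\<^sup>2 + (rect a b $ 4 - rect a b $ 2)\<^sup>2 = a\<^sup>2"
    "(rect a b $ 1 + rect a b $ 3)\<^sup>2 + (rect a b $ 2 + rect a b $ 4)\<^sup>2 = b\<^sup>2"
    by (simp_all add: k_def[symmetric] k add.commute)
qed

lemma sqrt_quarter: "sqrt (c / 4) = sqrt c / 2"
  by (simp add: real_sqrt_divide)

section \<open>The Newtonian Hamiltonian and its gradient at a rectangle\<close>

lemma pps4bp_H_equal_masses:
  "pps4bp_H 1 w =
     1/4 * (((snd w $ 1)\<^sup>2 + (snd w $ 2)\<^sup>2) + ((snd w $ 3)\<^sup>2 + (snd w $ 4)\<^sup>2))
     - ((1/2) / sqrt ((fst w $ 1)\<^sup>2 + (fst w $ 2)\<^sup>2)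
       + 2 / sqrt ((fst w $ 3 - fst w $ 1)\<^sup>2 + (fst w $ 4 - fst w $ 2)\<^sup>2)
       + 2 / sqrt ((fst w $ 1 + fst w $ 3)\<^sup>2 + (fst w $ 2 + fst w $ 4)\<^sup>2)
       + (1/2) / sqrt ((fst w $ 3)\<^sup>2 + (fst w $ 4)\<^sup>2))"
  by (cases w) (simp add: pps4bp_H_def kinetic_def potential_def field_simps)

lemma pps4bp_H_rect:
  assumes "a > 0" "b > 0"
  shows "pps4bp_H 1 (rect a b, rect c d) = (c\<^sup>2 + d\<^sup>2) / 8 - 2 / a - 2 / b - 2 / sqrt (a\<^sup>2 + b\<^sup>2)"
  using assms unfolding pps4bp_H_equal_masses fst_conv snd_conv rect_squares sqrt_quarter
  by simp

text \<open>The interaction within a single pair of opposite bodies has a gradient that leaves the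
  plane of rectangles; the sum over both pairs does not, since the masses are equal. As
  \<open>rect 1 0\<close> and \<open>rect 0 1\<close> have squared norm 1/2, the coordinates of the
  gradient are twice the partial derivatives of the expression in
  \<open>pps4bp_H_rect\<close>.\<close>

lemma GDERIV_pps4bp_rect:
  assumes ab: "a > 0" "b > 0"
  shows "GDERIV (pps4bp_H 1) (rect a b, rect c d) :>
    (rect (4 * (1 / a\<^sup>2 + a / sqrt (a\<^sup>2 + b\<^sup>2) ^ 3)) (4 * (1 / b\<^sup>2 + b / sqrt (a\<^sup>2 + b\<^sup>2) ^ 3)), rect (c / 2) (d / 2))"
proof -
  define P where "P = (rect a b, rect c d)"
  define k where "k = cos (pi/4)"
  have k: "k * k = 1/2" using cos_sin_pi_8(5) by (simp add: k_def)
  define r where "r = sqrt (a\<^sup>2 + b\<^sup>2)"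
  have r: "r > 0" using ab by (simp add: r_def add_pos_pos)
  have fst_d: "((\<lambda>w::phase. fst w $ i) has_derivative (\<lambda>h. fst h $ i)) (at P)"
    and snd_d: "((\<lambda>w::phase. snd w $ i) has_derivative (\<lambda>h. snd h $ i)) (at P)" for i
    by (rule bounded_linear_imp_has_derivative bounded_linear_compose[OF bounded_linear_vec_nth bounded_linear_fst]
        bounded_linear_compose[OF bounded_linear_vec_nth bounded_linear_snd])+
  have Pc: "fst P $ 1 = k / 2 * (a + b)" "fst P $ 2 = k / 2 * (b - a)" "fst P $ 3 = k / 2 * (b - a)" "fst P $ 4 = k / 2 * (a + b)"
    "snd P $ 1 = k / 2 * (c + d)" "snd P $ 2 = k / 2 * (d - c)" "snd P $ 3 = k / 2 * (d - c)" "snd P $ 4 = k / 2 * (c + d)"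
    by (simp_all add: P_def k_def)
  define l1 l2 where "l1 h = k / 2 * (h $ 1 - h $ 2 - h $ 3 + h $ 4)" and "l2 h = k / 2 * (h $ 1 + h $ 2 + h $ 3 + h $ 4)"
    for h :: "real^4"
  define D1 D2 D3 D4 where "D1 w = (fst w $ 1)\<^sup>2 + (fst w $ 2)\<^sup>2" and "D2 w = (fst w $ 3)\<^sup>2 + (fst w $ 4)\<^sup>2"
    and "D3 w = (fst w $ 3 - fst w $ 1)\<^sup>2 + (fst w $ 4 - fst w $ 2)\<^sup>2"
    and "D4 w = (fst w $ 1 + fst w $ 3)\<^sup>2 + (fst w $ 2 + fst w $ 4)\<^sup>2" for w :: phase
  have D: "D1 P = (a\<^sup>2 + b\<^sup>2) / 4" "D2 P = (a\<^sup>2 + b\<^sup>2) / 4" "D3 P = a\<^sup>2" "D4 P = b\<^sup>2"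
    unfolding D1_def D2_def D3_def D4_def P_def fst_conv by (rule rect_squares)+
  have root: "sqrt (D1 P) = r / 2" "sqrt (D2 P) = r / 2" "sqrt (D3 P) = a" "sqrt (D4 P) = b"
    unfolding D using ab by (simp_all add: sqrt_quarter r_def)
  have pos: "D1 P > 0" "D2 P > 0" "D3 P > 0" "D4 P > 0"
    unfolding D using ab by (simp_all add: add_pos_pos)
  define e1 e2 where "e1 h = k * ((a + b) * h $ 1 + (b - a) * h $ 2)" and "e2 h = k * ((b - a) * h $ 3 + (a + b) * h $ 4)"
    for h :: "real^4"
  have d: "(D1 has_derivative (\<lambda>h. e1 (fst h))) (at P)" "(D2 has_derivative (\<lambda>h. e2 (fst h))) (at P)"
    "(D3 has_derivative (\<lambda>h. 4 * a * l1 (fst h))) (at P)" "(D4 has_derivative (\<lambda>h. 4 * b * l2 (fst h))) (at P)"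
    unfolding D1_def D2_def D3_def D4_def e1_def e2_def l1_def l2_def
    by (rule derivative_eq_intros fst_d refl | simp add: Pc fun_eq_iff field_simps)+
  have e: "e1 h + e2 h = 2 * (a * l1 h + b * l2 h)" for h
    by (simp add: e1_def e2_def l1_def l2_def field_simps)
  define K where "K w = ((snd w $ 1)\<^sup>2 + (snd w $ 2)\<^sup>2) + ((snd w $ 3)\<^sup>2 + (snd w $ 4)\<^sup>2)" for w :: phase
  have dK: "(K has_derivative (\<lambda>h. 2 * (c * l1 (snd h) + d * l2 (snd h)))) (at P)"
    unfolding K_def l1_def l2_def
    by (rule derivative_eq_intros snd_d refl | simp add: Pc fun_eq_iff field_simps)+
  note q = has_derivative_quotient_sqrt[OF has_derivative_const, of D1 _ P "1/2", OF d(1) pos(1)]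
    has_derivative_quotient_sqrt[OF has_derivative_const, of D2 _ P "1/2", OF d(2) pos(2)]
    has_derivative_quotient_sqrt[OF has_derivative_const, of D3 _ P 2, OF d(3) pos(3)]
    has_derivative_quotient_sqrt[OF has_derivative_const, of D4 _ P 2, OF d(4) pos(4)]
  have eq: "pps4bp_H 1 = (\<lambda>w. 1/4 * K w - ((1/2) / sqrt (D1 w) + 2 / sqrt (D3 w) + 2 / sqrt (D4 w) + (1/2) / sqrt (D2 w)))"
    by (rule ext) (simp only: pps4bp_H_equal_masses K_def D1_def D2_def D3_def D4_def)
  have dH: "(pps4bp_H 1 has_derivative (\<lambda>h. 1/4 * (2 * (c * l1 (snd h) + d * l2 (snd h)))
      - ((0 / (r / 2) - 1/2 * e1 (fst h) / (2 * (r / 2) ^ 3)) + (0 / a - 2 * (4 * a * l1 (fst h)) / (2 * a ^ 3))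
        + (0 / b - 2 * (4 * b * l2 (fst h)) / (2 * b ^ 3)) + (0 / (r / 2) - 1/2 * e2 (fst h) / (2 * (r / 2) ^ 3))))) (at P)"
    unfolding eq
    by (intro has_derivative_diff has_derivative_add has_derivative_mult_right dK q[unfolded root])
  have "1/4 * (2 * (c * l1 (snd h) + d * l2 (snd h)))
      - ((0 / (r / 2) - 1/2 * e1 (fst h) / (2 * (r / 2) ^ 3)) + (0 / a - 2 * (4 * a * l1 (fst h)) / (2 * a ^ 3))
        + (0 / b - 2 * (4 * b * l2 (fst h)) / (2 * b ^ 3)) + (0 / (r / 2) - 1/2 * e2 (fst h) / (2 * (r / 2) ^ 3)))
    = h \<bullet> (rect (4 * (1 / a\<^sup>2 + a / r ^ 3)) (4 * (1 / b\<^sup>2 + b / r ^ 3)), rect (c / 2) (d / 2))" for h :: phase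
  proof -
    have inner: "h \<bullet> (rect u v, rect u' v') = u * l1 (fst h) + v * l2 (fst h) + (u' * l1 (snd h) + v' * l2 (snd h))" for u v u' v'
      by (simp add: inner_prod_def inner_vec4 l1_def l2_def k_def field_simps)
    have "1/2 * e1 (fst h) / (2 * (r / 2) ^ 3) + 1/2 * e2 (fst h) / (2 * (r / 2) ^ 3) = 2 * (e1 (fst h) + e2 (fst h)) / r ^ 3"
      using r by (simp add: power_divide field_simps)
    also have "\<dots> = 4 * (a / r ^ 3) * l1 (fst h) + 4 * (b / r ^ 3) * l2 (fst h)"
      unfolding e by (simp add: add_divide_distrib)
    finally have 1: "1/2 * e1 (fst h) / (2 * (r / 2) ^ 3) + 1/2 * e2 (fst h) / (2 * (r / 2) ^ 3)
      = 4 * (a / r ^ 3) * l1 (fst h) + 4 * (b / r ^ 3) * l2 (fst h)" .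
    have 2: "2 * (4 * a * l1 (fst h)) / (2 * a ^ 3) = 4 * (1 / a\<^sup>2) * l1 (fst h)"
      "2 * (4 * b * l2 (fst h)) / (2 * b ^ 3) = 4 * (1 / b\<^sup>2) * l2 (fst h)"
      using ab by (simp_all add: power2_eq_square power3_eq_cube)
    define U V where "U = 1/2 * e1 (fst h) / (2 * (r / 2) ^ 3)" and "V = 1/2 * e2 (fst h) / (2 * (r / 2) ^ 3)"
    have V: "V = 4 * (a / r ^ 3) * l1 (fst h) + 4 * (b / r ^ 3) * l2 (fst h) - U" using 1 by (simp add: U_def V_def)
    show ?thesis
      unfolding inner 2 U_def[symmetric] V_def[symmetric] unfolding V by (simp add: algebra_simps)
  qed
  with dH show ?thesis by (simp only: gderiv_def P_def r_def)
qed

lemma antiderivative_exists: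
  fixes f :: "real \<Rightarrow> real"
  assumes "continuous_on UNIV f"
  obtains F where "F 0 = 0" "\<And>s. (F has_real_derivative f s) (at s)"
proof
  let ?F = "\<lambda>u. LBINT y=0..ereal u. f y"
  show "?F 0 = 0" by (simp flip: zero_ereal_def)
  fix s :: real
  have "(?F has_vector_derivative f s) (at s within {- \<bar>s\<bar> - 1..\<bar>s\<bar> + 1})"
    using interval_integral_FTC2[of "- \<bar>s\<bar> - 1" 0 "\<bar>s\<bar> + 1" f s] continuous_on_subset[OF assms]
    by (simp flip: zero_ereal_def)
  moreover have "at s within {- \<bar>s\<bar> - 1..\<bar>s\<bar> + 1} = at s"
    by (rule at_within_interior) auto
  ultimately show "(?F has_real_derivative f s) (at s)"
    by (simp add: has_real_derivative_iff_has_vector_derivative)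
qed

lemma has_vector_derivative_plane:
  assumes "(a has_real_derivative a') (at s)" "(b has_real_derivative b') (at s)"
  shows "((\<lambda>s. plane (a s) (b s)) has_vector_derivative plane a' b') (at s)"
  unfolding plane_eq[of "a _" "b _"] plane_eq[of a' b']
  using has_vector_derivative_add[OF
    has_vector_derivative_scaleR[OF assms(1) has_vector_derivative_const]
    has_vector_derivative_scaleR[OF assms(2) has_vector_derivative_const]]
  by simp

lemma has_vector_derivative_rect:
  assumes "(a has_real_derivative a') (at s)" "(b has_real_derivative b') (at s)"
  shows "((\<lambda>s. rect (a s) (b s)) has_vector_derivative rect a' b') (at s)"
  unfolding rect_eq[of "a _" "b _"] rect_eq[of a' b']
  using has_vector_derivative_add[OF
    has_vector_derivative_scaleR[OF assms(1) has_vector_derivative_const]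
    has_vector_derivative_scaleR[OF assms(2) has_vector_derivative_const]]
  by simp

section \<open>Symmetries, collisions and changes of coordinates on the plane\<close>

lemma cos_pi_8_pos: "cos (pi/8) > 0" and cos_pi_4_pos: "cos (pi/4) > 0"
  by (rule cos_gt_zero, use pi_gt_zero in linarith, use pi_gt_zero in linarith)+

lemma plane_inject: "plane a b = plane c d \<longleftrightarrow> a = c \<and> b = d"
  using cos_pi_8_pos by (auto simp: vec4_eq_iff)

lemma S_F_plane: "S_F (plane x y, plane p q) = (plane (- y) x, plane (- q) p)"
  and S_G_plane: "S_G (plane x y, plane p q) = (plane (- x) y, plane p (- q))"
  by (simp_all add: phase_eq_iff)

lemma regularized_sbc_plane:
  "regularized_sbc (plane x y, v) \<longleftrightarrow> x = 0 \<and> y \<noteq> 0 \<or> y = 0 \<and> x \<noteq> 0"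
  unfolding regularized_sbc_def case_prod_conv plane_squares by simp

lemma time_rate_plane: "time_rate (plane x y, v) = x\<^sup>2 * y\<^sup>2"
  unfolding time_rate_def case_prod_conv plane_squares ..

lemma Gamma_domain_plane: "(plane x y, v) \<in> Gamma_domain \<longleftrightarrow> x ^ 4 + y ^ 4 \<noteq> 0"
  by (simp only: Gamma_domain_def mem_Collect_eq case_prod_conv Let_def plane_quartic) simp

text \<open>A vanishing side is an SBC. Any other singularity needs a diagonal of length zero, that
  is, both sides zero.\<close>

lemma rect_collisions:
  assumes "a \<ge> 0" "b \<ge> 0" "a\<^sup>2 + b\<^sup>2 \<noteq> 0"
  shows "sbc_minus (rect a b) \<longleftrightarrow> a = 0" "sbc_plus (rect a b) \<longleftrightarrow> b = 0"
    "singular (rect a b) \<longleftrightarrow> a = 0 \<or> b = 0"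
proof -
  have n: "\<not> (a = 0 \<and> b = 0)" using assms(3) by auto
  note sq = rect_squares[of a b]
  show m: "sbc_minus (rect a b) \<longleftrightarrow> a = 0" and p: "sbc_plus (rect a b) \<longleftrightarrow> b = 0"
    using cos_pi_4_pos assms(3) unfolding sbc_minus_def sbc_plus_def sq by (auto simp: field_simps)
  have "\<not> binary_collision (rect a b)" "\<not> total_collapse (rect a b)"
    using cos_pi_4_pos n unfolding binary_collision_def total_collapse_def by auto
  then show "singular (rect a b) \<longleftrightarrow> a = 0 \<or> b = 0"
    using m p by (auto simp: singular_def)
qed

lemma position_change_plane: "position_change (plane x y) (rect (x\<^sup>2) (y\<^sup>2))"
proof -
  let ?g = "vector [cos (pi/4) * x\<^sup>2, - (cos (pi/4) * x\<^sup>2), cos (pi/4) * y\<^sup>2, cos (pi/4) * y\<^sup>2] :: real^4"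
  show ?thesis
    unfolding position_change_def plane_complex_squares
    by (rule exI[of _ ?g]) (simp add: field_simps)
qed

lemma momentum_change_plane:
  assumes "x \<noteq> 0" "y \<noteq> 0"
  shows "momentum_change (plane x y, plane p q) (rect (p / x) (q / y))"
proof -
  define al be k where "al = cos (pi/8)" and "be = sin (pi/8)" and "k = cos (pi/4)"
  have kr: "k * (al + be) = al" "k * (al - be) = be"
    using cos_sin_pi_8(1,2) by (simp_all add: al_def be_def k_def)
  \<comment> \<open>In complex notation the momentum relation is \<open>v = 2 * h * cnj u\<close>
    for each pair of coordinates. On the plane its solutions have lengths \<open>p / (2 * x)\<close>
    and \<open>q / (2 * y)\<close> up to sign, with arguments -pi/4 and pi/4.\<close>
  let ?h = "vector [k / 2 * (p / x), - (k / 2 * (p / x)), k / 2 * (q / y), k / 2 * (q / y)] :: real^4"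
  have "(k * (al + be)) * p = 2 * (k / 2 * (p / x)) * (al * x) + 2 * (- (k / 2 * (p / x))) * (- be * x)"
    "- (k * (al - be)) * p = - 2 * (k / 2 * (p / x)) * (- be * x) + 2 * (- (k / 2 * (p / x))) * (al * x)"
    "(k * (al + be)) * q = 2 * (k / 2 * (q / y)) * (al * y) + 2 * (k / 2 * (q / y)) * (be * y)"
    "(k * (al - be)) * q = - 2 * (k / 2 * (q / y)) * (be * y) + 2 * (k / 2 * (q / y)) * (al * y)"
    using assms by (simp_all add: field_simps)
  note v = this[unfolded kr]
  show ?thesis
    unfolding momentum_change_def case_prod_conv plane_nth rect_nth
    unfolding al_def[symmetric] be_def[symmetric] k_def[symmetric]
    by (rule exI[of _ ?h]) (use v in \<open>simp add: field_simps\<close>)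
qed

section \<open>The periodic orbit: collision times, symmetries and the change of time\<close>

context rectangle_orbit
begin

lemma x_0: "x 0 = 0"
  using reflect(1)[of 0] by simp

text \<open>On \<open>[- L, L]\<close> the product vanishes only at 0, and the shift by
  \<open>2 * L\<close> merely exchanges \<open>x\<close> and \<open>y\<close> up to sign.\<close>

lemma collision_times:
  assumes "x s * y s = 0"
  shows "\<exists>k::int. s = 2 * L * of_int k"
proof -
  let ?P = "\<lambda>s. x s * y s = 0 \<longrightarrow> (\<exists>k::int. s = 2 * L * of_int k)"
  have "?P s"
  proof (rule shift_invariant_from_period[OF L, of ?P])
    fix s assume s: "- L \<le> s" "s \<le> L"
    consider "s > 0" | "s = 0" | "s < 0" by linarith
    then show "?P s"
    proof cases
      case 1
      then show ?thesis using x_pos[of s] y_pos[of s] s by simp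
    next
      case 2
      then show ?thesis by (auto intro: exI[of _ 0])
    next
      case 3
      then show ?thesis using x_pos[of "- s"] y_pos[of "- s"] s by (simp add: reflect)
    qed
  next
    fix s
    have "(\<exists>k::int. s + 2 * L = 2 * L * of_int k) \<longleftrightarrow> (\<exists>k::int. s = 2 * L * of_int k)"
    proof
      assume "\<exists>k::int. s + 2 * L = 2 * L * of_int k"
      then obtain k :: int where "s + 2 * L = 2 * L * of_int k" by blast
      then have "s = 2 * L * of_int (k - 1)" by (simp add: algebra_simps)
      then show "\<exists>k::int. s = 2 * L * of_int k" by blast
    next
      assume "\<exists>k::int. s = 2 * L * of_int k"
      then obtain k :: int where "s = 2 * L * of_int k" by blast
      then have "s + 2 * L = 2 * L * of_int (k + 1)" by (simp add: algebra_simps)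
      then show "\<exists>k::int. s + 2 * L = 2 * L * of_int k" by blast
    qed
    then show "?P (s + 2 * L) \<longleftrightarrow> ?P s" by (simp only: quarter) (simp add: mult.commute)
  qed
  then show ?thesis using assms by blast
qed

text \<open>The period is \<open>8 * L\<close>. The shift of time by \<open>L\<close> moves the start from the collision to the
  diagonal.\<close>

definition X where "X s = x (s - L)"
definition Y where "Y s = y (s - L)"
definition P where "P s = p (s - L)"
definition Q where "Q s = q (s - L)"

lemma derivatives:
  "(X has_real_derivative P s * (Y s)\<^sup>2 / 4) (at s)"
  "(Y has_real_derivative Q s * (X s)\<^sup>2 / 4) (at s)"
  "(P has_real_derivative rect_force E (X s) (Y s) (Q s)) (at s)"
  "(Q has_real_derivative rect_force E (Y s) (X s) (P s)) (at s)"
proof -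
  have sh: "((\<lambda>s. f (s - L)) has_real_derivative f') (at s)" if "(f has_real_derivative f') (at (s - L))" for f f'
    using that DERIV_shift[of f f' s "- L"] by simp
  show "(X has_real_derivative P s * (Y s)\<^sup>2 / 4) (at s)"
    "(Y has_real_derivative Q s * (X s)\<^sup>2 / 4) (at s)"
    "(P has_real_derivative rect_force E (X s) (Y s) (Q s)) (at s)"
    "(Q has_real_derivative rect_force E (Y s) (X s) (P s)) (at s)"
    unfolding X_def[abs_def] Y_def[abs_def] P_def[abs_def] Q_def[abs_def]
    by (rule sh dx dy dp dq)+
qed

lemma energy': "rect_energy E (X s) (Y s) (P s) (Q s) = 0"
  and off_origin': "X s ^ 4 + Y s ^ 4 > 0"
  by (simp_all add: X_def Y_def P_def Q_def energy off_origin)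

lemma advance: "X (s + 2 * L) = Y s" "Y (s + 2 * L) = - X s" "P (s + 2 * L) = Q s" "Q (s + 2 * L) = - P s"
  using quarter[of "s - L"] by (simp_all add: X_def Y_def P_def Q_def algebra_simps)

text \<open>Half a period is minus the identity. Original positions depend on squares and original
  momenta on the quotients \<open>P / X\<close> and \<open>Q / Y\<close>, so the original orbit
  closes already after half the regularized period.\<close>

lemma advance_half: "X (s + 4 * L) = - X s" "Y (s + 4 * L) = - Y s" "P (s + 4 * L) = - P s" "Q (s + 4 * L) = - Q s"
proof -
  have "s + 4 * L = s + 2 * L + 2 * L" by simp
  then show "X (s + 4 * L) = - X s" "Y (s + 4 * L) = - Y s" "P (s + 4 * L) = - P s" "Q (s + 4 * L) = - Q s"
    by (simp_all only: advance)
qed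

lemma mirror: "X (2 * L - s) = - X s" "Y (2 * L - s) = Y s" "P (2 * L - s) = P s" "Q (2 * L - s) = - Q s"
  using reflect[of "s - L"] by (simp_all add: X_def Y_def P_def Q_def algebra_simps)

lemma initial: "X 0 = - Y 0" "Y 0 > 0" "Q 0 = P 0" "P 0 > 0"
  using reflect[of L] y_pos[of L] L diagonal by (simp_all add: X_def Y_def P_def Q_def)

lemma first_collision: "X L = 0" "Y L > 0"
  using y_pos[of 0] L by (simp_all add: X_def Y_def x_0)

lemma later_collisions:
  "X (3 * L) = Y L" "Y (3 * L) = 0" "X (5 * L) = 0" "Y (5 * L) = - Y L" "X (7 * L) = - Y L" "Y (7 * L) = 0"
  using advance[of L] advance_half[of L] advance[of "5 * L"] by (simp_all add: first_collision)

lemma collision_between: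
  assumes "X s * Y s = 0" "0 \<le> s" "s \<le> 4 * L"
  shows "s = L \<or> s = 3 * L"
proof -
  obtain k :: int where k: "s - L = 2 * L * of_int k"
    using collision_times[of "s - L"] assms(1) by (auto simp: X_def Y_def)
  then have s: "s = (2 * of_int k + 1) * L" by (simp add: algebra_simps)
  have "0 \<le> 2 * of_int k + (1::real)" using assms(2) L unfolding s by (simp add: zero_le_mult_iff)
  moreover have "2 * of_int k + (1::real) \<le> 4" using assms(3) L unfolding s by simp
  ultimately have "k = 0 \<or> k = 1" by linarith
  then show ?thesis using s by auto
qed

definition orbit :: "real \<Rightarrow> phase" where
  "orbit s = (plane (X s) (Y s), plane (P s) (Q s))"

lemma orbit_solves: "solves_hamiltonian (Gamma_hat 1 E) orbit UNIV"
  unfolding solves_hamiltonian_def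
proof
  fix s
  let ?Hq = "plane (- rect_force E (X s) (Y s) (Q s)) (- rect_force E (Y s) (X s) (P s))"
  let ?Hp = "plane (P s * (Y s)\<^sup>2 / 4) (Q s * (X s)\<^sup>2 / 4)"
  have "GDERIV (Gamma_hat 1 E) (orbit s) :> (?Hq, ?Hp)"
    unfolding orbit_def by (rule GDERIV_Gamma_hat_plane[OF off_origin'])
  moreover have "(orbit has_vector_derivative (?Hp, - ?Hq)) (at s)"
    unfolding orbit_def[abs_def] plane_minus minus_minus
    by (intro has_vector_derivative_Pair has_vector_derivative_plane derivatives)
  ultimately show "\<exists>Hq Hp. GDERIV (Gamma_hat 1 E) (orbit s) :> (Hq, Hp) \<and>
      (orbit has_vector_derivative (Hp, - Hq)) (at s)" by blast
qed

lemma orbit_symmetries: "S_F (orbit s) = orbit (s + - 2 * L)" "S_G (orbit s) = orbit (2 * L - s)"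
  using advance[of "s - 2 * L"] by (simp_all add: orbit_def S_F_plane S_G_plane mirror)

text \<open>The rate vanishes at collisions, but these are countable and fill no interval, so
  \<open>\<tau>\<close> is still strictly increasing. It is onto because every shift by
  \<open>2 * L\<close> adds the same positive amount. Symmetry of the rate about the collision at
  \<open>L\<close> places the collisions at exact quarters of the original period.\<close>

lemma time_change:
  obtains \<tau> where "\<tau> 0 = 0" "bij \<tau>" "strict_mono \<tau>" "\<And>s. (\<tau> has_real_derivative time_rate (orbit s)) (at s)"
    "\<And>s. \<tau> (s + 4 * L) = \<tau> s + \<tau> (4 * L)" "\<tau> L = \<tau> (4 * L) / 4" "\<tau> (3 * L) = 3 * \<tau> (4 * L) / 4"
proof -
  define \<rho> where "\<rho> s = (X s)\<^sup>2 * (Y s)\<^sup>2" for s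
  have rate: "time_rate (orbit s) = \<rho> s" for s by (simp add: orbit_def time_rate_plane \<rho>_def)
  have "continuous_on UNIV X" "continuous_on UNIV Y"
    by (rule DERIV_continuous_on, rule has_field_derivative_at_within, rule derivatives)+
  then have "continuous_on UNIV \<rho>"
    unfolding \<rho>_def by (intro continuous_intros)
  then obtain \<tau> where \<tau>0: "\<tau> 0 = 0" and d: "\<And>s. (\<tau> has_real_derivative \<rho> s) (at s)"
    by (rule antiderivative_exists) blast
  have mono: "\<tau> a \<le> \<tau> b" if "a \<le> b" for a b
  proof (rule DERIV_nonneg_imp_nondecreasing[OF that])
    show "\<exists>d. (\<tau> has_real_derivative d) (at u) \<and> 0 \<le> d" for u
      using d[of u] by (intro exI[of _ "\<rho> u"]) (simp add: \<rho>_def)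
  qed
  have strict: "\<tau> a < \<tau> b" if ab: "a < b" for a b
  proof (rule ccontr)
    assume "\<not> \<tau> a < \<tau> b"
    then have const: "\<tau> u = \<tau> a" if "u \<in> {a..b}" for u
      using mono[of a u] mono[of u b] that by auto
    have "X u * Y u = 0" if u: "u \<in> {a<..<b}" for u
    proof -
      have "(\<tau> has_real_derivative 0) (at u)"
      proof (rule has_field_derivative_transform_within_open[where S = "{a<..<b}" and f = "\<lambda>_. \<tau> a"])
        show "\<tau> a = \<tau> v" if "v \<in> {a<..<b}" for v using const[of v] that by simp
      qed (use u in auto)
      then have "\<rho> u = 0" using d DERIV_unique by blast
      then show ?thesis by (auto simp: \<rho>_def)
    qed
    note zero = this
    have "{a<..<b} \<subseteq> range (\<lambda>k::int. 2 * L * of_int k + L)"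
    proof
      fix u assume "u \<in> {a<..<b}"
      then obtain k :: int where "u - L = 2 * L * of_int k"
        using zero[of u] collision_times[of "u - L"] by (auto simp: X_def Y_def)
      then have "u = 2 * L * of_int k + L" by simp
      then show "u \<in> range (\<lambda>k::int. 2 * L * of_int k + L)" by blast
    qed
    then have "countable {a<..<b}" by (rule countable_subset) simp
    then show False using uncountable_open_interval ab by blast
  qed
  have shift2: "\<tau> (s + 2 * L) = \<tau> s + \<tau> (2 * L)" for s
  proof -
    have "((\<lambda>s. \<tau> (s + 2 * L) - \<tau> s) has_real_derivative 0) (at s)" for s
    proof -
      have "((\<lambda>s. \<tau> (s + 2 * L)) has_real_derivative \<rho> (s + 2 * L)) (at s)"
        using d[of "s + 2 * L"] by (simp only: DERIV_shift)
      moreover have "\<rho> (s + 2 * L) = \<rho> s"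
        unfolding \<rho>_def advance by (simp add: mult.commute)
      ultimately show ?thesis using DERIV_diff[OF _ d] by fastforce
    qed
    then have "\<tau> (s + 2 * L) - \<tau> s = \<tau> (0 + 2 * L) - \<tau> 0" by (intro DERIV_isconst_all) auto
    then show ?thesis by (simp add: \<tau>0)
  qed
  have half: "\<tau> L = \<tau> (2 * L) / 2"
  proof -
    have "((\<lambda>s. \<tau> (2 * L - s) + \<tau> s) has_real_derivative 0) (at s)" for s
    proof -
      have "((\<lambda>s. 2 * L - s) has_real_derivative -1) (at s)" by (auto intro!: derivative_eq_intros)
      from DERIV_chain2[where f = \<tau> and g = "\<lambda>s. 2 * L - s" and x = s, OF d this]
      have "((\<lambda>s. \<tau> (2 * L - s)) has_real_derivative \<rho> (2 * L - s) * -1) (at s)" .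
      from DERIV_add[OF this d] show ?thesis by (simp add: \<rho>_def mirror)
    qed
    then have "\<tau> (2 * L - L) + \<tau> L = \<tau> (2 * L - 0) + \<tau> 0" by (intro DERIV_isconst_all) auto
    then show ?thesis by (simp add: \<tau>0)
  qed
  have four: "\<tau> (4 * L) = 2 * \<tau> (2 * L)" using shift2[of "2 * L"] by simp
  have M: "\<tau> (2 * L) > 0" using strict[of 0 "2 * L"] L \<tau>0 by simp
  have far: "\<tau> (2 * L * real n) = real n * \<tau> (2 * L)" "\<tau> (- (2 * L * real n)) = - (real n * \<tau> (2 * L))" for n
  proof (induction n)
    case (Suc n)
    show "\<tau> (2 * L * real (Suc n)) = real (Suc n) * \<tau> (2 * L)"
      using shift2[of "2 * L * real n"] Suc by (simp add: algebra_simps)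
    show "\<tau> (- (2 * L * real (Suc n))) = - (real (Suc n) * \<tau> (2 * L))"
      using shift2[of "- (2 * L * real (Suc n))"] Suc by (simp add: algebra_simps)
  qed (simp_all add: \<tau>0)
  have "surj \<tau>"
  proof (rule surjI)
    fix t
    obtain n where "\<bar>t\<bar> / \<tau> (2 * L) \<le> real n" using real_arch_simple by blast
    then have n: "\<bar>t\<bar> \<le> real n * \<tau> (2 * L)" using M by (simp add: divide_le_eq)
    have "\<exists>s. - (2 * L * real n) \<le> s \<and> s \<le> 2 * L * real n \<and> \<tau> s = t"
      using n L d by (intro IVT) (auto simp: far intro: DERIV_isCont)
    then show "\<tau> (SOME s. \<tau> s = t) = t" by (metis (mono_tags) someI)
  qed
  moreover have "strict_mono \<tau>" using strict by (simp add: strict_mono_def)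
  ultimately have "bij \<tau>" by (simp add: bij_def strict_mono_imp_inj_on)
  show ?thesis
  proof (rule that[OF \<tau>0 \<open>bij \<tau>\<close> \<open>strict_mono \<tau>\<close>])
    show "(\<tau> has_real_derivative time_rate (orbit s)) (at s)" for s using d by (simp add: rate)
    show "\<tau> (s + 4 * L) = \<tau> s + \<tau> (4 * L)" for s
    proof -
      have "s + 4 * L = s + 2 * L + 2 * L" by simp
      then show ?thesis by (simp only: shift2 four)
    qed
    show "\<tau> L = \<tau> (4 * L) / 4" by (simp add: four half)
    show "\<tau> (3 * L) = 3 * \<tau> (4 * L) / 4" using shift2[of L] by (simp add: four half)
  qed
qed

text \<open>Both are instances of \<open>DERIV_slope\<close>, the first with the sides exchanged.
  The last factor is the rate of time; the other one is the Newtonian force found in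
  \<open>GDERIV_pps4bp_rect\<close>.\<close>

lemma momentum_derivatives:
  assumes "X s \<noteq> 0" "Y s \<noteq> 0"
  shows "((\<lambda>s. P s / X s) has_real_derivative
      - (4 * (1 / ((X s)\<^sup>2)\<^sup>2 + (X s)\<^sup>2 / sqrt (((X s)\<^sup>2)\<^sup>2 + ((Y s)\<^sup>2)\<^sup>2) ^ 3)) * ((X s)\<^sup>2 * (Y s)\<^sup>2)) (at s)"
    "((\<lambda>s. Q s / Y s) has_real_derivative
      - (4 * (1 / ((Y s)\<^sup>2)\<^sup>2 + (Y s)\<^sup>2 / sqrt (((X s)\<^sup>2)\<^sup>2 + ((Y s)\<^sup>2)\<^sup>2) ^ 3)) * ((X s)\<^sup>2 * (Y s)\<^sup>2)) (at s)"
proof -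
  have eq: "- (4 * c\<^sup>2 / a\<^sup>2) * (1 + a ^ 6 / R) = - (4 * (1 / (a\<^sup>2)\<^sup>2 + a\<^sup>2 / R)) * (a\<^sup>2 * c\<^sup>2)"
    if "a \<noteq> 0" "R \<noteq> 0" for a c R :: real
    using that by (simp add: field_simps)
  have R: "sqrt (X s ^ 4 + Y s ^ 4) ^ 3 \<noteq> 0" "sqrt (Y s ^ 4 + X s ^ 4) ^ 3 \<noteq> 0"
    using off_origin'[of s] by (simp_all add: add.commute)
  have n: "Y s ^ 4 + X s ^ 4 > 0" using off_origin'[of s] by (simp add: add.commute)
  have "rect_energy E (Y s) (X s) (Q s) (P s) = 0" using energy' by (simp add: rect_energy_commute)
  from DERIV_slope[where x = Y and y = X and p = Q and q = P, OF derivatives(1,3) this n assms(1)]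
  show "((\<lambda>s. P s / X s) has_real_derivative
      - (4 * (1 / ((X s)\<^sup>2)\<^sup>2 + (X s)\<^sup>2 / sqrt (((X s)\<^sup>2)\<^sup>2 + ((Y s)\<^sup>2)\<^sup>2) ^ 3)) * ((X s)\<^sup>2 * (Y s)\<^sup>2)) (at s)"
    unfolding eq[OF assms(1) R(2)] by (simp add: add.commute flip: power_mult)
  from DERIV_slope[where x = X and y = Y and p = P and q = Q, OF derivatives(2,4) energy' off_origin' assms(2)]
  show "((\<lambda>s. Q s / Y s) has_real_derivative
      - (4 * (1 / ((Y s)\<^sup>2)\<^sup>2 + (Y s)\<^sup>2 / sqrt (((X s)\<^sup>2)\<^sup>2 + ((Y s)\<^sup>2)\<^sup>2) ^ 3)) * ((X s)\<^sup>2 * (Y s)\<^sup>2)) (at s)"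
    unfolding eq[OF assms(2) R(1)] by (simp add: mult.commute flip: power_mult)
qed

lemma corresponding_orbit:
  "\<exists>(x :: real \<Rightarrow> real^4) (\<omega> :: real \<Rightarrow> real^4) (R :: real).
      corresponds orbit x \<omega> \<and>
      solves_hamiltonian (pps4bp_H 1) (\<lambda>t. (x t, \<omega> t)) {t. \<not> singular (x t)} \<and>
      (\<forall>t. \<not> singular (x t) \<longrightarrow> pps4bp_H 1 (x t, \<omega> t) = E) \<and>
      (\<forall>t. x t $ 4 = x t $ 1 \<and> x t $ 3 = x t $ 2 \<and> \<bar>x t $ 2\<bar> \<le> x t $ 1) \<and>
      (\<forall>t. \<not> singular (x t) \<longrightarrow> \<omega> t $ 4 = \<omega> t $ 1 \<and> \<omega> t $ 3 = \<omega> t $ 2) \<and>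
      x 0 $ 1 > 0 \<and> x 0 $ 2 = 0 \<and> \<omega> 0 $ 1 = 0 \<and> \<omega> 0 $ 2 > 0 \<and>
      R = integral {0..4 * L} (\<lambda>s. time_rate (orbit s)) \<and> R > 0 \<and>
      (\<forall>t. x (t + R) = x t) \<and>
      (\<forall>t. \<not> singular (x t) \<longrightarrow> \<omega> (t + R) = \<omega> t) \<and>
      (\<forall>t \<in> {0..R}. singular (x t) \<longleftrightarrow> t = R/4 \<or> t = 3*R/4) \<and>
      (sbc_minus (x (R/4)) \<and> sbc_plus (x (3*R/4)) \<or>
       sbc_plus (x (R/4)) \<and> sbc_minus (x (3*R/4)))"
proof -
  obtain \<tau> where \<tau>0: "\<tau> 0 = 0" and bij: "bij \<tau>" and mono: "strict_mono \<tau>"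
    and d\<tau>: "\<And>s. (\<tau> has_real_derivative time_rate (orbit s)) (at s)"
    and period: "\<And>s. \<tau> (s + 4 * L) = \<tau> s + \<tau> (4 * L)"
    and quarters: "\<tau> L = \<tau> (4 * L) / 4" "\<tau> (3 * L) = 3 * \<tau> (4 * L) / 4"
    by (rule time_change) blast
  have rate: "time_rate (orbit s) = (X s)\<^sup>2 * (Y s)\<^sup>2" for s by (simp add: orbit_def time_rate_plane)
  define \<sigma> where "\<sigma> = inv_into UNIV \<tau>"
  have \<sigma>\<tau>: "\<sigma> (\<tau> s) = s" and \<tau>\<sigma>: "\<tau> (\<sigma> t) = t" for s t
    using bij by (simp_all add: \<sigma>_def bij_def surj_f_inv_f)
  define R where "R = \<tau> (4 * L)"
  define pos where "pos t = rect ((X (\<sigma> t))\<^sup>2) ((Y (\<sigma> t))\<^sup>2)" for t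
  \<comment> \<open>At a collision time one denominator vanishes and the quotient is 0 by
    convention, so the algebraic relations between the components hold there too.\<close>
  define mom where "mom t = rect (P (\<sigma> t) / X (\<sigma> t)) (Q (\<sigma> t) / Y (\<sigma> t))" for t
  have off: "((X s)\<^sup>2)\<^sup>2 + ((Y s)\<^sup>2)\<^sup>2 > 0" for s using off_origin'[of s] by (simp flip: power_mult)
  note coll = rect_collisions[OF zero_le_power2 zero_le_power2 less_imp_neq[OF off, symmetric]]
  have sing: "singular (pos t) \<longleftrightarrow> X (\<sigma> t) = 0 \<or> Y (\<sigma> t) = 0" for t
    unfolding pos_def coll by simp
  have R: "R > 0" using strict_monoD[OF mono, of 0 "4 * L"] L by (simp add: R_def \<tau>0)
  have d\<sigma>: "(\<sigma> has_real_derivative 1 / ((X (\<sigma> t))\<^sup>2 * (Y (\<sigma> t))\<^sup>2)) (at t)" if "\<not> singular (pos t)" for t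
  proof -
    have "isCont \<sigma> (\<tau> (\<sigma> t))"
      by (rule isCont_inverse_function[where d = 1]) (use \<sigma>\<tau> d\<tau> in \<open>auto intro: DERIV_isCont\<close>)
    then have "isCont \<sigma> t" by (simp add: \<tau>\<sigma>)
    moreover have "(X (\<sigma> t))\<^sup>2 * (Y (\<sigma> t))\<^sup>2 \<noteq> 0" using that by (simp add: sing)
    ultimately have "(\<sigma> has_real_derivative inverse ((X (\<sigma> t))\<^sup>2 * (Y (\<sigma> t))\<^sup>2)) (at t)"
      using d\<tau>[of "\<sigma> t"] \<tau>\<sigma> unfolding rate
      by (intro DERIV_inverse_function[where f = \<tau> and a = "t - 1" and b = "t + 1"]) auto
    then show ?thesis by (simp add: inverse_eq_divide)
  qed
  \<comment> \<open>The derivative in regularized time is required with the rate as an explicit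
    factor, which the derivative of \<open>\<sigma>\<close> then cancels.\<close>
  have chain: "((\<lambda>t. f (\<sigma> t)) has_real_derivative f') (at t)"
    if "(f has_real_derivative f' * ((X (\<sigma> t))\<^sup>2 * (Y (\<sigma> t))\<^sup>2)) (at (\<sigma> t))" "\<not> singular (pos t)" for f f' t
    using DERIV_chain2[where f = f and g = \<sigma> and x = t, OF that(1) d\<sigma>[OF that(2)]] that(2)
    by (simp add: sing)
  have "corresponds orbit pos mom"
    unfolding corresponds_def
  proof (intro exI[of _ \<tau>] conjI allI impI \<tau>0 bij d\<tau>)
    fix s
    show "position_change (fst (orbit s)) (pos (\<tau> s))"
      by (simp add: orbit_def pos_def \<sigma>\<tau> position_change_plane)
    assume "\<not> singular (pos (\<tau> s))"
    then show "momentum_change (orbit s) (mom (\<tau> s))"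
      unfolding orbit_def mom_def \<sigma>\<tau> by (intro momentum_change_plane) (auto simp: sing \<sigma>\<tau>)
  qed
  moreover have "solves_hamiltonian (pps4bp_H 1) (\<lambda>t. (pos t, mom t)) {t. \<not> singular (pos t)}"
    unfolding solves_hamiltonian_def
  proof
    fix t assume "t \<in> {t. \<not> singular (pos t)}"
    then have ns: "\<not> singular (pos t)" by simp
    then have XY: "X (\<sigma> t) \<noteq> 0" "Y (\<sigma> t) \<noteq> 0" by (simp_all add: sing)
    define s where "s = \<sigma> t"
    define r where "r = sqrt (((X s)\<^sup>2)\<^sup>2 + ((Y s)\<^sup>2)\<^sup>2)"
    let ?f = "4 * (1 / ((X s)\<^sup>2)\<^sup>2 + (X s)\<^sup>2 / r ^ 3)" and ?g = "4 * (1 / ((Y s)\<^sup>2)\<^sup>2 + (Y s)\<^sup>2 / r ^ 3)"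
    have "GDERIV (pps4bp_H 1) (pos t, mom t) :> (rect ?f ?g, rect (P s / X s / 2) (Q s / Y s / 2))"
      unfolding pos_def mom_def r_def s_def by (rule GDERIV_pps4bp_rect) (use XY in simp_all)
    moreover have "((\<lambda>t. (pos t, mom t)) has_vector_derivative
        (rect (P s / X s / 2) (Q s / Y s / 2), - rect ?f ?g)) (at t)"
      unfolding rect_minus pos_def mom_def
    proof (intro has_vector_derivative_Pair has_vector_derivative_rect)
      have "((\<lambda>s. (X s)\<^sup>2) has_real_derivative P s / X s / 2 * ((X s)\<^sup>2 * (Y s)\<^sup>2)) (at s)"
        using DERIV_power[OF derivatives(1), of 2 s] XY by (simp add: s_def power2_eq_square field_simps)
      then show "((\<lambda>t. (X (\<sigma> t))\<^sup>2) has_real_derivative P s / X s / 2) (at t)"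
        unfolding s_def by (rule chain[OF _ ns])
      have "((\<lambda>s. (Y s)\<^sup>2) has_real_derivative Q s / Y s / 2 * ((X s)\<^sup>2 * (Y s)\<^sup>2)) (at s)"
        using DERIV_power[OF derivatives(2), of 2 s] XY by (simp add: s_def power2_eq_square field_simps)
      then show "((\<lambda>t. (Y (\<sigma> t))\<^sup>2) has_real_derivative Q s / Y s / 2) (at t)"
        unfolding s_def by (rule chain[OF _ ns])
      show "((\<lambda>t. P (\<sigma> t) / X (\<sigma> t)) has_real_derivative - ?f) (at t)"
        using chain[OF momentum_derivatives(1)[OF XY] ns] by (simp add: r_def s_def)
      show "((\<lambda>t. Q (\<sigma> t) / Y (\<sigma> t)) has_real_derivative - ?g) (at t)"
        using chain[OF momentum_derivatives(2)[OF XY] ns] by (simp add: r_def s_def)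
    qed
    ultimately show "\<exists>Hq Hp. GDERIV (pps4bp_H 1) (pos t, mom t) :> (Hq, Hp) \<and>
        ((\<lambda>t. (pos t, mom t)) has_vector_derivative (Hp, - Hq)) (at t)" by blast
  qed
  moreover have "pps4bp_H 1 (pos t, mom t) = E" if "\<not> singular (pos t)" for t
  proof -
    define s where "s = \<sigma> t"
    have XY: "X s \<noteq> 0" "Y s \<noteq> 0" using that by (simp_all add: sing s_def)
    define r where "r = sqrt (X s ^ 4 + Y s ^ 4)"
    have "pps4bp_H 1 (pos t, mom t) = ((P s / X s)\<^sup>2 + (Q s / Y s)\<^sup>2) / 8 - 2 / (X s)\<^sup>2 - 2 / (Y s)\<^sup>2 - 2 / r"
      unfolding pos_def mom_def s_def[symmetric]
      by (subst pps4bp_H_rect) (use XY in \<open>simp_all add: r_def flip: power_mult\<close>)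
    \<comment> \<open>Away from collisions, multiplication by the rate of time turns the energy
      relation into the zero level of \<open>rect_energy\<close>.\<close>
    moreover have "(X s)\<^sup>2 * (Y s)\<^sup>2 * (((P s / X s)\<^sup>2 + (Q s / Y s)\<^sup>2) / 8 - 2 / (X s)\<^sup>2 - 2 / (Y s)\<^sup>2 - 2 / r)
      = (X s)\<^sup>2 * (Y s)\<^sup>2 * E"
    proof -
      have "(X s)\<^sup>2 * (Y s)\<^sup>2 * (((P s / X s)\<^sup>2 + (Q s / Y s)\<^sup>2) / 8 - 2 / (X s)\<^sup>2 - 2 / (Y s)\<^sup>2 - 2 / r)
        = ((P s)\<^sup>2 * (Y s)\<^sup>2 + (Q s)\<^sup>2 * (X s)\<^sup>2) / 8 - 2 * (Y s)\<^sup>2 - 2 * (X s)\<^sup>2 - 2 * ((X s)\<^sup>2 * (Y s)\<^sup>2 / r)"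
        using XY by (simp add: power_divide right_diff_distrib distrib_left add_divide_distrib mult_ac)
      also have "\<dots> = (X s)\<^sup>2 * (Y s)\<^sup>2 * E"
        using energy'[of s] unfolding rect_energy_def r_def[symmetric] by (simp add: algebra_simps)
      finally show ?thesis .
    qed
    ultimately show ?thesis using XY by simp
  qed
  moreover have "pos t $ 4 = pos t $ 1 \<and> pos t $ 3 = pos t $ 2 \<and> \<bar>pos t $ 2\<bar> \<le> pos t $ 1" for t
    using cos_pi_4_pos by (simp add: pos_def abs_mult abs_le_iff)
  moreover have "mom t $ 4 = mom t $ 1 \<and> mom t $ 3 = mom t $ 2" for t
    by (simp add: mom_def)
  moreover have "\<sigma> 0 = 0" using \<sigma>\<tau>[of 0] by (simp add: \<tau>0)
  then have "pos 0 $ 1 > 0" "pos 0 $ 2 = 0" "mom 0 $ 1 = 0" "mom 0 $ 2 > 0"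
    using initial cos_pi_4_pos by (simp_all add: pos_def mom_def add_pos_pos)
  moreover have "R = integral {0..4 * L} (\<lambda>s. time_rate (orbit s))"
  proof -
    have "((\<lambda>s. time_rate (orbit s)) has_integral \<tau> (4 * L) - \<tau> 0) {0..4 * L}"
      using L d\<tau> by (intro fundamental_theorem_of_calculus)
        (auto simp flip: has_real_derivative_iff_has_vector_derivative intro: has_field_derivative_at_within)
    then show ?thesis by (simp add: R_def \<tau>0 integral_unique)
  qed
  moreover have shift: "\<sigma> (t + R) = \<sigma> t + 4 * L" for t
    using period[of "\<sigma> t"] \<sigma>\<tau>[of "\<sigma> t + 4 * L"] by (simp add: R_def \<tau>\<sigma>)
  have "pos (t + R) = pos t" "mom (t + R) = mom t" for t
    by (simp_all add: pos_def mom_def shift advance_half)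
  moreover have "\<sigma> (R / 4) = L" "\<sigma> (3 * R / 4) = 3 * L"
    using \<sigma>\<tau>[of L] \<sigma>\<tau>[of "3 * L"] by (simp_all add: R_def quarters)
  note at_quarters = this
  moreover have "singular (pos t) \<longleftrightarrow> t = R / 4 \<or> t = 3 * R / 4" if "t \<in> {0..R}" for t
  proof
    assume "singular (pos t)"
    moreover have "0 \<le> \<sigma> t" "\<sigma> t \<le> 4 * L"
      using that strict_mono_less_eq[OF mono, of 0 "\<sigma> t"] strict_mono_less_eq[OF mono, of "\<sigma> t" "4 * L"]
      by (simp_all add: \<tau>\<sigma> \<tau>0 R_def)
    ultimately have "\<sigma> t = L \<or> \<sigma> t = 3 * L" by (intro collision_between) (auto simp: sing)
    then show "t = R / 4 \<or> t = 3 * R / 4" using \<tau>\<sigma>[of t] quarters by (auto simp: R_def)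
  next
    assume "t = R / 4 \<or> t = 3 * R / 4"
    then show "singular (pos t)"
      by (auto simp only: sing at_quarters first_collision later_collisions)
  qed
  moreover have "sbc_minus (pos (R / 4)) \<and> sbc_plus (pos (3 * R / 4))"
    unfolding pos_def coll at_quarters by (simp add: first_collision later_collisions)
  ultimately show ?thesis using R by (intro exI[of _ pos] exI[of _ mom] exI[of _ R]) blast
qed

end

theorem theorem5p2:
  fixes E :: real
  assumes "E < 0"
  shows "\<exists>(\<gamma> :: real \<Rightarrow> phase) (T :: real).
    T > 0 \<and> (\<forall>s. \<gamma> (s + T) = \<gamma> s) \<and>
    range \<gamma> \<subseteq> Gamma_domain \<and>
    solves_hamiltonian (Gamma_hat 1 E) \<gamma> UNIV \<and>
    (\<forall>s. Gamma_hat 1 E (\<gamma> s) = 0) \<and>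
    (\<forall>s. angular_momentum (\<gamma> s) = 0) \<and>
    time_reversible \<gamma> \<and>
    symmetry_group \<gamma> \<cong> D4 \<and>
    (\<forall>s \<in> {T/8, 3*T/8, 5*T/8, 7*T/8}. regularized_sbc (\<gamma> s)) \<and>
    distinct [\<gamma> (T/8), \<gamma> (3*T/8), \<gamma> (5*T/8), \<gamma> (7*T/8)] \<and>
    (\<exists>(x :: real \<Rightarrow> real^4) (\<omega> :: real \<Rightarrow> real^4) (R :: real).
      corresponds \<gamma> x \<omega> \<and>
      solves_hamiltonian (pps4bp_H 1) (\<lambda>t. (x t, \<omega> t)) {t. \<not> singular (x t)} \<and>
      (\<forall>t. \<not> singular (x t) \<longrightarrow> pps4bp_H 1 (x t, \<omega> t) = E) \<and>
      (\<forall>t. x t $ 4 = x t $ 1 \<and> x t $ 3 = x t $ 2 \<and> \<bar>x t $ 2\<bar> \<le> x t $ 1) \<and>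
      (\<forall>t. \<not> singular (x t) \<longrightarrow> \<omega> t $ 4 = \<omega> t $ 1 \<and> \<omega> t $ 3 = \<omega> t $ 2) \<and>
      x 0 $ 1 > 0 \<and> x 0 $ 2 = 0 \<and> \<omega> 0 $ 1 = 0 \<and> \<omega> 0 $ 2 > 0 \<and>
      R = integral {0..T/2} (\<lambda>s. time_rate (\<gamma> s)) \<and> R > 0 \<and>
      (\<forall>t. x (t + R) = x t) \<and>
      (\<forall>t. \<not> singular (x t) \<longrightarrow> \<omega> (t + R) = \<omega> t) \<and>
      (\<forall>t \<in> {0..R}. singular (x t) \<longleftrightarrow> t = R/4 \<or> t = 3*R/4) \<and>
      (sbc_minus (x (R/4)) \<and> sbc_plus (x (3*R/4)) \<or>
       sbc_plus (x (R/4)) \<and> sbc_minus (x (3*R/4))))"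
proof -
  obtain x y p q L where "rectangle_orbit E x y p q L"
    using rectangle_orbit_every_energy[OF assms] .
  then interpret rectangle_orbit E x y p q L .
  have "S_G \<in> FG_set" unfolding FG_set_def by (rule generate.incl) simp
  moreover have F: "time_preserving orbit S_F" and G: "time_reversing orbit S_G"
    unfolding time_preserving_def time_reversing_def using orbit_symmetries by blast+
  ultimately have "time_reversible orbit" by (auto simp: time_reversible_def)
  moreover have "symmetry_group orbit \<cong> D4" by (rule symmetry_group_iso_D4[OF F G])
  moreover have "orbit (s + 8 * L) = orbit s" for s
    using advance_half[of s] advance_half[of "s + 4 * L"] by (simp add: orbit_def algebra_simps)
  moreover have "range orbit \<subseteq> Gamma_domain"
    using off_origin' by (auto simp: orbit_def Gamma_domain_plane less_imp_neq[symmetric])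
  moreover have "Gamma_hat 1 E (orbit s) = 0" for s
    by (simp add: orbit_def Gamma_hat_plane energy')
  moreover have "angular_momentum (orbit s) = 0" for s
    by (simp add: orbit_def angular_momentum_def)
  moreover have "regularized_sbc (orbit s)" if "s \<in> {L, 3 * L, 5 * L, 7 * L}" for s
    using that first_collision by (auto simp: orbit_def regularized_sbc_plane later_collisions)
  \<comment> \<open>With \<open>c = Y L > 0\<close> the pair \<open>(X, Y)\<close> takes the values
    \<open>(0, c)\<close>, \<open>(c, 0)\<close>, \<open>(0, - c)\<close>, \<open>(- c, 0)\<close>
    at the four collisions.\<close>
  moreover have "distinct [orbit L, orbit (3 * L), orbit (5 * L), orbit (7 * L)]"
    using first_collision by (simp add: orbit_def plane_inject later_collisions)
  ultimately show ?thesis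
    using L orbit_solves corresponding_orbit
    by (intro exI[of _ orbit] exI[of _ "8 * L"] conjI) simp_all
qed

end
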